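(* Let $\eta$ be a Poisson process on a measurable space $(\mathbb X,\mathcal X)$ with $\sigma$-finite intensity measure $\lambda$, and let $g:\mathbb X\times\mathbf N\to[0,\infty)$ be measurable with $\mathbb E[g(x,\eta)^2]<\infty$ for $\lambda$-a.e. $x$. Assume that for some $\alpha>0$, $$\mathbb E\Big[\int_{\mathbb X^2}(D_yg(x,\eta))^2\,\lambda^2(\mathrm dx,\mathrm dy)\Big]\le\alpha\,\mathbb E\Big[\int_{\mathbb X}g(x,\eta)^2\,\lambda(\mathrm dx)\Big]<\infty.$$ Then $$\int_0^\infty e^{-t}\int_{\mathbb X}\mathbb E[g(x,\eta)g(x,\eta^t)]\,\lambda(\mathrm dx)\,\mathrm dt\ge\frac1{\alpha+1}\,\mathbb E\Big[\int_{\mathbb X}g(x,\eta)^2\,\lambda(\mathrm dx)\Big].$$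
   Context: $\mathbf N$ is the space of $\sigma$-finite counting measures on $\mathbb X$. $D_yg(x,\mu)=g(x,\mu+\delta_y)-g(x,\mu)$. For $t\ge0$, $\eta^t$ is obtained by keeping each point of $\eta$ independently with probability $e^{-t}$ and adding an independent Poisson process with intensity $(1-e^{-t})\lambda$. *)

theory Defs
  imports "HOL-Probability.Probability"
begin

text \<open>Counting measures on the measurable space underlying the measure lam are
represented as set functions 'a set => ennreal (value 0 outside the sigma-algebra).
N = measures that are countable sums of finite N_0-valued measures.\<close>

definition Nset :: "'a measure \<Rightarrow> ('a set \<Rightarrow> ennreal) set" where
  "Nset L = {\<mu>. (\<forall>B. B \<notin> sets L \<longrightarrow> \<mu> B = 0) \<and>
     (\<exists>\<nu> :: nat \<Rightarrow> 'a set \<Rightarrow> nat.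
        (\<forall>n. measure_space (space L) (sets L) (\<lambda>B. of_nat (\<nu> n B))) \<and>
        (\<forall>B\<in>sets L. \<mu> B = (\<Sum>n. of_nat (\<nu> n B))))}"

definition N_meas :: "'a measure \<Rightarrow> ('a set \<Rightarrow> ennreal) measure" where
  "N_meas L = sigma (Nset L)
     (\<Union>B\<in>sets L. {(\<lambda>\<mu>. \<mu> B) -` A \<inter> Nset L | A. A \<in> sets (borel :: ennreal measure)})"

definition cm_dirac :: "'a measure \<Rightarrow> 'a \<Rightarrow> 'a set \<Rightarrow> ennreal" where
  "cm_dirac L y = (\<lambda>B. if B \<in> sets L then indicator B y else 0)"

definition cm_add :: "('a set \<Rightarrow> ennreal) \<Rightarrow> ('a set \<Rightarrow> ennreal) \<Rightarrow> 'a set \<Rightarrow> ennreal" where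
  "cm_add \<mu> \<nu> = (\<lambda>B. \<mu> B + \<nu> B)"

definition Dop :: "'a measure \<Rightarrow> ('a \<Rightarrow> ('a set \<Rightarrow> ennreal) \<Rightarrow> real) \<Rightarrow> 'a \<Rightarrow> 'a
                    \<Rightarrow> ('a set \<Rightarrow> ennreal) \<Rightarrow> real" where
  "Dop L g y x \<mu> = g x (cm_add \<mu> (cm_dirac L y)) - g x \<mu>"

definition poisson_process :: "'w measure \<Rightarrow> 'a measure \<Rightarrow> ('w \<Rightarrow> 'a set \<Rightarrow> ennreal) \<Rightarrow> bool" where
  "poisson_process P L \<eta> \<longleftrightarrow>
     prob_space P \<and> \<eta> \<in> measurable P (N_meas L) \<and>
     (\<forall>B\<in>sets L. emeasure L B < \<infinity> \<longrightarrow>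
        (\<forall>k::nat. measure P {\<omega>\<in>space P. \<eta> \<omega> B = of_nat k} =
            exp (- enn2real (emeasure L B)) * enn2real (emeasure L B) ^ k / fact k)) \<and>
     (\<forall>B\<in>sets L. emeasure L B = \<infinity> \<longrightarrow> (AE \<omega> in P. \<eta> \<omega> B = \<infinity>)) \<and>
     (\<forall>(m::nat) B. (\<forall>i<m. B i \<in> sets L) \<longrightarrow> disjoint_family_on B {..<m} \<longrightarrow>
        prob_space.indep_vars P (\<lambda>_. borel) (\<lambda>i \<omega>. \<eta> \<omega> (B i)) {..<m})"

text \<open>xi is obtained from eta by keeping each point independently with probability p
and adding an independent Poisson process with intensity (1-p) L.  The points of eta
are given by a measurable enumeration (kappa, X) (so eta is proper), the coins U are
i.i.d. Bernoulli(p), and (kappa,X), U, zeta are independent.\<close>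
definition thinned_superposition ::
  "'w measure \<Rightarrow> 'a measure \<Rightarrow> ('w \<Rightarrow> 'a set \<Rightarrow> ennreal) \<Rightarrow> real
   \<Rightarrow> ('w \<Rightarrow> 'a set \<Rightarrow> ennreal) \<Rightarrow> bool" where
  "thinned_superposition P L \<eta> p \<xi> \<longleftrightarrow>
     (\<exists>(\<kappa> :: 'w \<Rightarrow> enat) (X :: 'w \<Rightarrow> nat \<Rightarrow> 'a) (U :: 'w \<Rightarrow> nat \<Rightarrow> bool) \<zeta>.
        (\<lambda>\<omega>. (\<kappa> \<omega>, X \<omega>)) \<in> measurable P (count_space UNIV \<Otimes>\<^sub>M (\<Pi>\<^sub>M i\<in>UNIV. L)) \<and>
        U \<in> measurable P (\<Pi>\<^sub>M i\<in>UNIV. count_space UNIV) \<and>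
        distr P (\<Pi>\<^sub>M i\<in>UNIV. count_space UNIV) U
          = (\<Pi>\<^sub>M i\<in>UNIV. measure_pmf (bernoulli_pmf p)) \<and>
        poisson_process P (scale_measure (ennreal (1 - p)) L) \<zeta> \<and>
        prob_space.indep_set P
          (sets (vimage_algebra (space P) (\<lambda>\<omega>. (\<kappa> \<omega>, X \<omega>))
                   (count_space UNIV \<Otimes>\<^sub>M (\<Pi>\<^sub>M i\<in>UNIV. L))))
          (sets (vimage_algebra (space P) (\<lambda>\<omega>. (U \<omega>, \<zeta> \<omega>))
                   ((\<Pi>\<^sub>M i\<in>UNIV. count_space UNIV) \<Otimes>\<^sub>M
                    N_meas (scale_measure (ennreal (1 - p)) L)))) \<and>
        prob_space.indep_set P
          (sets (vimage_algebra (space P) U (\<Pi>\<^sub>M i\<in>UNIV. count_space UNIV)))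
          (sets (vimage_algebra (space P) \<zeta> (N_meas (scale_measure (ennreal (1 - p)) L)))) \<and>
        (\<forall>\<omega>\<in>space P. \<eta> \<omega> = (\<lambda>B. if B \<in> sets L then
            (\<Sum>i. if enat i < \<kappa> \<omega> then indicator B (X \<omega> i) else 0) else 0)) \<and>
        (\<forall>\<omega>\<in>space P. \<xi> \<omega> = (\<lambda>B. if B \<in> sets L then
            (\<Sum>i. if enat i < \<kappa> \<omega> \<and> U \<omega> i then indicator B (X \<omega> i) else 0) + \<zeta> \<omega> B
            else 0)))"

end

theory Submission
  imports Defs
begin

text \<open>
  Write \<open>\<phi>(t)\<close> for the correlation of \<open>F(\<eta>)\<close> and \<open>F(\<eta>\<^sup>t)\<close>, where \<open>F = g(x, \<sqdot>)\<close>, and \<open>D\<close> for the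
  expectation of the integral of \<open>(D\<^sub>y F)\<^sup>2\<close>. Cauchy--Schwarz conditionally on \<open>\<eta>\<close> gives
  \<open>\<phi>(t/2)\<^sup>2 \<le> \<phi>(0) \<phi>(t)\<close>, and for small \<open>t\<close> one has \<open>\<phi>(0) - \<phi>(t) \<le> t D + O(t\<^sup>2)\<close>, because up to
  probability \<open>O(t\<^sup>2)\<close> at most one point is removed or added. Iterating the first
  inequality yields \<open>\<phi>(t) \<ge> \<phi>(0) exp(- t D / \<phi>(0)) \<ge> exp(- \<alpha> t) ((1 + \<alpha> t) \<phi>(0) - t D)\<close>. The last
  expression is linear in \<open>\<phi>(0)\<close> and \<open>D\<close>, so it can be integrated over \<open>x\<close>; the hypothesis turns it into
  \<open>exp(- \<alpha> t)\<close> times the second moment, and integration against \<open>exp(- t)\<close> gives the factor \<open>1 / (\<alpha> + 1)\<close>.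
  The error term requires bounded \<open>F\<close> and finite intensity, so first only the points in a set \<open>T\<close> of finite
  intensity are refreshed; then \<open>T\<close> grows to the whole space and the truncation of \<open>F\<close> is removed.
\<close>

section \<open>Point configurations\<close>

text \<open>The hypothesis gives each \<open>\<xi> t\<close> its own enumeration, coins and noise,
  and no joint law across different times. So every comparison of times passes through the joint law
  of the pair (\<eta>, \<open>\<xi> t\<close>), which is characterised by its Laplace functional
  (\<open>pair_law\<close>). Three realisations of this law are used. The first is the given one.
  The second consists of two independent refreshments of the same points at half the time;
  conditional independence turns the correlation into the mean of a square. The third is a common
  part plus two independent finite clusters, in which the number of changed points is visible. The
  symmetry of the law gives E(F(X) - F(Y))^2 = 2 (phi(0) - phi(t)), so the small-time bound is a
  bound for a squared difference. The linear lower bound is the tangent of exp taken where D =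
  \<alpha> phi(0). A ratio D / phi(0) in an exponent could not be integrated over x, because the
  hypothesis only compares the integrals of D and phi(0).\<close>

definition eneg :: "ennreal \<Rightarrow> real" where
  "eneg x = (if x = \<infinity> then 0 else exp (- enn2real x))"

lemma eneg_nonneg [simp]: "0 \<le> eneg x"
  by (simp add: eneg_def)

lemma eneg_le_1 [simp]: "eneg x \<le> 1"
  by (simp add: eneg_def)

lemma eneg_0 [simp]: "eneg 0 = 1"
  by (simp add: eneg_def)

lemma eneg_top [simp]: "eneg top = 0"
  by (simp add: eneg_def)

lemma eneg_ennreal: "0 \<le> r \<Longrightarrow> eneg (ennreal r) = exp (- r)"
  by (simp add: eneg_def)

text \<open>The convention exp(-infinity) = 0 keeps this valid for infinite counts, so Laplace
  transforms are real functions with values in [0, 1] even on sets of infinite mass.\<close>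

lemma eneg_add: "eneg (x + y) = eneg x * eneg y"
  by (cases x; cases y) (auto simp: eneg_def exp_add[symmetric] simp flip: ennreal_plus)

lemma eneg_sum: "finite A \<Longrightarrow> eneg (\<Sum>a\<in>A. f a) = (\<Prod>a\<in>A. eneg (f a))"
  by (induction A rule: finite_induct) (auto simp: eneg_add)

lemma eneg_measurable [measurable]: "eneg \<in> borel_measurable borel"
  unfolding eneg_def by measurable

text \<open>Continuity of \<open>eneg\<close> along partial sums, including an infinite limit, where
  the partial products tend to 0. It turns sums over infinitely many points into infinite
  products.\<close>

lemma eneg_suminf: "(\<lambda>n. \<Prod>i<n. eneg (f i)) \<longlonglongrightarrow> eneg (\<Sum>i. f i)"
proof -
  have sm: "(\<lambda>n. \<Sum>i<n. f i) \<longlonglongrightarrow> (\<Sum>i. f i)"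
    using summable_LIMSEQ[of f] by simp
  have "(\<lambda>n. eneg (\<Sum>i<n. f i)) \<longlonglongrightarrow> eneg (\<Sum>i. f i)"
  proof (cases "(\<Sum>i. f i) = top")
    case False
    then have fin: "(\<Sum>i<n. f i) \<noteq> top" for n
      using sum_le_suminf[of f "{..<n}"] by (metis finite_lessThan summableI top_unique zero_le)
    have "(\<lambda>n. exp (- enn2real (\<Sum>i<n. f i))) \<longlonglongrightarrow> exp (- enn2real (\<Sum>i. f i))"
      using sm False by (intro tendsto_intros tendsto_enn2real) (auto simp: top.not_eq_extremum)
    then show ?thesis using False fin by (simp add: eneg_def)
  next
    case True
    have "\<exists>N. \<forall>n\<ge>N. norm (eneg (\<Sum>i<n. f i) - 0) < r" if "r > 0" for r
    proof -
      \<comment> \<open>Every \<open>x\<close> above - ln r satisfies e^(-x) < r; the maximum with 0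
        keeps \<open>ennreal c\<close> faithful when r > 1.\<close>
      define c where "c = max 0 (- ln r)"
      have "0 \<le> c" "ennreal c < top" by (auto simp: c_def)
      then have "\<forall>\<^sub>F n in sequentially. ennreal c < (\<Sum>i<n. f i)"
        using sm True order_tendstoD(1) by fastforce
      moreover have "eneg x < r" if "ennreal c < x" for x
      proof (cases "x = top")
        case False
        then have "c < enn2real x"
          using that \<open>0 \<le> c\<close> by (cases x) (auto simp: ennreal_less_iff)
        then have "- enn2real x < ln r" by (simp add: c_def)
        then show ?thesis using \<open>r > 0\<close> False by (simp add: eneg_def exp_less_mono flip: ln_ge_iff)
            (metis exp_less_cancel_iff exp_ln)
      qed (use \<open>r > 0\<close> in simp)
      ultimately show ?thesis
        unfolding eventually_sequentially by (metis abs_of_nonneg diff_zero eneg_nonneg real_norm_def)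
    qed
    then show ?thesis using True unfolding LIMSEQ_iff by simp
  qed
  then show ?thesis by (simp add: eneg_sum)
qed

lemma suminf_swap_ennreal:
  fixes a :: "nat \<Rightarrow> nat \<Rightarrow> ennreal"
  shows "(\<Sum>i. \<Sum>n. a i n) = (\<Sum>n. \<Sum>i. a i n)"
  using nn_integral_suminf[of "\<lambda>i n. a i n" "count_space UNIV"]
  by (simp add: nn_integral_count_space_nat)

section \<open>The sigma-algebra on counting measures and operations on configurations\<close>

lemma N_meas_cong: "space L = space L' \<Longrightarrow> sets L = sets L' \<Longrightarrow> N_meas L = N_meas L'"
  by (simp add: N_meas_def Nset_def)

lemma space_N_meas [simp]: "space (N_meas L) = Nset L"
  unfolding N_meas_def by (rule space_measure_of) auto

lemma sets_N_meas: "sets (N_meas L) = sigma_sets (Nset L)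
     (\<Union>B\<in>sets L. {(\<lambda>\<mu>. \<mu> B) -` A \<inter> Nset L | A. A \<in> sets (borel :: ennreal measure)})"
  unfolding N_meas_def by (rule sets_measure_of) auto

lemma measurable_N_eval:
  assumes "B \<in> sets L" shows "(\<lambda>\<mu>. \<mu> B) \<in> borel_measurable (N_meas L)"
proof (rule measurableI)
  fix A :: "ennreal set" assume "A \<in> sets borel"
  then show "(\<lambda>\<mu>. \<mu> B) -` A \<inter> space (N_meas L) \<in> sets (N_meas L)"
    unfolding sets_N_meas space_N_meas by (intro sigma_sets.Basic) (use assms in auto)
qed auto

lemma measurable_N_I:
  assumes "\<And>\<omega>. \<omega> \<in> space M \<Longrightarrow> f \<omega> \<in> Nset L"
    and "\<And>B. B \<in> sets L \<Longrightarrow> (\<lambda>\<omega>. f \<omega> B) \<in> borel_measurable M"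
  shows "f \<in> measurable M (N_meas L)"
  unfolding N_meas_def
proof (rule measurable_measure_of)
  fix y assume "y \<in> (\<Union>B\<in>sets L. {(\<lambda>\<mu>. \<mu> B) -` A \<inter> Nset L |A. A \<in> sets (borel::ennreal measure)})"
  then obtain B A where y: "B \<in> sets L" "A \<in> sets (borel::ennreal measure)" "y = (\<lambda>\<mu>. \<mu> B) -` A \<inter> Nset L"
    by auto
  have "f -` y \<inter> space M = (\<lambda>\<omega>. f \<omega> B) -` A \<inter> space M"
    using y(3) assms(1) by auto
  then show "f -` y \<inter> space M \<in> sets M"
    using measurable_sets[OF assms(2)[OF y(1)] y(2)] by simp
qed (use assms(1) in auto)

lemma Nset_nullD: "\<mu> \<in> Nset L \<Longrightarrow> B \<notin> sets L \<Longrightarrow> \<mu> B = 0"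
  by (auto simp: Nset_def)

text \<open>Elements of \<open>Nset\<close> are bare set functions; this makes continuity from below
  and integration against a configuration available. Additivity is an interchange of two
  sums.\<close>

lemma Nset_measure_space:
  assumes "\<mu> \<in> Nset L" shows "measure_space (space L) (sets L) \<mu>"
proof -
  obtain \<nu> :: "nat \<Rightarrow> 'a set \<Rightarrow> nat" where ms: "\<And>n. measure_space (space L) (sets L) (\<lambda>B. of_nat (\<nu> n B))"
    and \<mu>: "\<And>B. B \<in> sets L \<Longrightarrow> \<mu> B = (\<Sum>n. of_nat (\<nu> n B))"
    using assms by (auto simp: Nset_def)
  have pos: "positive (sets L) \<mu>"
    using ms \<mu> by (auto simp: measure_space_def positive_def)
  have "countably_additive (sets L) \<mu>"
  proof (rule countably_additiveI)
    fix A :: "nat \<Rightarrow> 'a set"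
    assume A: "range A \<subseteq> sets L" "disjoint_family A" "\<Union> (range A) \<in> sets L"
    have "(\<Sum>i. \<mu> (A i)) = (\<Sum>i. \<Sum>n. of_nat (\<nu> n (A i)))"
      using A by (intro suminf_cong \<mu>) auto
    also have "\<dots> = (\<Sum>n. \<Sum>i. of_nat (\<nu> n (A i)))"
      by (rule suminf_swap_ennreal)
    also have "\<dots> = (\<Sum>n. of_nat (\<nu> n (\<Union> (range A))))"
      using ms A by (intro suminf_cong) (auto simp: measure_space_def countably_additive_def)
    finally show "(\<Sum>i. \<mu> (A i)) = \<mu> (\<Union> (range A))"
      using A by (simp add: \<mu>)
  qed
  with pos show ?thesis by (simp add: measure_space_def sets.sigma_algebra_axioms)
qed

text \<open>Either finitely many of the integer measures charge \<open>B\<close>, or infinitely many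
  do and each contributes at least 1. The countable range is what lets the level sets of evaluations
  generate the sigma-algebra.\<close>

lemma Nset_nat_valued:
  assumes "\<mu> \<in> Nset L" shows "\<mu> B \<in> insert \<infinity> (range of_nat)"
proof (cases "B \<in> sets L")
  case True
  then obtain \<nu> :: "nat \<Rightarrow> 'a set \<Rightarrow> nat" where \<mu>: "\<mu> B = (\<Sum>n. of_nat (\<nu> n B))"
    using assms by (auto simp: Nset_def)
  show ?thesis
  proof (cases "finite {n. \<nu> n B \<noteq> 0}")
    case True
    then have "\<mu> B = (\<Sum>n | \<nu> n B \<noteq> 0. of_nat (\<nu> n B))"
      unfolding \<mu> by (intro suminf_finite) auto
    then show ?thesis by (simp flip: of_nat_sum)
  next
    case False
    have "\<mu> B = \<infinity>"
    proof (rule ccontr)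
      assume "\<mu> B \<noteq> \<infinity>"
      then have "(\<Sum>n. of_nat (\<nu> n B) :: ennreal) < top" by (simp add: \<mu> top.not_eq_extremum)
      then obtain N where N: "(\<Sum>n. of_nat (\<nu> n B) :: ennreal) < of_nat N"
        using ennreal_Ex_less_of_nat by blast
      obtain A where A: "A \<subseteq> {n. \<nu> n B \<noteq> 0}" "finite A" "card A = N"
        using False infinite_arbitrarily_large by metis
      have "of_nat N = (\<Sum>n\<in>A. 1 :: ennreal)" using A by simp
      also have "\<dots> \<le> (\<Sum>n\<in>A. of_nat (\<nu> n B))"
      proof (rule sum_mono)
        fix n assume "n \<in> A"
        then have "1 \<le> \<nu> n B" using A by auto
        then show "1 \<le> (of_nat (\<nu> n B) :: ennreal)"
          by (metis of_nat_1 of_nat_mono)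
      qed
      also have "\<dots> \<le> (\<Sum>n. of_nat (\<nu> n B))"
        using A by (intro sum_le_suminf) auto
      finally show False using N by simp
    qed
    then show ?thesis by simp
  qed
qed (use assms in \<open>auto simp: Nset_nullD intro!: image_eqI[of _ _ 0]\<close>)

text \<open>The predicate \<open>K\<close> covers truncation at a random number of points, selection
  by coins, and finite clusters in one form. The value 0 off the sigma-algebra follows the
  convention of \<open>Nset\<close>.\<close>

definition pts :: "'a measure \<Rightarrow> (nat \<Rightarrow> bool) \<Rightarrow> (nat \<Rightarrow> 'a) \<Rightarrow> 'a set \<Rightarrow> ennreal" where
  "pts L K x = (\<lambda>B. if B \<in> sets L then (\<Sum>i. if K i then indicator B (x i) else 0) else 0)"

definition restr :: "'a measure \<Rightarrow> 'a set \<Rightarrow> ('a set \<Rightarrow> ennreal) \<Rightarrow> 'a set \<Rightarrow> ennreal" where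
  "restr L T \<mu> = (\<lambda>B. if B \<in> sets L then \<mu> (B \<inter> T) else 0)"

lemma NsetI:
  fixes \<nu> :: "nat \<Rightarrow> 'a set \<Rightarrow> nat"
  assumes "\<And>B. B \<notin> sets L \<Longrightarrow> \<mu> B = 0"
    and "\<And>n. \<nu> n {} = 0"
    and "\<And>n A. range A \<subseteq> sets L \<Longrightarrow> disjoint_family A \<Longrightarrow>
          (\<Sum>i. of_nat (\<nu> n (A i))) = (of_nat (\<nu> n (\<Union>i::nat. A i)) :: ennreal)"
    and "\<And>B. B \<in> sets L \<Longrightarrow> \<mu> B = (\<Sum>n. of_nat (\<nu> n B))"
  shows "\<mu> \<in> Nset L"
  using assms unfolding Nset_def
  by (auto simp: measure_space_def positive_def countably_additive_def sets.sigma_algebra_axioms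
      intro!: exI[of _ \<nu>])

lemma Nset_cm_add [simp]:
  assumes "\<mu> \<in> Nset L" "\<nu> \<in> Nset L" shows "cm_add \<mu> \<nu> \<in> Nset L"
proof -
  obtain a :: "nat \<Rightarrow> 'a set \<Rightarrow> nat" where a: "\<And>n. measure_space (space L) (sets L) (\<lambda>B. of_nat (a n B))"
    "\<And>B. B \<in> sets L \<Longrightarrow> \<mu> B = (\<Sum>n. of_nat (a n B))"
    using assms(1) by (auto simp: Nset_def)
  obtain b :: "nat \<Rightarrow> 'a set \<Rightarrow> nat" where b: "\<And>n. measure_space (space L) (sets L) (\<lambda>B. of_nat (b n B))"
    "\<And>B. B \<in> sets L \<Longrightarrow> \<nu> B = (\<Sum>n. of_nat (b n B))"
    using assms(2) by (auto simp: Nset_def)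
  show ?thesis
  proof (rule NsetI[where \<nu>="\<lambda>n B. a n B + b n B"])
    fix n and A :: "nat \<Rightarrow> 'a set"
    assume A: "range A \<subseteq> sets L" "disjoint_family A"
    have "(\<Sum>i. of_nat (a n (A i)) :: ennreal) = of_nat (a n (\<Union>i. A i))"
      "(\<Sum>i. of_nat (b n (A i)) :: ennreal) = of_nat (b n (\<Union>i. A i))"
      using a(1)[of n] b(1)[of n] A by (auto simp: measure_space_def countably_additive_def)
    then show "(\<Sum>i. of_nat (a n (A i) + b n (A i)) :: ennreal)
        = of_nat (a n (\<Union>i. A i) + b n (\<Union>i. A i))"
      by (simp flip: suminf_add)
  next
    show "a n {} + b n {} = 0" for n
      using a(1)[of n] b(1)[of n] by (simp add: measure_space_def positive_def)
  qed (use assms a(2) b(2) in \<open>auto simp: cm_add_def Nset_nullD suminf_add\<close>)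
qed

lemma Nset_pts [simp]: "pts L K x \<in> Nset L"
proof (rule NsetI[where \<nu>="\<lambda>n B. if K n \<and> x n \<in> B then 1 else 0"])
  fix n and A :: "nat \<Rightarrow> 'a set"
  assume "range A \<subseteq> sets L" "disjoint_family A"
  then show "(\<Sum>i. of_nat (if K n \<and> x n \<in> A i then 1 else 0) :: ennreal)
      = of_nat (if K n \<and> x n \<in> (\<Union>i. A i) then 1 else 0)"
    using suminf_indicator[of A "x n"] by (cases "K n") (auto simp: indicator_def of_bool_def if_distrib[of of_nat] cong: if_cong)
qed (auto simp: pts_def indicator_def intro!: suminf_cong)

lemma Nset_restr [simp]:
  assumes "\<mu> \<in> Nset L" "T \<in> sets L" shows "restr L T \<mu> \<in> Nset L"
proof -
  obtain a :: "nat \<Rightarrow> 'a set \<Rightarrow> nat" where a: "\<And>n. measure_space (space L) (sets L) (\<lambda>B. of_nat (a n B))"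
    "\<And>B. B \<in> sets L \<Longrightarrow> \<mu> B = (\<Sum>n. of_nat (a n B))"
    using assms(1) by (auto simp: Nset_def)
  show ?thesis
  proof (rule NsetI[where \<nu>="\<lambda>n B. a n (B \<inter> T)"])
    fix n and A :: "nat \<Rightarrow> 'a set"
    assume A: "range A \<subseteq> sets L" "disjoint_family A"
    have "range (\<lambda>i. A i \<inter> T) \<subseteq> sets L" "disjoint_family (\<lambda>i. A i \<inter> T)"
      using A assms(2) by (auto simp: disjoint_family_on_def)
    then have "(\<Sum>i. of_nat (a n (A i \<inter> T)) :: ennreal) = of_nat (a n (\<Union>i. A i \<inter> T))"
      using a(1)[of n] by (auto simp: measure_space_def countably_additive_def)
    then show "(\<Sum>i. of_nat (a n (A i \<inter> T)) :: ennreal) = of_nat (a n ((\<Union>i. A i) \<inter> T))"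
      by (simp add: Int_commute)
  next
    show "a n ({} \<inter> T) = 0" for n
      using a(1)[of n] by (simp add: measure_space_def positive_def)
  qed (use assms a(2) in \<open>auto simp: restr_def\<close>)
qed

lemma cm_dirac_eq_pts: "cm_dirac L y = pts L (\<lambda>i. i = 0) (\<lambda>_. y)"
proof -
  have "(\<Sum>i::nat. if i = 0 then indicator B y else 0) = (indicator B y :: ennreal)" for B
    using suminf_finite[of "{0}" "\<lambda>i::nat. if i = 0 then indicator B y else 0 :: ennreal"] by simp
  then show ?thesis by (simp add: cm_dirac_def pts_def fun_eq_iff)
qed

lemma Nset_cm_dirac [simp]: "cm_dirac L y \<in> Nset L"
  by (simp add: cm_dirac_eq_pts)

lemma measurable_pts:
  assumes "\<And>i. Measurable.pred M (\<lambda>\<omega>. K \<omega> i)" "\<And>i. (\<lambda>\<omega>. x \<omega> i) \<in> measurable M L"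
  shows "(\<lambda>\<omega>. pts L (K \<omega>) (x \<omega>)) \<in> measurable M (N_meas L)"
proof (rule measurable_N_I)
  fix B assume [measurable]: "B \<in> sets L"
  note assms[measurable]
  show "(\<lambda>\<omega>. pts L (K \<omega>) (x \<omega>) B) \<in> borel_measurable M"
    unfolding pts_def by measurable
qed simp

lemma measurable_cm_add [measurable (raw)]:
  assumes "X \<in> measurable M (N_meas L)" "Y \<in> measurable M (N_meas L)"
  shows "(\<lambda>\<omega>. cm_add (X \<omega>) (Y \<omega>)) \<in> measurable M (N_meas L)"
proof (rule measurable_N_I)
  fix B assume B: "B \<in> sets L"
  have [measurable]: "(\<lambda>\<omega>. X \<omega> B) \<in> borel_measurable M" "(\<lambda>\<omega>. Y \<omega> B) \<in> borel_measurable M"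
    using measurable_compose[OF assms(1) measurable_N_eval[OF B]] measurable_compose[OF assms(2) measurable_N_eval[OF B]]
    by auto
  show "(\<lambda>\<omega>. cm_add (X \<omega>) (Y \<omega>) B) \<in> borel_measurable M"
    unfolding cm_add_def by measurable
qed (use assms[THEN measurable_space] in auto)

lemma measurable_restr:
  assumes "T \<in> sets L"
  shows "restr L T \<in> measurable (N_meas L) (N_meas L)"
proof (rule measurable_N_I)
  fix B assume B: "B \<in> sets L"
  have "(\<lambda>\<mu>. \<mu> (B \<inter> T)) \<in> borel_measurable (N_meas L)"
    using B assms by (intro measurable_N_eval) auto
  then show "(\<lambda>\<mu>. restr L T \<mu> B) \<in> borel_measurable (N_meas L)"
    using B by (simp add: restr_def)
qed (use assms in auto)

lemma measurable_cm_dirac: "cm_dirac L \<in> measurable L (N_meas L)"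
  by (rule measurable_N_I) (simp, simp add: cm_dirac_def)

section \<open>Finite measures determined by products of functions with values in [0, 1]\<close>

lemma (in finite_measure) integrable_bounded:
  fixes f :: "'a \<Rightarrow> real"
  assumes "f \<in> borel_measurable M" "\<And>x. x \<in> space M \<Longrightarrow> \<bar>f x\<bar> \<le> C"
  shows "integrable M f"
  using assms by (intro integrable_const_bound[of _ C]) auto

lemma prod_list_unit_interval:
  "(\<And>a. a \<in> set as \<Longrightarrow> 0 \<le> a \<and> a \<le> 1) \<Longrightarrow> 0 \<le> prod_list as \<and> prod_list as \<le> (1::real)"
  by (induction as) (auto intro!: mult_le_one)

lemma prod_list_measurable:
  "(\<And>h. h \<in> set hs \<Longrightarrow> h \<in> borel_measurable M) \<Longrightarrow>
    (\<lambda>x. \<Prod>h\<leftarrow>hs. h x :: real) \<in> borel_measurable M"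
  by (induction hs) auto

text \<open>Indicators of the events \<open>h = a\<close> are bounded limits of the polynomials
  \<open>(1 - (h - a)\<^sup>2) ^ n\<close>.\<close>

lemma finite_measure_eqI_products:
  fixes H :: "('b \<Rightarrow> real) set"
  assumes fin: "finite_measure M1" "finite_measure M2" and sets: "sets M1 = sets M2"
    and meas: "\<And>h. h \<in> H \<Longrightarrow> h \<in> borel_measurable M1"
    and unit: "\<And>h x. h \<in> H \<Longrightarrow> x \<in> space M1 \<Longrightarrow> 0 \<le> h x \<and> h x \<le> 1"
    and gen: "sets M1 \<subseteq> sigma_sets (space M1) {{x \<in> space M1. h x = a} | h a. h \<in> H}"
    and eq: "\<And>hs. set hs \<subseteq> H \<Longrightarrow> (\<integral>x. (\<Prod>h\<leftarrow>hs. h x) \<partial>M1) = (\<integral>x. (\<Prod>h\<leftarrow>hs. h x) \<partial>M2)"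
  shows "M1 = M2"
proof -
  interpret M1: finite_measure M1 by fact
  interpret M2: finite_measure M2 by fact
  have sp: "space M1 = space M2" using sets by (rule sets_eq_imp_space_eq)
  have mc: "f \<in> borel_measurable M1 \<longleftrightarrow> f \<in> borel_measurable M2" for f :: "'b \<Rightarrow> real"
    using measurable_cong_sets[OF sets refl, of borel] by auto
  \<comment> \<open>Equality of integrals is demanded even after multiplication by any product from
    \<open>H\<close>. With this strengthening the class is closed under linear combinations,
    multiplication by members of \<open>H\<close> and bounded limits.\<close>
  define good where "good f \<longleftrightarrow> f \<in> borel_measurable M1 \<and> (\<exists>C. \<forall>x\<in>space M1. \<bar>f x\<bar> \<le> C) \<and>
      (\<forall>hs. set hs \<subseteq> H \<longrightarrow> (\<integral>x. f x * (\<Prod>h\<leftarrow>hs. h x) \<partial>M1) = (\<integral>x. f x * (\<Prod>h\<leftarrow>hs. h x) \<partial>M2))"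
    for f :: "'b \<Rightarrow> real"
  have prod_unit: "0 \<le> (\<Prod>h\<leftarrow>hs. h x) \<and> (\<Prod>h\<leftarrow>hs. h x) \<le> 1" if "set hs \<subseteq> H" "x \<in> space M1" for hs x
    using that unit by (intro prod_list_unit_interval) auto
  have prod_meas: "(\<lambda>x. \<Prod>h\<leftarrow>hs. h x) \<in> borel_measurable M1" if "set hs \<subseteq> H" for hs
    using that meas by (intro prod_list_measurable) auto
  have intble: "integrable M1 (\<lambda>x. f x * (\<Prod>h\<leftarrow>hs. h x))" "integrable M2 (\<lambda>x. f x * (\<Prod>h\<leftarrow>hs. h x))"
    if "good f" "set hs \<subseteq> H" for f hs
  proof -
    obtain C where C: "\<And>x. x \<in> space M1 \<Longrightarrow> \<bar>f x\<bar> \<le> C" and f: "f \<in> borel_measurable M1"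
      using \<open>good f\<close> by (auto simp: good_def)
    have "\<bar>f x * (\<Prod>h\<leftarrow>hs. h x)\<bar> \<le> C" if "x \<in> space M1" for x
    proof -
      have "\<bar>f x * (\<Prod>h\<leftarrow>hs. h x)\<bar> = \<bar>f x\<bar> * (\<Prod>h\<leftarrow>hs. h x)"
        using prod_unit[OF \<open>set hs \<subseteq> H\<close> that] by (simp add: abs_mult)
      also have "\<dots> \<le> \<bar>f x\<bar> * 1"
        using prod_unit[OF \<open>set hs \<subseteq> H\<close> that] by (intro mult_left_mono) auto
      finally show ?thesis using C[OF that] by simp
    qed
    moreover have "(\<lambda>x. f x * (\<Prod>h\<leftarrow>hs. h x)) \<in> borel_measurable M1"
      using f prod_meas[OF \<open>set hs \<subseteq> H\<close>] by measurable
    ultimately show "integrable M1 (\<lambda>x. f x * (\<Prod>h\<leftarrow>hs. h x))" "integrable M2 (\<lambda>x. f x * (\<Prod>h\<leftarrow>hs. h x))"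
      by (auto simp: mc sp intro!: M1.integrable_bounded[of _ C] M2.integrable_bounded[of _ C])
  qed
  have good_const: "good (\<lambda>_. c)" for c
    using eq by (auto simp: good_def intro!: exI[of _ "\<bar>c\<bar>"])
  have good_lin: "good (\<lambda>x. c * f x + d * g x)" if f: "good f" and g: "good g" for c d f g
  proof -
    obtain C D where "\<forall>x\<in>space M1. \<bar>f x\<bar> \<le> C" "\<forall>x\<in>space M1. \<bar>g x\<bar> \<le> D"
      using f g by (auto simp: good_def)
    then have "\<bar>c * f x + d * g x\<bar> \<le> \<bar>c\<bar> * C + \<bar>d\<bar> * D" if "x \<in> space M1" for x
      using that by (intro order_trans[OF abs_triangle_ineq]) (auto simp: abs_mult intro!: add_mono mult_left_mono)
    moreover have "(\<integral>x. (c * f x + d * g x) * (\<Prod>h\<leftarrow>hs. h x) \<partial>M1)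
        = (\<integral>x. (c * f x + d * g x) * (\<Prod>h\<leftarrow>hs. h x) \<partial>M2)" if hs: "set hs \<subseteq> H" for hs
      using intble[OF f hs] intble[OF g hs] f g hs
      by (simp add: distrib_right mult.assoc good_def)
    moreover have "(\<lambda>x. c * f x + d * g x) \<in> borel_measurable M1"
      using f g by (auto simp: good_def)
    ultimately show ?thesis unfolding good_def by blast
  qed
  have good_mult: "good (\<lambda>x. f x * h x)" if f: "good f" and h: "h \<in> H" for f h
  proof -
    obtain C where "\<forall>x\<in>space M1. \<bar>f x\<bar> \<le> C"
      using f by (auto simp: good_def)
    then have "\<bar>f x * h x\<bar> \<le> C" if "x \<in> space M1" for x
      using that unit[OF h that] mult_mono[of "\<bar>f x\<bar>" C "\<bar>h x\<bar>" 1] by (auto simp: abs_mult)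
    moreover have "(\<integral>x. (f x * h x) * (\<Prod>h\<leftarrow>hs. h x) \<partial>M1)
        = (\<integral>x. (f x * h x) * (\<Prod>h\<leftarrow>hs. h x) \<partial>M2)" if hs: "set hs \<subseteq> H" for hs
      using f h hs unfolding good_def by (auto dest!: spec[of _ "h # hs"] simp: mult.assoc)
    moreover have "(\<lambda>x. f x * h x) \<in> borel_measurable M1"
      using f meas[OF h] by (auto simp: good_def)
    ultimately show ?thesis unfolding good_def by blast
  qed
  have good_lim: "good f"
    if g: "\<And>n. good (g n)" and b: "\<And>n x. x \<in> space M1 \<Longrightarrow> \<bar>g n x\<bar> \<le> C"
      and lim: "\<And>x. x \<in> space M1 \<Longrightarrow> (\<lambda>n. g n x) \<longlonglongrightarrow> f x" for f g C
  proof -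
    have gm: "g n \<in> borel_measurable M1" for n
      using g[of n] unfolding good_def by blast
    have "\<bar>f x\<bar> \<le> C" if "x \<in> space M1" for x
      using b[OF that] by (intro LIMSEQ_le_const2[OF tendsto_rabs[OF lim[OF that]]]) auto
    moreover have f[measurable]: "f \<in> borel_measurable M1"
      using lim gm by (rule borel_measurable_LIMSEQ_real)
    moreover have "(\<integral>x. f x * (\<Prod>h\<leftarrow>hs. h x) \<partial>M1) = (\<integral>x. f x * (\<Prod>h\<leftarrow>hs. h x) \<partial>M2)"
      if hs: "set hs \<subseteq> H" for hs
    proof -
      have bd: "\<bar>g n x * (\<Prod>h\<leftarrow>hs. h x)\<bar> \<le> C" if "x \<in> space M1" for n x
        using b[OF that, of n] prod_unit[OF hs that] mult_mono[of "\<bar>g n x\<bar>" C "(\<Prod>h\<leftarrow>hs. h x)" 1]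
        by (auto simp: abs_mult)
      have m[measurable]: "(\<lambda>x. \<Prod>h\<leftarrow>hs. h x) \<in> borel_measurable M1" "g n \<in> borel_measurable M1" for n
        using prod_meas[OF hs] gm by auto
      have l1: "(\<lambda>n. \<integral>x. g n x * (\<Prod>h\<leftarrow>hs. h x) \<partial>M1) \<longlonglongrightarrow> (\<integral>x. f x * (\<Prod>h\<leftarrow>hs. h x) \<partial>M1)"
      proof (rule integral_dominated_convergence[where w="\<lambda>_. C"])
        show "AE x in M1. (\<lambda>n. g n x * (\<Prod>h\<leftarrow>hs. h x)) \<longlonglongrightarrow> f x * (\<Prod>h\<leftarrow>hs. h x)"
          using lim by (intro AE_I2 tendsto_mult tendsto_const) auto
        show "AE x in M1. norm (g n x * (\<Prod>h\<leftarrow>hs. h x)) \<le> C" for n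
          using bd by (intro AE_I2) (simp only: real_norm_def)
      qed auto
      have l2: "(\<lambda>n. \<integral>x. g n x * (\<Prod>h\<leftarrow>hs. h x) \<partial>M2) \<longlonglongrightarrow> (\<integral>x. f x * (\<Prod>h\<leftarrow>hs. h x) \<partial>M2)"
      proof (rule integral_dominated_convergence[where w="\<lambda>_. C"])
        show "(\<lambda>x. f x * (\<Prod>h\<leftarrow>hs. h x)) \<in> borel_measurable M2"
          "(\<lambda>x. g n x * (\<Prod>h\<leftarrow>hs. h x)) \<in> borel_measurable M2" for n
          by (simp_all flip: mc)
        show "AE x in M2. (\<lambda>n. g n x * (\<Prod>h\<leftarrow>hs. h x)) \<longlonglongrightarrow> f x * (\<Prod>h\<leftarrow>hs. h x)"
          using lim sp by (intro AE_I2 tendsto_mult tendsto_const) auto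
        show "AE x in M2. norm (g n x * (\<Prod>h\<leftarrow>hs. h x)) \<le> C" for n
          using bd sp by (intro AE_I2) (simp only: real_norm_def)
      qed auto
      have "(\<integral>x. g n x * (\<Prod>h\<leftarrow>hs. h x) \<partial>M1) = (\<integral>x. g n x * (\<Prod>h\<leftarrow>hs. h x) \<partial>M2)" for n
        using g[of n] hs unfolding good_def by blast
      with l1 have "(\<lambda>n. \<integral>x. g n x * (\<Prod>h\<leftarrow>hs. h x) \<partial>M2) \<longlonglongrightarrow> (\<integral>x. f x * (\<Prod>h\<leftarrow>hs. h x) \<partial>M1)"
        by simp
      then show ?thesis
        using l2 by (rule LIMSEQ_unique)
    qed
    ultimately show ?thesis unfolding good_def by blast
  qed
  have good_ind: "good (\<lambda>x. f x * of_bool (h x = a))" if f: "good f" and h: "h \<in> H" for f h a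
  \<comment> \<open>For a in [0, 1] the square (h - a)^2 is at most 1, so the powers stay bounded;
    for any other a the level set is empty and the indicator is zero.\<close>
  proof (cases "0 \<le> a \<and> a \<le> 1")
    case a: True
    obtain C where C: "\<And>x. x \<in> space M1 \<Longrightarrow> \<bar>f x\<bar> \<le> C"
      using f by (auto simp: good_def)
    show ?thesis
    proof (rule good_lim[where C=C and g="\<lambda>n x. f x * (1 - (h x - a)\<^sup>2) ^ n"])
      show "good (\<lambda>x. f x * (1 - (h x - a)\<^sup>2) ^ n)" for n
      proof (induction n)
        case (Suc n)
        let ?F = "\<lambda>x. f x * (1 - (h x - a)\<^sup>2) ^ n"
        \<comment> \<open>The next power comes from expanding 1 - (h - a)^2 = (1 - a^2) + 2 a h -
          h^2, which uses only linear combinations and multiplication by \<open>h\<close>.\<close>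
        have "good (\<lambda>x. 1 * ((1 - a\<^sup>2) * ?F x + 2 * a * (?F x * h x)) + (-1) * (?F x * h x * h x))"
          by (intro good_lin good_mult Suc h)
        moreover have "1 * ((1 - a\<^sup>2) * (u * P) + 2 * a * (u * P * v)) + (-1) * (u * P * v * v)
            = u * ((1 - (v - a)\<^sup>2) * P)" for u P v
          by (simp add: algebra_simps power2_eq_square)
        ultimately show ?case by simp
      qed (use f in simp)
    next
      fix x assume x: "x \<in> space M1"
      have "\<bar>h x - a\<bar> \<le> 1" using a unit[OF h x] by auto
      then have sq: "(h x - a)\<^sup>2 \<le> 1" by (simp add: abs_square_le_1)
      then have "0 \<le> (1 - (h x - a)\<^sup>2) ^ n \<and> (1 - (h x - a)\<^sup>2) ^ n \<le> 1" for n
        by (auto intro!: power_le_one)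
      then show "\<bar>f x * (1 - (h x - a)\<^sup>2) ^ n\<bar> \<le> C" for n
        using C[OF x] mult_mono[of "\<bar>f x\<bar>" C "(1 - (h x - a)\<^sup>2) ^ n" 1]
        by (simp add: abs_mult)
      show "(\<lambda>n. f x * (1 - (h x - a)\<^sup>2) ^ n) \<longlonglongrightarrow> f x * of_bool (h x = a)"
      proof (cases "h x = a")
        case False
        then have "0 < (h x - a)\<^sup>2" by simp
        then have "(\<lambda>n. (1 - (h x - a)\<^sup>2) ^ n) \<longlonglongrightarrow> 0"
          using sq by (intro LIMSEQ_realpow_zero) auto
        then show ?thesis using False by (auto intro: tendsto_mult_right_zero)
      qed simp
    qed
  next
    case False
    then have "h x \<noteq> a" if "x \<in> space M1" for x using unit[OF h that] by auto
    then show ?thesis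
      by (intro good_lim[where g="\<lambda>_ _. 0" and C=0, OF good_const]) auto
  qed
  \<comment> \<open>Finite intersections of level sets, indexed by lists: concatenation gives
    stability under intersection, and the empty list gives the whole space.\<close>
  define E where "E = {{x \<in> space M1. \<forall>(h, a)\<in>set ias. h x = a} | ias. fst ` set ias \<subseteq> H}"
  have good_E: "good (\<lambda>x. \<Prod>(h, a)\<leftarrow>ias. of_bool (h x = a))" if "fst ` set ias \<subseteq> H" for ias
    using that
  proof (induction ias)
    case (Cons ia ias)
    then show ?case
      using good_ind[of "\<lambda>x. \<Prod>(h, a)\<leftarrow>ias. of_bool (h x = a)" "fst ia" "snd ia"]
      by (cases ia) (auto simp: mult.commute)
  qed (use good_const in auto)
  have prod_ind: "(\<Prod>(h, a)\<leftarrow>ias. of_bool (h x = a)) = (of_bool (\<forall>(h, a)\<in>set ias. h x = a) :: real)" 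
    for ias :: "(('b \<Rightarrow> real) \<times> real) list" and x
    by (induction ias) auto
  show ?thesis
  proof (rule measure_eqI_generator_eq[where A="\<lambda>_. space M1"])
    show "Int_stable E"
    proof (rule Int_stableI)
      fix A B assume "A \<in> E" "B \<in> E"
      then obtain xs ys where "A = {x \<in> space M1. \<forall>(h, a)\<in>set xs. h x = a}" "fst ` set xs \<subseteq> H"
        "B = {x \<in> space M1. \<forall>(h, a)\<in>set ys. h x = a}" "fst ` set ys \<subseteq> H"
        unfolding E_def by blast
      then show "A \<inter> B \<in> E"
        unfolding E_def by (intro CollectI exI[of _ "xs @ ys"]) (auto simp: ball_Un)
    qed
    have E_sets: "E \<subseteq> sets M1"
    proof
      fix A assume "A \<in> E"
      then obtain xs where A: "A = {x \<in> space M1. \<forall>(h, a)\<in>set xs. h x = a}" "fst ` set xs \<subseteq> H"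
        unfolding E_def by blast
      have "(\<lambda>x. \<Prod>(h, a)\<leftarrow>xs. of_bool (h x = a) :: real) \<in> borel_measurable M1"
        using good_E[OF A(2)] by (simp add: good_def)
      then have "{x \<in> space M1. (\<Prod>(h, a)\<leftarrow>xs. of_bool (h x = a) :: real) = 1} \<in> sets M1"
        by measurable
      then show "A \<in> sets M1"
        by (simp add: prod_ind A(1))
    qed
    show Pow: "E \<subseteq> Pow (space M1)" using E_def by blast
    have "{{x \<in> space M1. h x = a} | h a. h \<in> H} \<subseteq> E"
    proof safe
      fix h a assume "h \<in> H"
      then show "{x \<in> space M1. h x = a} \<in> E"
        unfolding E_def by (intro CollectI exI[of _ "[(h, a)]"]) auto
    qed
    then have "sets M1 \<subseteq> sigma_sets (space M1) E"
      by (rule order_trans[OF gen sigma_sets_mono'])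
    moreover have "sigma_sets (space M1) E \<subseteq> sets M1"
      using E_sets sets.sigma_sets_subset by blast
    ultimately show "sets M1 = sigma_sets (space M1) E" by simp
    then show "sets M2 = sigma_sets (space M1) E" using sets by simp
    fix A assume "A \<in> E"
    then obtain xs where A: "A = {x \<in> space M1. \<forall>(h, a)\<in>set xs. h x = a}" "fst ` set xs \<subseteq> H"
      unfolding E_def by blast
    have "(\<integral>x. (indicator A x :: real) \<partial>M1) = (\<integral>x. (\<Prod>(h, a)\<leftarrow>xs. of_bool (h x = a)) * (\<Prod>h\<leftarrow>[]. h x) \<partial>M1)"
      by (intro Bochner_Integration.integral_cong) (auto simp: prod_ind A(1) indicator_def)
    also have "\<dots> = (\<integral>x. (\<Prod>(h, a)\<leftarrow>xs. of_bool (h x = a)) * (\<Prod>h\<leftarrow>[]. h x) \<partial>M2)"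
      using good_E[OF A(2)] unfolding good_def by (auto dest!: spec[of _ "[]"])
    also have "\<dots> = (\<integral>x. (indicator A x :: real) \<partial>M2)"
      by (intro Bochner_Integration.integral_cong) (auto simp: prod_ind A(1) indicator_def sp)
    finally show "emeasure M1 A = emeasure M2 A"
      using A(1) sp by (simp add: M1.emeasure_eq_measure M2.emeasure_eq_measure Int_absorb2)
  next
    show "range (\<lambda>_. space M1) \<subseteq> E"
      unfolding E_def by (auto intro!: exI[of _ "[]"])
  qed auto
qed

section \<open>Joint laws of point processes\<close>

text \<open>The Laplace functional at the simple function that adds up the indicators of a list of
  sets. Appending lists multiplies functionals, so the family is closed under products.\<close>

definition lap :: "'a set list \<Rightarrow> ('a set \<Rightarrow> ennreal) \<Rightarrow> real" where
  "lap Bs \<mu> = (\<Prod>B\<leftarrow>Bs. eneg (\<mu> B))"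

text \<open>The factor that a single point at \<open>x\<close> contributes to
  \<open>lap Bs\<close>.\<close>

definition expw :: "'a set list \<Rightarrow> 'a \<Rightarrow> real" where
  "expw Bs x = (\<Prod>B\<leftarrow>Bs. exp (- indicator B x))"

lemma lap_simps [simp]: "lap [] \<mu> = 1" "lap (B # Bs) \<mu> = eneg (\<mu> B) * lap Bs \<mu>"
  by (simp_all add: lap_def)

lemma expw_simps [simp]: "expw [] x = 1" "expw (B # Bs) x = exp (- indicator B x) * expw Bs x"
  by (simp_all add: expw_def)

lemma lap_append: "lap (Bs @ Cs) \<mu> = lap Bs \<mu> * lap Cs \<mu>"
  by (simp add: lap_def)

lemma expw_append: "expw (Bs @ Cs) x = expw Bs x * expw Cs x"
  by (simp add: expw_def)

lemma lap_cm_add: "lap Bs (cm_add \<mu> \<nu>) = lap Bs \<mu> * lap Bs \<nu>"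
  by (induction Bs) (auto simp: cm_add_def eneg_add)

lemma lap_nonneg [simp]: "0 \<le> lap Bs \<mu>" and lap_le_1 [simp]: "lap Bs \<mu> \<le> 1"
  by (induction Bs) (auto intro!: mult_le_one)

lemma expw_pos [simp]: "0 < expw Bs x"
  by (induction Bs) auto

lemma expw_le_1 [simp]: "expw Bs x \<le> 1"
  by (induction Bs) (auto intro!: mult_le_one simp: less_imp_le)

lemma lap_measurable:
  "set Bs \<subseteq> sets L \<Longrightarrow> lap Bs \<in> borel_measurable (N_meas L)"
proof (induction Bs)
  case (Cons B Bs)
  then have [measurable]: "(\<lambda>\<mu>. \<mu> B) \<in> borel_measurable (N_meas L)" "lap Bs \<in> borel_measurable (N_meas L)"
    by (auto intro: measurable_N_eval)
  show ?case by simp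
qed (simp add: fun_eq_iff[of "lap []" "\<lambda>_. 1", THEN iffD2])

lemma expw_measurable [measurable]: "set Bs \<subseteq> sets L \<Longrightarrow> expw Bs \<in> borel_measurable L"
proof (induction Bs)
  case (Cons B Bs)
  then have [measurable]: "B \<in> sets L" "expw Bs \<in> borel_measurable L" by auto
  show ?case by simp
qed (simp add: fun_eq_iff[of "expw []" "\<lambda>_. 1", THEN iffD2])

lemma lap_restr:
  assumes "set Bs \<subseteq> sets L"
  shows "lap Bs (restr L T \<mu>) = lap (map (\<lambda>B. B \<inter> T) Bs) \<mu>"
  using assms by (induction Bs) (auto simp: restr_def)

lemma expw_map_Int: "expw (map (\<lambda>B. B \<inter> T) Bs) x = (if x \<in> T then expw Bs x else 1)"
  by (induction Bs) (auto simp: indicator_def)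

section \<open>Test sets inside an exhaustion and the identification of joint laws\<close>

locale exhaustion =
  fixes L :: "'a measure" and S :: "nat \<Rightarrow> 'a set"
  assumes S_sets [measurable, simp]: "S n \<in> sets L"
    and S_fin: "emeasure L (S n) < \<infinity>"
    and S_mono: "incseq S"
    and S_UN: "(\<Union>n. S n) = space L"
begin

text \<open>Sets inside one member of the exhaustion, rather than all sets of finite intensity: a
  finite list of them lies in a single \<open>S n\<close>, and on each of them refreshing on
  \<open>S n\<close> eventually agrees with full refreshing.\<close>

definition loc :: "'a set set" where
  "loc = {B \<in> sets L. \<exists>n. B \<subseteq> S n}"

lemma loc_sets: "B \<in> loc \<Longrightarrow> B \<in> sets L"
  by (simp add: loc_def)

lemma loc_list_sets: "set Bs \<subseteq> loc \<Longrightarrow> set Bs \<subseteq> sets L"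
  using loc_sets by blast

lemma loc_Int: "B \<in> loc \<Longrightarrow> T \<in> sets L \<Longrightarrow> B \<inter> T \<in> loc"
  by (auto simp: loc_def)

lemma loc_list_cover:
  assumes "set Bs \<subseteq> loc" obtains n where "\<And>B. B \<in> set Bs \<Longrightarrow> B \<subseteq> S n"
proof -
  have "\<exists>n. \<forall>B\<in>set Bs. B \<subseteq> S n"
    using assms
  proof (induction Bs)
    case (Cons B Bs)
    then obtain n m where n: "\<forall>B\<in>set Bs. B \<subseteq> S n" "B \<subseteq> S m"
      by (auto simp: loc_def)
    have "S n \<subseteq> S (max n m)" "S m \<subseteq> S (max n m)"
      using S_mono by (auto simp: incseq_def)
    with n show ?case by (intro exI[of _ "max n m"]) auto
  qed simp
  with that show ?thesis by blast
qed

abbreviation "N \<equiv> N_meas L"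

text \<open>For \<open>B\<close> in \<open>loc\<close> the evaluation has countably many values, so
  its level sets suffice. For general \<open>B\<close> the mass is the supremum of the masses of
  \<open>B \<inter> S n\<close>, by continuity from below.\<close>

lemma sigma_loc_eq: "sets N = sigma_sets (Nset L) {{\<mu> \<in> Nset L. \<mu> B = a} | B a. B \<in> loc}"
proof -
  define G where "G = {{\<mu> \<in> Nset L. \<mu> B = a} | B a. B \<in> loc}"
  define Q where "Q = sigma (Nset L) G"
  have sp: "space Q = Nset L" unfolding Q_def G_def by (rule space_measure_of) auto
  have st: "sets Q = sigma_sets (Nset L) G" unfolding Q_def G_def by (rule sets_measure_of) auto
  have loc_meas: "(\<lambda>\<mu>. \<mu> B) \<in> borel_measurable Q" if "B \<in> loc" for B
  proof -
    have "(\<lambda>\<mu>. \<mu> B) \<in> measurable Q (count_space (insert \<infinity> (range of_nat)))"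
    proof (rule measurable_count_space_eq_countable[THEN iffD2], simp, intro conjI ballI Pi_I)
      fix \<mu> assume "\<mu> \<in> space Q"
      then show "\<mu> B \<in> insert \<infinity> (range of_nat)"
        using Nset_nat_valued[of \<mu> L B] sp by blast
    next
      fix a :: ennreal
      have "(\<lambda>\<mu>. \<mu> B) -` {a} \<inter> space Q = {\<mu> \<in> Nset L. \<mu> B = a}" unfolding sp by auto
      also have "\<dots> \<in> sets Q"
        unfolding st using that by (intro sigma_sets.Basic) (auto simp: G_def)
      finally show "(\<lambda>\<mu>. \<mu> B) -` {a} \<inter> space Q \<in> sets Q" .
    qed
    then show ?thesis
      by (rule measurable_compose) simp
  qed
  have "(\<lambda>\<mu>. \<mu>) \<in> measurable Q N"
  proof (rule measurable_N_I)
    fix B assume B: "B \<in> sets L"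
    have m: "(\<lambda>\<mu>. \<mu> (B \<inter> S n)) \<in> borel_measurable Q" for n
      using B by (intro loc_meas) (auto simp: loc_def)
    have "(\<lambda>\<mu>. SUP n. \<mu> (B \<inter> S n)) \<in> borel_measurable Q"
      using m by (intro borel_measurable_SUP) auto
    moreover have "\<mu> B = (SUP n. \<mu> (B \<inter> S n))" if "\<mu> \<in> Nset L" for \<mu>
    proof -
      define M where "M = measure_of (space L) (sets L) \<mu>"
      have em: "emeasure M A = \<mu> A" if "A \<in> sets L" for A
        unfolding M_def using Nset_measure_space[OF \<open>\<mu> \<in> Nset L\<close>] that
        by (simp add: emeasure_measure_of_sigma measure_space_def)
      have sM: "sets M = sets L" by (simp add: M_def)
      have "(SUP n. emeasure M (B \<inter> S n)) = emeasure M (\<Union>n. B \<inter> S n)"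
        using B S_mono by (intro SUP_emeasure_incseq) (auto simp: sM incseq_def)
      also have "(\<Union>n. B \<inter> S n) = B"
        using S_UN sets.sets_into_space[OF B] by blast
      finally show ?thesis using B by (simp add: em)
    qed
    ultimately show "(\<lambda>\<mu>. \<mu> B) \<in> borel_measurable Q"
      by (subst measurable_cong[where g="\<lambda>\<mu>. SUP n. \<mu> (B \<inter> S n)"]) (auto simp: sp)
  qed (simp add: sp)
  from measurable_sets[OF this] have "sets N \<subseteq> sets Q"
    using sets.sets_into_space[of _ N] by (fastforce simp: sp Int_absorb2)
  moreover have "sets Q \<subseteq> sets N"
    unfolding st
  proof (rule sets.sigma_sets_subset[of _ N, simplified])
    show "G \<subseteq> sets N"
      unfolding G_def
    proof safe
      fix B a assume "B \<in> loc"
      then have "(\<lambda>\<mu>. \<mu> B) -` {a} \<inter> space N \<in> sets N"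
        by (intro measurable_sets[OF measurable_N_eval]) (auto simp: loc_sets)
      also have "(\<lambda>\<mu>. \<mu> B) -` {a} \<inter> space N = {\<mu> \<in> Nset L. \<mu> B = a}" by auto
      finally show "{\<mu> \<in> Nset L. \<mu> B = a} \<in> sets N" .
    qed
  qed
  ultimately show ?thesis using st unfolding G_def by simp
qed

lemma eneg_inj: "eneg x = eneg y \<longleftrightarrow> x = y"
  by (cases x; cases y) (auto simp: eneg_def)

text \<open>Products of the functions e^(-mu(B)) of either coordinate are exactly the products
  \<open>lap Bs * lap Cs\<close>. As \<open>eneg\<close> is injective, the level sets of these
  functions are those of the evaluations, which generate; hence
  \<open>finite_measure_eqI_products\<close> applies.\<close>

lemma pair_distr_eqI:
  assumes M: "prob_space M1" "prob_space M2"
    and X1: "X1 \<in> measurable M1 N" and Y1: "Y1 \<in> measurable M1 N"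
    and X2: "X2 \<in> measurable M2 N" and Y2: "Y2 \<in> measurable M2 N"
    and eq: "\<And>Bs Cs. set Bs \<subseteq> loc \<Longrightarrow> set Cs \<subseteq> loc \<Longrightarrow>
       (\<integral>\<omega>. lap Bs (X1 \<omega>) * lap Cs (Y1 \<omega>) \<partial>M1) = (\<integral>\<omega>. lap Bs (X2 \<omega>) * lap Cs (Y2 \<omega>) \<partial>M2)"
  shows "distr M1 (N \<Otimes>\<^sub>M N) (\<lambda>\<omega>. (X1 \<omega>, Y1 \<omega>)) = distr M2 (N \<Otimes>\<^sub>M N) (\<lambda>\<omega>. (X2 \<omega>, Y2 \<omega>))"
proof -
  define HX where "HX = {(\<lambda>z::('a set \<Rightarrow> ennreal) \<times> ('a set \<Rightarrow> ennreal). eneg (fst z B)) | B. B \<in> loc}"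
  define HY where "HY = {(\<lambda>z::('a set \<Rightarrow> ennreal) \<times> ('a set \<Rightarrow> ennreal). eneg (snd z B)) | B. B \<in> loc}"
  interpret M1: prob_space M1 by fact
  interpret M2: prob_space M2 by fact
  note [measurable] = X1 X2 Y1 Y2
  have eval[measurable]: "(\<lambda>\<mu>. \<mu> B) \<in> borel_measurable N" if "B \<in> loc" for B
    using that by (intro measurable_N_eval loc_sets)
  have Hm: "h \<in> borel_measurable (N \<Otimes>\<^sub>M N)" if "h \<in> HX \<union> HY" for h
    using that unfolding HX_def HY_def by (auto intro!: measurable_compose[OF measurable_fst] measurable_compose[OF measurable_snd])
  have list: "\<exists>Bs Cs. set Bs \<subseteq> loc \<and> set Cs \<subseteq> loc \<and> (\<forall>z. (\<Prod>h\<leftarrow>hs. h z) = lap Bs (fst z) * lap Cs (snd z))"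
    if "set hs \<subseteq> HX \<union> HY" for hs
    using that
  proof (induction hs)
    case Nil
    then show ?case by (intro exI[of _ "[]"]) auto
  next
    case (Cons h hs)
    then obtain Bs Cs where IH: "set Bs \<subseteq> loc" "set Cs \<subseteq> loc"
      "\<And>z. (\<Prod>h\<leftarrow>hs. h z) = lap Bs (fst z) * lap Cs (snd z)" by auto
    consider B where "B \<in> loc" "h = (\<lambda>z. eneg (fst z B))" | B where "B \<in> loc" "h = (\<lambda>z. eneg (snd z B))"
      using Cons.prems by (auto simp: HX_def HY_def)
    then show ?case
    proof cases
      case 1
      then show ?thesis using IH by (intro exI[of _ "B # Bs"] exI[of _ Cs]) auto
    next
      case 2
      then show ?thesis using IH by (intro exI[of _ Bs] exI[of _ "B # Cs"]) auto
    qed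
  qed
  define G where "G = {{z \<in> Nset L \<times> Nset L. h z = a} | h a. h \<in> HX \<union> HY}"
  \<comment> \<open>\<open>M\<close> carries the sigma-algebra generated by the level sets of single
    coordinates; measurability of both projections from \<open>M\<close> shows that it contains the
    product sigma-algebra.\<close>
  define M where "M = sigma (Nset L \<times> Nset L) G"
  have sp: "space M = Nset L \<times> Nset L" unfolding M_def G_def by (rule space_measure_of) auto
  have st: "sets M = sigma_sets (Nset L \<times> Nset L) G" unfolding M_def G_def by (rule sets_measure_of) auto
  have N_alt: "N_meas L = sigma (Nset L) {{\<mu> \<in> Nset L. \<mu> B = a} | B a. B \<in> loc}"
    unfolding N_meas_def by (intro sigma_eqI sigma_loc_eq[unfolded sets_N_meas]) auto
  have "fst \<in> measurable M N"
    unfolding N_alt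
  proof (rule measurable_measure_of)
    fix y assume "y \<in> {{\<mu> \<in> Nset L. \<mu> B = a} |B a. B \<in> loc}"
    then obtain B a where "B \<in> loc" "y = {\<mu> \<in> Nset L. \<mu> B = a}" by auto
    moreover from this have "fst -` y \<inter> space M = {z \<in> Nset L \<times> Nset L. eneg (fst z B) = eneg a}"
      by (auto simp: sp eneg_inj)
    ultimately show "fst -` y \<inter> space M \<in> sets M"
      unfolding st by (auto simp: G_def HX_def intro!: sigma_sets.Basic)
  qed (auto simp: sp)
  moreover have "snd \<in> measurable M N"
    unfolding N_alt
  proof (rule measurable_measure_of)
    fix y assume "y \<in> {{\<mu> \<in> Nset L. \<mu> B = a} |B a. B \<in> loc}"
    then obtain B a where "B \<in> loc" "y = {\<mu> \<in> Nset L. \<mu> B = a}" by auto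
    moreover from this have "snd -` y \<inter> space M = {z \<in> Nset L \<times> Nset L. eneg (snd z B) = eneg a}"
      by (auto simp: sp eneg_inj)
    ultimately show "snd -` y \<inter> space M \<in> sets M"
      unfolding st by (auto simp: G_def HY_def intro!: sigma_sets.Basic)
  qed (auto simp: sp)
  ultimately have id: "(\<lambda>z. (fst z, snd z)) \<in> measurable M (N \<Otimes>\<^sub>M N)"
    by (rule measurable_Pair)
  have gen: "sets (N \<Otimes>\<^sub>M N) \<subseteq> sigma_sets (Nset L \<times> Nset L) G"
  proof
    fix A assume A: "A \<in> sets (N \<Otimes>\<^sub>M N)"
    then have "A \<subseteq> Nset L \<times> Nset L"
      using sets.sets_into_space[OF A] by (simp add: space_pair_measure)
    with measurable_sets[OF id A] show "A \<in> sigma_sets (Nset L \<times> Nset L) G"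
      by (simp add: sp st Int_absorb2)
  qed
  show ?thesis
  proof (rule finite_measure_eqI_products[where H="HX \<union> HY"])
    show "finite_measure (distr M1 (N \<Otimes>\<^sub>M N) (\<lambda>\<omega>. (X1 \<omega>, Y1 \<omega>)))"
      "finite_measure (distr M2 (N \<Otimes>\<^sub>M N) (\<lambda>\<omega>. (X2 \<omega>, Y2 \<omega>)))"
      by (intro M1.finite_measure_distr M2.finite_measure_distr; measurable)+
    fix hs assume hs: "set hs \<subseteq> HX \<union> HY"
    then obtain Bs Cs where BC: "set Bs \<subseteq> loc" "set Cs \<subseteq> loc"
      "\<And>z. (\<Prod>h\<leftarrow>hs. h z) = lap Bs (fst z) * lap Cs (snd z)"
      using list by blast
    have "(\<lambda>z. \<Prod>h\<leftarrow>hs. h z) \<in> borel_measurable (N \<Otimes>\<^sub>M N)"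
      using Hm hs by (intro prod_list_measurable) blast
    then have m: "(\<lambda>z. lap Bs (fst z) * lap Cs (snd z)) \<in> borel_measurable (N \<Otimes>\<^sub>M N)"
      by (simp add: BC(3))
    show "(\<integral>z. (\<Prod>h\<leftarrow>hs. h z) \<partial>distr M1 (N \<Otimes>\<^sub>M N) (\<lambda>\<omega>. (X1 \<omega>, Y1 \<omega>)))
        = (\<integral>z. (\<Prod>h\<leftarrow>hs. h z) \<partial>distr M2 (N \<Otimes>\<^sub>M N) (\<lambda>\<omega>. (X2 \<omega>, Y2 \<omega>)))"
      unfolding BC(3) using eq[OF BC(1,2)] m
      by (simp add: integral_distr)
  qed (use Hm gen in \<open>auto simp: G_def HX_def HY_def space_pair_measure\<close>)
qed

end

section \<open>Laplace functionals\<close>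

lemma sum_levels:
  fixes h :: "'b \<Rightarrow> 'c::semiring_1"
  assumes "finite (f ` A)" "x \<in> A"
  shows "(\<Sum>y\<in>f ` A. h y * indicator (f -` {y} \<inter> A) x) = h (f x)"
proof -
  have "(\<Sum>y\<in>f ` A. h y * indicator (f -` {y} \<inter> A) x) = (\<Sum>y\<in>f ` A. if f x = y then h y else 0)"
    using assms(2) by (intro sum.cong) (auto simp: indicator_def)
  then show ?thesis using assms by simp
qed

text \<open>The integral of a nonnegative simple function against \<open>\<mu>\<close>, written over
  its levels: these are disjoint sets, to which the independence in \<open>poisson_process\<close>
  applies.\<close>

definition levelsum :: "'a measure \<Rightarrow> ('a \<Rightarrow> real) \<Rightarrow> ('a set \<Rightarrow> ennreal) \<Rightarrow> ennreal" where
  "levelsum L f \<mu> = (\<Sum>y\<in>f ` space L. ennreal y * \<mu> (f -` {y} \<inter> space L))"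

text \<open>The Poisson generating function, summed over the possible counts. The alternative
  \<open>c = 0\<close> covers the level on which a simple function vanishes, which may have infinite
  intensity.\<close>

lemma poisson_eneg:
  assumes pp: "poisson_process P L \<eta>" and B: "B \<in> sets L" and c: "0 \<le> c"
    and fin: "emeasure L B < \<infinity> \<or> c = 0"
  shows "(\<integral>\<omega>. eneg (ennreal c * \<eta> \<omega> B) \<partial>P) = exp (- (1 - exp (- c)) * measure L B)"
proof -
  interpret P: prob_space P using pp by (simp add: poisson_process_def)
  show ?thesis
  proof (cases "c = 0")
    case True
    then show ?thesis by (simp add: P.prob_space)
  next
    case False
    then have fin: "emeasure L B < \<infinity>" using fin by simp
    have \<eta>: "\<eta> \<in> measurable P (N_meas L)" using pp by (simp add: poisson_process_def)
    have [measurable]: "(\<lambda>\<omega>. \<eta> \<omega> B) \<in> borel_measurable P"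
      using measurable_compose[OF \<eta> measurable_N_eval[OF B]] .
    define m where "m = measure L B"
    define q where "q k = exp (- m) * m ^ k / fact k" for k :: nat
    have q: "measure P {\<omega>\<in>space P. \<eta> \<omega> B = of_nat k} = q k" for k
      using pp B fin by (simp add: poisson_process_def q_def m_def measure_def)
    have q_nonneg: "0 \<le> q k" for k by (simp add: q_def m_def)
    define A where "A k = {\<omega>\<in>space P. \<eta> \<omega> B = of_nat k}" for k :: nat
    have A[measurable]: "A k \<in> sets P" for k unfolding A_def by measurable
    have dA: "disjoint_family A" by (auto simp: A_def disjoint_family_on_def)
    have gsum: "(\<lambda>k. exp (- (c * real k)) * q k) sums exp (- (1 - exp (- c)) * m)" if "0 \<le> c" for c
    proof -
      have "(\<lambda>k. (exp (- c) * m) ^ k /\<^sub>R fact k) sums exp (exp (- c) * m)"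
        by (rule exp_converges)
      then have "(\<lambda>k. exp (- m) * ((exp (- c) * m) ^ k /\<^sub>R fact k)) sums (exp (- m) * exp (exp (- c) * m))"
        by (rule sums_mult)
      moreover have "exp (- m) * ((exp (- c) * m) ^ k /\<^sub>R fact k) = exp (- (c * real k)) * q k" for k
        by (simp add: q_def power_mult_distrib exp_of_nat_mult[symmetric] divide_inverse mult.commute mult.left_commute)
      moreover have "exp (- m) * exp (exp (- c) * m) = exp (- (1 - exp (- c)) * m)"
        by (simp add: exp_add[symmetric] algebra_simps)
      ultimately show ?thesis by simp
    qed
    have "q sums measure P (\<Union>k. A k)"
      using P.finite_measure_UNION[of A] dA A q by (auto simp: A_def image_subset_iff)
    \<comment> \<open>At c = 0 the same series says that the Poisson probabilities add up to 1, so
      the count is almost surely finite.\<close>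
    with gsum[of 0] have "measure P (\<Union>k. A k) = 1"
      by (auto simp: sums_iff)
    then have AE: "AE \<omega> in P. \<omega> \<in> (\<Union>k. A k)"
      by (subst P.AE_in_set_eq_1) auto
    have eq: "eneg (ennreal c * \<eta> \<omega> B) = (\<Sum>k. exp (- (c * real k)) * indicator (A k) \<omega>)"
      if \<omega>: "\<omega> \<in> A j" for \<omega> j
    proof -
      have "eneg (ennreal c * \<eta> \<omega> B) = exp (- (c * real j))"
        using \<omega> c by (simp add: A_def eneg_ennreal ennreal_of_nat_eq_real_of_nat flip: ennreal_mult)
      also have "\<dots> = (\<Sum>k\<in>{j}. exp (- (c * real k)) * indicator (A k) \<omega>)"
        using \<omega> by simp
      also have "\<dots> = (\<Sum>k. exp (- (c * real k)) * indicator (A k) \<omega>)"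
        using \<omega> by (intro suminf_finite[symmetric]) (auto simp: A_def)
      finally show ?thesis .
    qed
    have "(\<lambda>k. \<integral>\<omega>. exp (- (c * real k)) * indicator (A k) \<omega> \<partial>P) sums
        (\<integral>\<omega>. (\<Sum>k. exp (- (c * real k)) * indicator (A k) \<omega>) \<partial>P)"
    proof (rule sums_integral)
      show "integrable P (\<lambda>\<omega>. exp (- (c * real k)) * indicator (A k) \<omega>)" for k
        by (simp add: P.emeasure_eq_measure)
      have sm: "summable (\<lambda>k. norm (exp (- (c * real k)) * indicator (A k) \<omega>))" if "\<omega> \<in> A j" for \<omega> j
        using that by (intro summable_finite[of "{j}"]) (auto simp: A_def)
      show "AE \<omega> in P. summable (\<lambda>k. norm (exp (- (c * real k)) * indicator (A k) \<omega>))"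
        using AE by eventually_elim (use sm in auto)
      show "summable (\<lambda>k. \<integral>\<omega>. norm (exp (- (c * real k)) * indicator (A k) \<omega>) \<partial>P)"
        using sums_summable[OF gsum[OF c]] q by (simp add: abs_mult A_def)
    qed
    moreover have "(\<integral>\<omega>. exp (- (c * real k)) * indicator (A k) \<omega> \<partial>P) = exp (- (c * real k)) * q k" for k
      using q by (simp add: A_def)
    moreover have "(\<integral>\<omega>. (\<Sum>k. exp (- (c * real k)) * indicator (A k) \<omega>) \<partial>P) = (\<integral>\<omega>. eneg (ennreal c * \<eta> \<omega> B) \<partial>P)"
      using AE eq by (intro integral_cong_AE) (measurable, auto)
    ultimately show ?thesis
      using gsum[OF c] by (simp add: sums_iff m_def)
  qed
qed

text \<open>Counts on distinct levels are independent, so the exponential of the sum factorises.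
  Independence is assumed for families indexed by an initial segment of the naturals, hence the
  enumeration \<open>h\<close> of the values.\<close>

lemma poisson_levelsum:
  assumes pp: "poisson_process P L \<eta>" and f: "simple_function L f"
    and nn: "\<And>x. 0 \<le> f x" and fin: "emeasure L {x \<in> space L. f x \<noteq> 0} < \<infinity>"
  shows "(\<integral>\<omega>. eneg (levelsum L f (\<eta> \<omega>)) \<partial>P)
    = exp (- (\<Sum>y\<in>f ` space L. (1 - exp (- y)) * measure L (f -` {y} \<inter> space L)))"
proof -
  interpret P: prob_space P using pp by (simp add: poisson_process_def)
  have \<eta>: "\<eta> \<in> measurable P (N_meas L)" using pp by (simp add: poisson_process_def)
  have finf: "finite (f ` space L)" using f by (simp add: simple_function_def)
  have fm[measurable]: "f \<in> borel_measurable L" using f by (rule borel_measurable_simple_function)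
  have Bs[measurable]: "f -` {y} \<inter> space L \<in> sets L" for y by (rule measurable_sets[OF fm]) simp
  obtain h where h: "bij_betw h {0..<card (f ` space L)} (f ` space L)"
    using ex_bij_betw_nat_finite[OF finf] by blast
  define m where "m = card (f ` space L)"
  define B where "B i = f -` {h i} \<inter> space L" for i
  have h: "bij_betw h {..<m} (f ` space L)" using h by (simp add: m_def atLeast0LessThan)
  then have inj: "inj_on h {..<m}" and im: "h ` {..<m} = f ` space L" by (auto simp: bij_betw_def)
  have hnn: "0 \<le> h i" if "i < m" for i
    using im that nn by (metis imageE imageI lessThan_iff)
  have dis: "disjoint_family_on B {..<m}"
    using inj by (auto simp: disjoint_family_on_def B_def inj_on_def)
  have ind: "P.indep_vars (\<lambda>_. borel) (\<lambda>i \<omega>. \<eta> \<omega> (B i)) {..<m}"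
  proof -
    have *: "P.indep_vars (\<lambda>_. borel) (\<lambda>i \<omega>. \<eta> \<omega> (B i)) {..<m}"
      if "\<forall>i<m. B i \<in> sets L" "disjoint_family_on B {..<m}" for m :: nat and B
      using pp that by (simp add: poisson_process_def)
    show ?thesis by (rule *[OF _ dis]) (simp add: B_def)
  qed
  have "eneg (levelsum L f (\<eta> \<omega>)) = (\<Prod>i<m. eneg (ennreal (h i) * \<eta> \<omega> (B i)))" for \<omega>
    unfolding levelsum_def im[symmetric] B_def by (simp add: sum.reindex[OF inj] eneg_sum)
  then have "(\<integral>\<omega>. eneg (levelsum L f (\<eta> \<omega>)) \<partial>P) = (\<integral>\<omega>. (\<Prod>i<m. eneg (ennreal (h i) * \<eta> \<omega> (B i))) \<partial>P)"
    by simp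
  also have "\<dots> = (\<Prod>i<m. \<integral>\<omega>. eneg (ennreal (h i) * \<eta> \<omega> (B i)) \<partial>P)"
  proof (rule P.indep_vars_lebesgue_integral)
    show "P.indep_vars (\<lambda>_. borel) (\<lambda>i \<omega>. eneg (ennreal (h i) * \<eta> \<omega> (B i))) {..<m}"
      using ind by (rule P.indep_vars_compose2) measurable
    fix i assume "i \<in> {..<m}"
    have [measurable]: "(\<lambda>\<omega>. \<eta> \<omega> (B i)) \<in> borel_measurable P"
      unfolding B_def by (rule measurable_compose[OF \<eta> measurable_N_eval[OF Bs]])
    show "integrable P (\<lambda>\<omega>. eneg (ennreal (h i) * \<eta> \<omega> (B i)))"
      by (rule P.integrable_bounded[of _ 1]) auto
  qed simp
  also have "\<dots> = (\<Prod>i<m. exp (- (1 - exp (- h i)) * measure L (B i)))"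
  proof (rule prod.cong)
    fix i assume i: "i \<in> {..<m}"
    have "emeasure L (B i) < \<infinity> \<or> h i = 0"
    proof (cases "h i = 0")
      case False
      then have "B i \<subseteq> {x \<in> space L. f x \<noteq> 0}" by (auto simp: B_def)
      then have "emeasure L (B i) \<le> emeasure L {x \<in> space L. f x \<noteq> 0}"
        by (intro emeasure_mono) auto
      with fin show ?thesis by auto
    qed simp
    then show "(\<integral>\<omega>. eneg (ennreal (h i) * \<eta> \<omega> (B i)) \<partial>P) = exp (- (1 - exp (- h i)) * measure L (B i))"
      using i hnn Bs by (intro poisson_eneg[OF pp]) (auto simp: B_def)
  qed simp
  also have "\<dots> = exp (- (\<Sum>i<m. (1 - exp (- h i)) * measure L (B i)))"
    by (simp add: exp_sum sum_negf[symmetric] algebra_simps)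
  also have "(\<Sum>i<m. (1 - exp (- h i)) * measure L (B i))
      = (\<Sum>y\<in>f ` space L. (1 - exp (- y)) * measure L (f -` {y} \<inter> space L))"
    unfolding im[symmetric] B_def by (simp add: sum.reindex[OF inj])
  finally show ?thesis .
qed

lemma poisson_laplace_simple:
  assumes pp: "poisson_process P (scale_measure (ennreal r) L) \<eta>" and r: "0 \<le> r" and f: "simple_function L f"
    and nn: "\<And>x. 0 \<le> f x" and fin: "emeasure L {x \<in> space L. f x \<noteq> 0} < \<infinity>"
  shows "(\<integral>\<omega>. eneg (levelsum L f (\<eta> \<omega>)) \<partial>P) = exp (- r * (\<integral>x. 1 - exp (- f x) \<partial>L))"
proof -
  let ?L = "scale_measure (ennreal r) L"
  have sf: "simple_function ?L f"
    using f by (simp add: simple_function_def space_scale_measure)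
  have fm[measurable]: "f \<in> borel_measurable L" using f by (rule borel_measurable_simple_function)
  have finf: "finite (f ` space L)" using f by (simp add: simple_function_def)
  have Bs[measurable]: "f -` {y} \<inter> space L \<in> sets L" for y by (rule measurable_sets[OF fm]) simp
  have Bfin: "emeasure L (f -` {y} \<inter> space L) < \<infinity>" if "y \<noteq> 0" for y
  proof -
    have "emeasure L (f -` {y} \<inter> space L) \<le> emeasure L {x \<in> space L. f x \<noteq> 0}"
      using that by (intro emeasure_mono) auto
    with fin show ?thesis by auto
  qed
  have ms: "measure ?L A = r * measure L A" for A
    using r by (simp add: measure_def enn2real_mult)
  have "emeasure ?L {x \<in> space ?L. f x \<noteq> 0} < \<infinity>"
    using fin by (simp add: space_scale_measure ennreal_mult_less_top)
  from poisson_levelsum[OF pp sf nn this]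
  have "(\<integral>\<omega>. eneg (levelsum L f (\<eta> \<omega>)) \<partial>P)
      = exp (- (\<Sum>y\<in>f ` space L. (1 - exp (- y)) * (r * measure L (f -` {y} \<inter> space L))))"
    by (simp add: levelsum_def space_scale_measure ms)
  also have "(\<Sum>y\<in>f ` space L. (1 - exp (- y)) * (r * measure L (f -` {y} \<inter> space L)))
      = r * (\<Sum>y\<in>f ` space L. (1 - exp (- y)) * measure L (f -` {y} \<inter> space L))"
    by (simp add: sum_distrib_left mult.left_commute)
  also have "(\<Sum>y\<in>f ` space L. (1 - exp (- y)) * measure L (f -` {y} \<inter> space L))
      = (\<Sum>y\<in>f ` space L. \<integral>x. (1 - exp (- y)) * indicator (f -` {y} \<inter> space L) x \<partial>L)"
    by simp
  also have "\<dots> = (\<integral>x. (\<Sum>y\<in>f ` space L. (1 - exp (- y)) * indicator (f -` {y} \<inter> space L) x) \<partial>L)"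
  proof (rule Bochner_Integration.integral_sum[symmetric])
    fix y assume "y \<in> f ` space L"
    show "integrable L (\<lambda>x. (1 - exp (- y)) * indicator (f -` {y} \<inter> space L) x)"
    \<comment> \<open>The level 0 may have infinite measure, but its coefficient 1 - exp(-0)
      vanishes.\<close>
    proof (cases "y = 0")
      case False
      then show ?thesis using Bfin[OF False] Bs by (intro integrable_mult_right integrable_real_indicator) auto
    qed simp
  qed
  also have "\<dots> = (\<integral>x. 1 - exp (- f x) \<partial>L)"
    by (intro Bochner_Integration.integral_cong refl) (rule sum_levels[OF finf])
  finally show ?thesis by simp
qed

text \<open>A decreasing limit when \<open>w\<close> has values in [0, 1]. Averaging over coins
  produces weights p c + (1 - p), which are no longer of the form \<open>expw Bs\<close>, so
  products over points are needed for general weights.\<close>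

definition prodw :: "('a \<Rightarrow> real) \<Rightarrow> (nat \<Rightarrow> bool) \<Rightarrow> (nat \<Rightarrow> 'a) \<Rightarrow> real" where
  "prodw w K x = lim (\<lambda>n. \<Prod>i<n. if K i then w (x i) else 1)"

lemma prodw_tendsto:
  assumes "\<And>y. 0 \<le> w y" "\<And>y. w y \<le> 1"
  shows "(\<lambda>n. \<Prod>i<n. if K i then w (x i) else 1) \<longlonglongrightarrow> prodw w K x"
proof -
  let ?p = "\<lambda>n. \<Prod>i<n. if K i then w (x i) else 1"
  have nn: "0 \<le> ?p n" for n using assms by (intro prod_nonneg) auto
  have "?p (Suc n) \<le> ?p n" for n
    using mult_left_mono[OF _ nn[of n], of "if K n then w (x n) else 1" 1] assms by auto
  then have "decseq ?p" by (rule decseq_SucI)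
  moreover have "bdd_below (range ?p)" using nn by (intro bdd_belowI[of _ 0]) auto
  ultimately have "convergent ?p" unfolding convergent_def
    using LIMSEQ_decseq_INF by blast
  then show ?thesis unfolding prodw_def by (simp add: convergent_LIMSEQ_iff)
qed

lemma prodw_mult:
  assumes "\<And>y. 0 \<le> w y" "\<And>y. w y \<le> 1" "\<And>y. 0 \<le> v y" "\<And>y. v y \<le> 1"
  shows "prodw w K x * prodw v K x = prodw (\<lambda>y. w y * v y) K x"
proof -
  have eq: "(\<Prod>i<n. if K i then w (x i) else 1) * (\<Prod>i<n. if K i then v (x i) else 1)
      = (\<Prod>i<n. if K i then w (x i) * v (x i) else 1)" for n
    unfolding prod.distrib[symmetric] by (intro prod.cong) auto
  have "(\<lambda>n. \<Prod>i<n. if K i then w (x i) * v (x i) else 1) \<longlonglongrightarrow> prodw w K x * prodw v K x"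
    using tendsto_mult[OF prodw_tendsto[where w=w and K=K and x=x] prodw_tendsto[where w=v and K=K and x=x]] assms by (simp add: eq)
  moreover have "(\<lambda>n. \<Prod>i<n. if K i then w (x i) * v (x i) else 1) \<longlonglongrightarrow> prodw (\<lambda>y. w y * v y) K x"
    using assms by (intro prodw_tendsto[of "\<lambda>y. w y * v y"]) (auto intro: mult_le_one)
  ultimately show ?thesis by (rule LIMSEQ_unique)
qed

lemma measurable_prodw:
  assumes [measurable]: "\<And>i. Measurable.pred M (\<lambda>\<omega>. K \<omega> i)" "\<And>i. (\<lambda>\<omega>. x \<omega> i) \<in> measurable M L"
    "w \<in> borel_measurable L"
  shows "(\<lambda>\<omega>. prodw w (K \<omega>) (x \<omega>)) \<in> borel_measurable M"
  unfolding prodw_def by measurable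

lemma prodw_exp:
  assumes "\<And>y. 0 \<le> f y"
  shows "prodw (\<lambda>y. exp (- f y)) K x = eneg (\<Sum>i. if K i then ennreal (f (x i)) else 0)"
proof -
  have "(\<lambda>n. \<Prod>i<n. if K i then exp (- f (x i)) else 1) \<longlonglongrightarrow> eneg (\<Sum>i. if K i then ennreal (f (x i)) else 0)"
    using eneg_suminf[of "\<lambda>i. if K i then ennreal (f (x i)) else 0"] assms
    by (simp add: if_distrib[of eneg] eneg_ennreal cong: if_cong)
  then show ?thesis
    using prodw_tendsto[where w="\<lambda>y. exp (- f y)" and K=K and x=x] assms LIMSEQ_unique by fastforce
qed

lemma eneg_levelsum_pts:
  assumes f: "simple_function L f" and nn: "\<And>x. 0 \<le> f x" and x: "\<And>i. x i \<in> space L"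
  shows "eneg (levelsum L f (pts L K x)) = prodw (\<lambda>y. exp (- f y)) K x"
proof -
  have finf: "finite (f ` space L)" using f by (simp add: simple_function_def)
  have Bs[measurable]: "f -` {y} \<inter> space L \<in> sets L" for y
    by (rule measurable_sets[OF borel_measurable_simple_function[OF f]]) simp
  have "levelsum L f (pts L K x)
      = (\<Sum>y\<in>f ` space L. \<Sum>i. ennreal y * (if K i then indicator (f -` {y} \<inter> space L) (x i) else 0))"
    by (simp add: levelsum_def pts_def Bs)
  also have "\<dots> = (\<Sum>i. \<Sum>y\<in>f ` space L. ennreal y * (if K i then indicator (f -` {y} \<inter> space L) (x i) else 0))"
    by (rule suminf_sum[symmetric]) simp
  also have "\<dots> = (\<Sum>i. if K i then ennreal (f (x i)) else 0)"
    using sum_levels[OF finf x, of ennreal] by (intro suminf_cong) auto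
  finally show ?thesis using nn by (simp add: prodw_exp)
qed

lemma lap_pts:
  assumes "set Bs \<subseteq> sets L"
  shows "lap Bs (pts L K x) = prodw (expw Bs) K x"
  using assms
proof (induction Bs)
  case (Cons B Bs)
  have "eneg (pts L K x B) = prodw (\<lambda>y. exp (- indicator B y)) K x"
    using Cons.prems by (subst prodw_exp) (auto simp: pts_def ennreal_indicator cong: if_cong)
  then show ?case
    using Cons by (simp add: prodw_mult less_imp_le)
qed (simp add: prodw_def expw_def[abs_def])

lemma expw_exp: "expw Bs x = exp (- (\<Sum>B\<leftarrow>Bs. indicator B x))"
  by (induction Bs) (auto simp: exp_add[symmetric])

lemma simple_sum_indicator:
  "set Bs \<subseteq> sets L \<Longrightarrow> simple_function L (\<lambda>x. \<Sum>B\<leftarrow>Bs. indicator B x :: real)"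
  by (induction Bs) auto

text \<open>Both sides are the exponential of minus the integral of the sum of indicators against
  \<open>\<mu>\<close>. The list form fits the identification of laws, the level form fits
  independence on disjoint sets.\<close>

lemma lap_levelsum:
  assumes \<mu>: "\<mu> \<in> Nset L" and Bs: "set Bs \<subseteq> sets L"
  shows "lap Bs \<mu> = eneg (levelsum L (\<lambda>x. \<Sum>B\<leftarrow>Bs. indicator B x) \<mu>)"
proof -
  define f where "f x = (\<Sum>B\<leftarrow>Bs. indicator B x :: real)" for x
  define M where "M = measure_of (space L) (sets L) \<mu>"
  have em: "emeasure M A = \<mu> A" if "A \<in> sets L" for A
    unfolding M_def using Nset_measure_space[OF \<mu>] that
    by (simp add: emeasure_measure_of_sigma measure_space_def)
  have sM: "sets M = sets L" and spM: "space M = space L" by (simp_all add: M_def)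
  have f: "simple_function L f" unfolding f_def by (rule simple_sum_indicator[OF Bs])
  have finf: "finite (f ` space L)" using f by (simp add: simple_function_def)
  have Bf: "f -` {y} \<inter> space L \<in> sets L" for y
    by (rule measurable_sets[OF borel_measurable_simple_function[OF f]]) simp
  then have [measurable]: "f -` {y} \<inter> space L \<in> sets M" for y
    by (simp add: sM)
  have nn: "0 \<le> f x" for x unfolding f_def by (induction Bs) auto
  have "lap Bs \<mu> = eneg (\<Sum>B\<leftarrow>Bs. \<mu> B)"
    by (induction Bs) (auto simp: eneg_add)
  also have "(\<Sum>B\<leftarrow>Bs. \<mu> B) = (\<integral>\<^sup>+x. ennreal (f x) \<partial>M)"
    unfolding f_def using Bs
  proof (induction Bs)
    case (Cons B Bs)
    have "(\<lambda>x. \<Sum>B\<leftarrow>Bs. indicator B x :: real) \<in> borel_measurable L"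
      using Cons.prems simple_sum_indicator[of Bs L] by (intro borel_measurable_simple_function) auto
    then have [measurable]: "(\<lambda>x. \<Sum>B\<leftarrow>Bs. indicator B x :: real) \<in> borel_measurable M"
      using measurable_cong_sets[OF sM refl] by blast
    have [measurable]: "B \<in> sets M" using Cons.prems by (simp add: sM)
    have "0 \<le> (\<Sum>B\<leftarrow>Bs. indicator B x :: real)" for x by (induction Bs) auto
    then have "(\<integral>\<^sup>+x. ennreal (\<Sum>B\<leftarrow>B # Bs. indicator B x) \<partial>M)
        = (\<integral>\<^sup>+x. indicator B x + ennreal (\<Sum>B\<leftarrow>Bs. indicator B x) \<partial>M)"
      by (simp add: ennreal_indicator)
    also have "\<dots> = \<mu> B + (\<integral>\<^sup>+x. ennreal (\<Sum>B\<leftarrow>Bs. indicator B x) \<partial>M)"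
      using Cons.prems by (subst nn_integral_add) (auto simp: em)
    finally show ?case using Cons by simp
  qed simp
  also have "(\<integral>\<^sup>+x. ennreal (f x) \<partial>M)
      = (\<integral>\<^sup>+x. (\<Sum>y\<in>f ` space L. ennreal y * indicator (f -` {y} \<inter> space L) x) \<partial>M)"
    by (intro nn_integral_cong) (simp add: sum_levels[OF finf] spM)
  also have "\<dots> = (\<Sum>y\<in>f ` space L. \<integral>\<^sup>+x. ennreal y * indicator (f -` {y} \<inter> space L) x \<partial>M)"
    by (rule nn_integral_sum) measurable
  also have "\<dots> = levelsum L f \<mu>"
    unfolding levelsum_def using Bf
    by (intro sum.cong refl) (simp add: sM em nn_integral_cmult_indicator)
  finally show ?thesis unfolding f_def .
qed

text \<open>The generating functional of a Poisson process. The substitution w = exp(-f) with f = -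
  ln w, valid because \<open>w\<close> is strictly positive, reduces it to the Laplace
  functional.\<close>

lemma poisson_points:
  assumes pp: "poisson_process P L \<eta>"
    and \<eta>: "\<And>\<omega>. \<omega> \<in> space P \<Longrightarrow> \<eta> \<omega> = pts L (K \<omega>) (x \<omega>)"
    and x: "\<And>\<omega> i. \<omega> \<in> space P \<Longrightarrow> x \<omega> i \<in> space L"
    and w: "simple_function L w" "\<And>y. 0 < w y" "\<And>y. w y \<le> 1"
    and fin: "emeasure L {x \<in> space L. w x \<noteq> 1} < \<infinity>"
  shows "(\<integral>\<omega>. prodw w (K \<omega>) (x \<omega>) \<partial>P) = exp (- (\<integral>x. 1 - w x \<partial>L))"
proof -
  define f where "f y = - ln (w y)" for y
  have wf: "w = (\<lambda>y. exp (- f y))" using w by (auto simp: f_def fun_eq_iff)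
  have f: "simple_function L f" unfolding f_def
    using simple_function_compose1[OF w(1), of "\<lambda>u. - ln u"] by simp
  have nn: "0 \<le> f y" for y using w(2)[of y] w(3)[of y] by (simp add: f_def)
  have "(\<integral>\<omega>. prodw w (K \<omega>) (x \<omega>) \<partial>P) = (\<integral>\<omega>. eneg (levelsum L f (\<eta> \<omega>)) \<partial>P)"
    using \<eta> x f nn by (intro Bochner_Integration.integral_cong) (auto simp: eneg_levelsum_pts wf)
  also have "\<dots> = exp (- 1 * (\<integral>x. 1 - exp (- f x) \<partial>L))"
  proof (rule poisson_laplace_simple)
    have "{x \<in> space L. f x \<noteq> 0} = {x \<in> space L. w x \<noteq> 1}" by (auto simp: wf)
    then show "emeasure L {x \<in> space L. f x \<noteq> 0} < \<infinity>" using fin by simp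
  qed (use pp f nn in auto)
  finally show ?thesis by (simp add: wf)
qed

context exhaustion
begin

lemma expw_eq_1: "x \<notin> \<Union>(set Bs) \<Longrightarrow> expw Bs x = 1"
  by (induction Bs) auto

lemma loc_Union_fin:
  assumes "set Bs \<subseteq> loc" shows "emeasure L (\<Union>(set Bs)) < \<infinity>" "\<Union>(set Bs) \<in> sets L"
proof -
  obtain n where n: "\<And>B. B \<in> set Bs \<Longrightarrow> B \<subseteq> S n" using loc_list_cover[OF assms] by blast
  have "emeasure L (\<Union>(set Bs)) \<le> emeasure L (S n)"
    using n by (intro emeasure_mono) auto
  then show "emeasure L (\<Union>(set Bs)) < \<infinity>" using S_fin[of n] by simp
  show "\<Union>(set Bs) \<in> sets L"
    using loc_list_sets[OF assms] by auto
qed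

lemma simple_expw: "set Bs \<subseteq> sets L \<Longrightarrow> simple_function L (expw Bs)"
  unfolding expw_exp[abs_def] by (rule simple_function_compose1[OF simple_sum_indicator, where g="\<lambda>u. exp (- u)"])

lemma poisson_lap:
  assumes pp: "poisson_process P (scale_measure (ennreal r) L) \<zeta>" and r: "0 \<le> r" and Bs: "set Bs \<subseteq> loc"
  shows "(\<integral>\<omega>. lap Bs (\<zeta> \<omega>) \<partial>P) = exp (- r * (\<integral>x. 1 - expw Bs x \<partial>L))"
proof -
  have \<zeta>: "\<zeta> \<in> measurable P N"
    using pp N_meas_cong[of "scale_measure (ennreal r) L" L] by (simp add: poisson_process_def space_scale_measure)
  have BL: "set Bs \<subseteq> sets L" by (rule loc_list_sets[OF Bs])
  have "(\<integral>\<omega>. lap Bs (\<zeta> \<omega>) \<partial>P) = (\<integral>\<omega>. eneg (levelsum L (\<lambda>x. \<Sum>B\<leftarrow>Bs. indicator B x) (\<zeta> \<omega>)) \<partial>P)"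
    using measurable_space[OF \<zeta>] by (intro Bochner_Integration.integral_cong refl lap_levelsum BL) simp
  also have "\<dots> = exp (- r * (\<integral>x. 1 - exp (- (\<Sum>B\<leftarrow>Bs. indicator B x)) \<partial>L))"
  proof (rule poisson_laplace_simple[OF pp r])
    have "{x \<in> space L. (\<Sum>B\<leftarrow>Bs. indicator B x) \<noteq> (0::real)} \<subseteq> \<Union>(set Bs)"
    proof (rule subsetI, rule ccontr)
      fix x assume "x \<in> {x \<in> space L. (\<Sum>B\<leftarrow>Bs. indicator B x) \<noteq> (0::real)}" "x \<notin> \<Union> (set Bs)"
      then show False using expw_eq_1[of x Bs] by (simp add: expw_exp)
    qed
    then have "emeasure L {x \<in> space L. (\<Sum>B\<leftarrow>Bs. indicator B x) \<noteq> (0::real)} \<le> emeasure L (\<Union>(set Bs))"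
      using loc_Union_fin(2)[OF Bs] by (intro emeasure_mono) auto
    then show "emeasure L {x \<in> space L. (\<Sum>B\<leftarrow>Bs. indicator B x) \<noteq> (0::real)} < \<infinity>"
      using loc_Union_fin[OF Bs] by auto
    show "0 \<le> (\<Sum>B\<leftarrow>Bs. indicator B x :: real)" for x by (induction Bs) auto
  qed (rule simple_sum_indicator[OF BL])
  finally show ?thesis by (simp add: expw_exp)
qed

end

section \<open>Thinning and refreshing\<close>

text \<open>Turns independence as stated in \<open>thinned_superposition\<close>, for generated
  sigma-algebras, into a product law, to which Fubini applies.\<close>

lemma (in prob_space) distr_pair_indep:
  assumes X: "X \<in> measurable M A" and Y: "Y \<in> measurable M B"
    and indep: "indep_set (sets (vimage_algebra (space M) X A)) (sets (vimage_algebra (space M) Y B))"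
  shows "distr M (A \<Otimes>\<^sub>M B) (\<lambda>\<omega>. (X \<omega>, Y \<omega>)) = distr M A X \<Otimes>\<^sub>M distr M B Y"
proof (rule pair_measure_eqI[symmetric])
  interpret X: prob_space "distr M A X" by (rule prob_space_distr[OF X])
  interpret Y: prob_space "distr M B Y" by (rule prob_space_distr[OF Y])
  show "sigma_finite_measure (distr M A X)" "sigma_finite_measure (distr M B Y)" by unfold_locales
  show "sets (distr M A X \<Otimes>\<^sub>M distr M B Y) = sets (distr M (A \<Otimes>\<^sub>M B) (\<lambda>\<omega>. (X \<omega>, Y \<omega>)))"
    by simp
  note [measurable] = X Y
  fix E F assume "E \<in> sets (distr M A X)" "F \<in> sets (distr M B Y)"
  then have EF[measurable]: "E \<in> sets A" "F \<in> sets B" by simp_all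
  have "X -` E \<inter> space M \<in> sets (vimage_algebra (space M) X A)" "Y -` F \<inter> space M \<in> sets (vimage_algebra (space M) Y B)"
    using EF by (auto intro: in_vimage_algebra)
  from indep_setD[OF indep this]
  have "prob (X -` E \<inter> space M \<inter> (Y -` F \<inter> space M)) = prob (X -` E \<inter> space M) * prob (Y -` F \<inter> space M)" .
  moreover have "(\<lambda>\<omega>. (X \<omega>, Y \<omega>)) -` (E \<times> F) \<inter> space M = X -` E \<inter> space M \<inter> (Y -` F \<inter> space M)" by auto
  ultimately show "emeasure (distr M A X) E * emeasure (distr M B Y) F = emeasure (distr M (A \<Otimes>\<^sub>M B) (\<lambda>\<omega>. (X \<omega>, Y \<omega>))) (E \<times> F)"
    using EF by (simp add: emeasure_distr emeasure_eq_measure ennreal_mult)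
qed

lemma integral_pair_bounded:
  fixes f :: "'a \<times> 'b \<Rightarrow> real"
  assumes "prob_space A" "prob_space B" and f: "f \<in> borel_measurable (A \<Otimes>\<^sub>M B)"
    and bd: "\<And>z. z \<in> space (A \<Otimes>\<^sub>M B) \<Longrightarrow> \<bar>f z\<bar> \<le> C"
  shows "(\<integral>z. f z \<partial>(A \<Otimes>\<^sub>M B)) = (\<integral>x. (\<integral>y. f (x, y) \<partial>B) \<partial>A)"
proof -
  interpret A: prob_space A by fact
  interpret B: prob_space B by fact
  interpret AB: pair_prob_space A B ..
  have "integrable (A \<Otimes>\<^sub>M B) f" by (rule AB.integrable_bounded[OF f bd])
  then show ?thesis by (simp add: AB.integral_fst')
qed

text \<open>The integrand depends on the first n coordinates only, which reduces the infinite
  product measure to a finite one. It serves the coins as well as the uniform points of a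
  cluster.\<close>

lemma PiM_prod_expectation:
  fixes f :: "nat \<Rightarrow> 'a \<Rightarrow> real"
  assumes M: "prob_space M" and f: "\<And>i. f i \<in> borel_measurable M"
    and bd: "\<And>i x. x \<in> space M \<Longrightarrow> \<bar>f i x\<bar> \<le> C"
  shows "(\<integral>u. (\<Prod>i<n. f i (u i)) \<partial>(\<Pi>\<^sub>M i\<in>UNIV. M)) = (\<Prod>i<n. \<integral>x. f i x \<partial>M)"
proof -
  interpret M: prob_space M by fact
  interpret I: product_prob_space "\<lambda>_::nat. M" UNIV ..
  note [measurable] = f
  have "(\<integral>u. (\<Prod>i<n. f i (u i)) \<partial>(\<Pi>\<^sub>M i\<in>UNIV. M))
      = (\<integral>u. (\<Prod>i<n. f i (restrict u {..<n} i)) \<partial>(\<Pi>\<^sub>M i\<in>UNIV. M))"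
    by (intro Bochner_Integration.integral_cong prod.cong) auto
  also have "\<dots> = (\<integral>u. (\<Prod>i<n. f i (u i)) \<partial>distr (\<Pi>\<^sub>M i\<in>UNIV. M) (\<Pi>\<^sub>M i\<in>{..<n}. M) (\<lambda>u. restrict u {..<n}))"
    by (subst integral_distr) auto
  also have "\<dots> = (\<integral>u. (\<Prod>i<n. f i (u i)) \<partial>(\<Pi>\<^sub>M i\<in>{..<n}. M))"
    by (subst I.distr_PiM_restrict_finite) auto
  also have "\<dots> = (\<Prod>i<n. \<integral>x. f i x \<partial>M)"
    using M.integrable_bounded[OF f bd] by (intro I.product_integral_prod) auto
  finally show ?thesis .
qed

text \<open>Coins act only on points in \<open>T\<close>, all other points are kept. The same coins
  serve every \<open>T\<close>, so refreshments on different sets live on one space and can be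
  compared.\<close>

definition thin :: "'a measure \<Rightarrow> 'a set \<Rightarrow> enat \<Rightarrow> (nat \<Rightarrow> 'a) \<Rightarrow> (nat \<Rightarrow> bool) \<Rightarrow> 'a set \<Rightarrow> ennreal" where
  "thin L T k x u = pts L (\<lambda>i. enat i < k \<and> (u i \<or> x i \<notin> T)) x"

text \<open>The mean over one coin of the factor at a point: \<open>c x\<close> if the point is kept
  and 1 if it is removed.\<close>

definition thinw :: "'a set \<Rightarrow> real \<Rightarrow> ('a \<Rightarrow> real) \<Rightarrow> 'a \<Rightarrow> real" where
  "thinw T p c x = (if x \<in> T then p * c x + (1 - p) else c x)"

definition restrw :: "'a set \<Rightarrow> ('a \<Rightarrow> real) \<Rightarrow> 'a \<Rightarrow> real" where
  "restrw T c x = (if x \<in> T then c x else 1)"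

text \<open>The weights for which the generating functional of a Poisson process is available; the
  class is closed under coin averages, restriction to \<open>T\<close> and products.\<close>

definition weight :: "'a measure \<Rightarrow> ('a \<Rightarrow> real) \<Rightarrow> bool" where
  "weight L w \<longleftrightarrow> simple_function L w \<and> (\<forall>y. 0 < w y \<and> w y \<le> 1) \<and> emeasure L {x \<in> space L. w x \<noteq> 1} < \<infinity>"

lemma weight_measurable: "weight L w \<Longrightarrow> w \<in> borel_measurable L"
  by (simp add: weight_def borel_measurable_simple_function)

lemma weight_subset:
  assumes w: "simple_function L w" "\<And>y. 0 < w y" "\<And>y. w y \<le> 1"
    and A: "A \<in> sets L" "emeasure L A < \<infinity>" "{x \<in> space L. w x \<noteq> 1} \<subseteq> A"
  shows "weight L w"
  using emeasure_mono[OF A(3,1)] w A(2) by (auto simp: weight_def)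

lemma weight_supp: "weight L w \<Longrightarrow> {x \<in> space L. w x \<noteq> 1} \<in> sets L"
  using weight_measurable[of L w] by measurable

lemma simple_function_thinw:
  assumes "simple_function L c" "T \<in> sets L"
  shows "simple_function L (thinw T p c)" "simple_function L (restrw T c)"
proof -
  have 1: "simple_function L (\<lambda>x. p * c x + (1 - p))"
    using simple_function_compose1[OF assms(1), of "\<lambda>u. p * u + (1 - p)"] .
  show "simple_function L (thinw T p c)" "simple_function L (restrw T c)"
    unfolding thinw_def[abs_def] restrw_def[abs_def]
    by (intro simple_function_If_set assms(1) 1 simple_function_const sets.Int assms(2) sets.top)+
qed

lemma convex_unit:
  assumes "0 < p" "p \<le> 1" "0 < c" "c \<le> (1::real)"
  shows "0 < p * c + (1 - p)" "p * c + (1 - p) \<le> 1"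
proof -
  have "0 < p * c" using assms by simp
  then show "0 < p * c + (1 - p)" using assms by linarith
  have "p * c \<le> p" using assms by (simp add: mult_left_le)
  then show "p * c + (1 - p) \<le> 1" by linarith
qed

lemma weight_thinw:
  assumes c: "weight L c" and p: "0 < p" "p \<le> 1" and T: "T \<in> sets L"
  shows "weight L (thinw T p c)"
proof (rule weight_subset[OF _ _ _ weight_supp[OF c]])
  show "simple_function L (thinw T p c)" using c T by (intro simple_function_thinw) (auto simp: weight_def)
  have cu: "0 < c y" "c y \<le> 1" for y using c by (auto simp: weight_def)
  show "0 < thinw T p c y" "thinw T p c y \<le> 1" for y
    using cu[of y] convex_unit[OF p, of "c y"] by (auto simp: thinw_def)
  show "emeasure L {x \<in> space L. c x \<noteq> 1} < \<infinity>" using c by (simp add: weight_def)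
qed (auto simp: thinw_def)

lemma weight_restrw:
  assumes c: "weight L c" and T: "T \<in> sets L"
  shows "weight L (restrw T c)"
proof (rule weight_subset[OF _ _ _ weight_supp[OF c]])
  show "simple_function L (restrw T c)" using c T by (intro simple_function_thinw) (auto simp: weight_def)
  show "0 < restrw T c y" "restrw T c y \<le> 1" for y
    using c by (auto simp: restrw_def weight_def)
  show "emeasure L {x \<in> space L. c x \<noteq> 1} < \<infinity>" using c by (simp add: weight_def)
qed (auto simp: restrw_def)

lemma weight_mult:
  assumes b: "weight L b" and c: "weight L c"
  shows "weight L (\<lambda>x. b x * c x)"
proof (rule weight_subset[where A="{x \<in> space L. b x \<noteq> 1} \<union> {x \<in> space L. c x \<noteq> 1}"])
  show "simple_function L (\<lambda>x. b x * c x)"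
    using b c by (intro simple_function_mult) (auto simp: weight_def)
  have "emeasure L ({x \<in> space L. b x \<noteq> 1} \<union> {x \<in> space L. c x \<noteq> 1})
      \<le> emeasure L {x \<in> space L. b x \<noteq> 1} + emeasure L {x \<in> space L. c x \<noteq> 1}"
    using weight_supp[OF b] weight_supp[OF c] by (rule emeasure_subadditive)
  also have "\<dots> < \<infinity>" using b c by (simp add: weight_def)
  finally show "emeasure L ({x \<in> space L. b x \<noteq> 1} \<union> {x \<in> space L. c x \<noteq> 1}) < \<infinity>" .
  show "{x \<in> space L. b x \<noteq> 1} \<union> {x \<in> space L. c x \<noteq> 1} \<in> sets L"
    using weight_supp[OF b] weight_supp[OF c] by blast
  show "0 < b y * c y" "b y * c y \<le> 1" for y
    using b c by (auto simp: weight_def intro: mult_le_one less_imp_le)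
qed auto

lemma weight_integrable:
  assumes w: "weight L w" shows "integrable L (\<lambda>x. 1 - w x)"
proof (rule Bochner_Integration.integrable_bound)
  show "integrable L (indicator {x \<in> space L. w x \<noteq> 1} :: _ \<Rightarrow> real)"
    using w weight_supp[OF w] by (intro integrable_real_indicator) (auto simp: weight_def)
  show "(\<lambda>x. 1 - w x) \<in> borel_measurable L" using weight_measurable[OF w] by measurable
  show "AE x in L. norm (1 - w x) \<le> norm (indicator {x \<in> space L. w x \<noteq> 1} x :: real)"
    using w by (intro AE_I2) (auto simp: weight_def indicator_def less_imp_le abs_le_iff)
qed

text \<open>Collects the exponents of the points and of two noise terms into one integral, so that
  laws can be compared by a pointwise identity of integrands.\<close>

lemma exp_weight_combine:
  assumes "weight L v" "weight L b" "weight L c"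
  shows "exp (- (\<integral>x. 1 - v x \<partial>L)) * (exp (- q * (\<integral>x. 1 - b x \<partial>L)) * exp (- q * (\<integral>x. 1 - c x \<partial>L)))
    = exp (- (\<integral>x. (1 - v x) + q * (1 - b x) + q * (1 - c x) \<partial>L))"
proof -
  have "(\<integral>x. (1 - v x) + q * (1 - b x) + q * (1 - c x) \<partial>L)
      = (\<integral>x. 1 - v x \<partial>L) + q * (\<integral>x. 1 - b x \<partial>L) + q * (\<integral>x. 1 - c x \<partial>L)"
    using assms[THEN weight_integrable]
    by (simp only: Bochner_Integration.integral_add Bochner_Integration.integrable_add
        integrable_mult_right integral_mult_right_zero)
  then show ?thesis
    by (simp only: exp_add[symmetric] minus_mult_left[symmetric] minus_add_distrib add.assoc)
qed

text \<open>Given the points, the coins are independent, so partial products integrate factor by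
  factor; the infinite product follows by dominated convergence with bound 1.\<close>

lemma coin_expectation:
  assumes p: "0 < p" "p \<le> 1" and c: "\<And>y. 0 < c y" "\<And>y. c y \<le> 1"
  shows "(\<integral>u. prodw c (\<lambda>i. enat i < k \<and> (u i \<or> x i \<notin> T)) x \<partial>(\<Pi>\<^sub>M i\<in>UNIV. measure_pmf (bernoulli_pmf p)))
    = prodw (thinw T p c) (\<lambda>i. enat i < k) x"
proof -
  let ?C = "\<Pi>\<^sub>M i\<in>(UNIV::nat set). measure_pmf (bernoulli_pmf p)"
  interpret C: product_prob_space "\<lambda>_::nat. measure_pmf (bernoulli_pmf p)" UNIV ..
  interpret C: prob_space ?C by (rule prob_space_PiM) (rule prob_space_measure_pmf)
  define F where "F i v = (if enat i < k \<and> (v \<or> x i \<notin> T) then c (x i) else 1)" for i v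
  have F01: "0 \<le> F i v \<and> F i v \<le> 1" for i v using c by (auto simp: F_def less_imp_le)
  have EF: "(\<integral>v. F i v \<partial>bernoulli_pmf p) = (if enat i < k then thinw T p c (x i) else 1)" for i
    using p by (simp add: F_def thinw_def algebra_simps)
  have lim: "(\<lambda>n. \<Prod>i<n. F i (u i)) \<longlonglongrightarrow> prodw c (\<lambda>i. enat i < k \<and> (u i \<or> x i \<notin> T)) x" for u
    unfolding F_def using c by (intro prodw_tendsto) (auto simp: less_imp_le)
  have [measurable]: "(\<lambda>u. F i (u i)) \<in> borel_measurable ?C" for i
    by (rule measurable_compose[OF measurable_component_singleton]) auto
  have "(\<lambda>n. \<integral>u. (\<Prod>i<n. F i (u i)) \<partial>?C) \<longlonglongrightarrow> (\<integral>u. prodw c (\<lambda>i. enat i < k \<and> (u i \<or> x i \<notin> T)) x \<partial>?C)"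
  proof (rule integral_dominated_convergence[where w="\<lambda>_. 1"])
    show "(\<lambda>u. prodw c (\<lambda>i. enat i < k \<and> (u i \<or> x i \<notin> T)) x) \<in> borel_measurable ?C"
      by (rule borel_measurable_LIMSEQ_real[where u="\<lambda>n u. \<Prod>i<n. F i (u i)", OF lim]) measurable
    have "0 \<le> (\<Prod>i<n. F i (u i)) \<and> (\<Prod>i<n. F i (u i)) \<le> 1" for n u
      using F01 by (auto intro!: prod_nonneg prod_le_1)
    then show "AE u in ?C. norm (\<Prod>i<n. F i (u i)) \<le> 1" for n
      by (intro AE_I2) simp
    show "AE u in ?C. (\<lambda>n. \<Prod>i<n. F i (u i)) \<longlonglongrightarrow> prodw c (\<lambda>i. enat i < k \<and> (u i \<or> x i \<notin> T)) x"
      by (intro AE_I2 lim)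
  qed measurable
  moreover have "(\<integral>u. (\<Prod>i<n. F i (u i)) \<partial>?C) = (\<Prod>i<n. if enat i < k then thinw T p c (x i) else 1)" for n
  proof (subst PiM_prod_expectation[where C=1])
    show "\<bar>F i v\<bar> \<le> 1" for i v using F01[of i v] by simp
  qed (simp_all add: EF prob_space_measure_pmf)
  moreover have "(\<lambda>n. \<Prod>i<n. if enat i < k then thinw T p c (x i) else 1) \<longlonglongrightarrow> prodw (thinw T p c) (\<lambda>i. enat i < k) x"
  proof (rule prodw_tendsto)
    show "0 \<le> thinw T p c y" "thinw T p c y \<le> 1" for y
      using c[of y] convex_unit[OF p, of "c y"] by (auto simp: thinw_def)
  qed
  ultimately show ?thesis using LIMSEQ_unique by fastforce
qed

text \<open>The exponent density on \<open>T\<close>: common points have rate p and carry both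
  factors, while points of only one configuration have rate 1 - p on each side.\<close>

definition pair_rate :: "real \<Rightarrow> real \<Rightarrow> real \<Rightarrow> real" where
  "pair_rate p b c = p * (1 - b * c) + (1 - p) * (1 - b) + (1 - p) * (1 - c)"

context exhaustion
begin

text \<open>The joint law of \<open>(A + B + M, A + C + M)\<close>, where \<open>A\<close>, \<open>B\<close>, \<open>C\<close> and \<open>M\<close> are independent Poisson
  processes, the first three on \<open>T\<close> with intensities \<open>p L\<close>, \<open>(1 - p) L\<close>, \<open>(1 - p) L\<close> and the last one
  outside \<open>T\<close> with intensity \<open>L\<close>.\<close>

definition pair_law :: "real \<Rightarrow> 'a set \<Rightarrow> 'b measure \<Rightarrow> ('b \<Rightarrow> 'a set \<Rightarrow> ennreal) \<Rightarrow> ('b \<Rightarrow> 'a set \<Rightarrow> ennreal) \<Rightarrow> bool" where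
  "pair_law p T M X Y \<longleftrightarrow> prob_space M \<and> X \<in> measurable M N \<and> Y \<in> measurable M N \<and>
     (\<forall>Bs Cs. set Bs \<subseteq> loc \<longrightarrow> set Cs \<subseteq> loc \<longrightarrow>
       (\<integral>\<omega>. lap Bs (X \<omega>) * lap Cs (Y \<omega>) \<partial>M)
         = exp (- (\<integral>x. (if x \<in> T then pair_rate p (expw Bs x) (expw Cs x) else 1 - expw Bs x * expw Cs x) \<partial>L)))"

lemma pair_law_distr_eq:
  assumes "pair_law p T M X Y" "pair_law p T M' X' Y'"
  shows "distr M (N \<Otimes>\<^sub>M N) (\<lambda>\<omega>. (X \<omega>, Y \<omega>)) = distr M' (N \<Otimes>\<^sub>M N) (\<lambda>\<omega>. (X' \<omega>, Y' \<omega>))"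
  using assms unfolding pair_law_def by (intro pair_distr_eqI) auto

lemma weight_expw: "set Bs \<subseteq> loc \<Longrightarrow> weight L (expw Bs)"
proof (rule weight_subset[where A="\<Union>(set Bs)"])
  assume Bs: "set Bs \<subseteq> loc"
  show "simple_function L (expw Bs)" by (rule simple_expw[OF loc_list_sets[OF Bs]])
  show "\<Union> (set Bs) \<in> sets L" "emeasure L (\<Union> (set Bs)) < \<infinity>" using loc_Union_fin[OF Bs] by auto
  show "{x \<in> space L. expw Bs x \<noteq> 1} \<subseteq> \<Union> (set Bs)" using expw_eq_1[of _ Bs] by blast
qed simp_all

end

section \<open>Refreshments driven by fixed points, coins and noise\<close>

locale thinning = exhaustion L S for L :: "'a measure" and S +
  fixes P :: "'w measure" and \<eta> :: "'w \<Rightarrow> 'a set \<Rightarrow> ennreal" and p :: real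
    and \<kappa> :: "'w \<Rightarrow> enat" and X :: "'w \<Rightarrow> nat \<Rightarrow> 'a" and U :: "'w \<Rightarrow> nat \<Rightarrow> bool"
    and \<zeta> :: "'w \<Rightarrow> 'a set \<Rightarrow> ennreal"
  assumes pp: "poisson_process P L \<eta>"
    and p_pos: "0 < p" and p_le: "p \<le> 1"
    and KX: "(\<lambda>\<omega>. (\<kappa> \<omega>, X \<omega>)) \<in> measurable P (count_space UNIV \<Otimes>\<^sub>M (\<Pi>\<^sub>M i\<in>UNIV. L))"
    and U: "U \<in> measurable P (\<Pi>\<^sub>M i\<in>UNIV. count_space UNIV)"
    and U_distr: "distr P (\<Pi>\<^sub>M i\<in>UNIV. count_space UNIV) U
          = (\<Pi>\<^sub>M i\<in>UNIV. measure_pmf (bernoulli_pmf p))"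
    and pp_zeta: "poisson_process P (scale_measure (ennreal (1 - p)) L) \<zeta>"
    and indep1: "prob_space.indep_set P
          (sets (vimage_algebra (space P) (\<lambda>\<omega>. (\<kappa> \<omega>, X \<omega>)) (count_space UNIV \<Otimes>\<^sub>M (\<Pi>\<^sub>M i\<in>UNIV. L))))
          (sets (vimage_algebra (space P) (\<lambda>\<omega>. (U \<omega>, \<zeta> \<omega>)) ((\<Pi>\<^sub>M i\<in>UNIV. count_space UNIV) \<Otimes>\<^sub>M N_meas L)))"
    and indep2: "prob_space.indep_set P
          (sets (vimage_algebra (space P) U (\<Pi>\<^sub>M i\<in>UNIV. count_space UNIV)))
          (sets (vimage_algebra (space P) \<zeta> (N_meas L)))"
    and eta_pts: "\<And>\<omega>. \<omega> \<in> space P \<Longrightarrow> \<eta> \<omega> = pts L (\<lambda>i. enat i < \<kappa> \<omega>) (X \<omega>)"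
begin

abbreviation "ES \<equiv> (count_space UNIV :: enat measure) \<Otimes>\<^sub>M (\<Pi>\<^sub>M i\<in>(UNIV::nat set). L)"
abbreviation "CS \<equiv> (\<Pi>\<^sub>M i\<in>(UNIV::nat set). count_space (UNIV::bool set))"
abbreviation "WS \<equiv> CS \<Otimes>\<^sub>M N"
abbreviation "RS \<equiv> ES \<Otimes>\<^sub>M WS"
abbreviation "prod_full w e \<equiv> prodw w (\<lambda>i. enat i < fst e) (snd e)"
abbreviation "noise T Bs \<equiv> exp (- (1 - p) * (\<integral>x. 1 - restrw T (expw Bs) x \<partial>L))"

text \<open>The laws of the enumerated points and of the marks. Enumerations are kept instead of
  configurations because a coin belongs to an index. By independence, conditioning on the points is
  integration over \<open>W\<close> with the points fixed.\<close>

definition "R = distr P ES (\<lambda>\<omega>. (\<kappa> \<omega>, X \<omega>))"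
definition "W = distr P WS (\<lambda>\<omega>. (U \<omega>, \<zeta> \<omega>))"

definition full :: "enat \<times> (nat \<Rightarrow> 'a) \<Rightarrow> 'a set \<Rightarrow> ennreal" where
  "full e = pts L (\<lambda>i. enat i < fst e) (snd e)"

text \<open>Both the thinning and the fresh noise are confined to \<open>T\<close>, so on a set of
  finite intensity only finitely many points change almost surely.\<close>

definition refresh :: "'a set \<Rightarrow> enat \<times> (nat \<Rightarrow> 'a) \<Rightarrow> (nat \<Rightarrow> bool) \<times> ('a set \<Rightarrow> ennreal) \<Rightarrow> 'a set \<Rightarrow> ennreal" where
  "refresh T e w = cm_add (thin L T (fst e) (snd e) (fst w)) (restr L T (snd w))"

sublocale P: prob_space P
  using pp by (simp add: poisson_process_def)

lemma eta_meas [measurable]: "\<eta> \<in> measurable P N"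
  using pp by (simp add: poisson_process_def)

lemma zeta_meas [measurable]: "\<zeta> \<in> measurable P N"
  using pp_zeta N_meas_cong[of "scale_measure (ennreal (1 - p)) L" L]
  by (simp add: poisson_process_def space_scale_measure)

lemma KX_meas [measurable]: "(\<lambda>\<omega>. (\<kappa> \<omega>, X \<omega>)) \<in> measurable P ES"
  by (rule KX)

lemma U_meas [measurable]: "U \<in> measurable P CS"
  by (rule U)

lemma sets_R [measurable_cong, simp]: "sets R = sets ES" and sets_W [measurable_cong, simp]: "sets W = sets WS"
  by (simp_all add: R_def W_def)

lemma space_R [simp]: "space R = space ES" and space_W [simp]: "space W = space WS"
  by (simp_all add: R_def W_def)

lemma prob_R: "prob_space R" and prob_W: "prob_space W"
  unfolding R_def W_def by (intro P.prob_space_distr; measurable)+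

lemma distr_RW: "distr P RS (\<lambda>\<omega>. ((\<kappa> \<omega>, X \<omega>), (U \<omega>, \<zeta> \<omega>))) = R \<Otimes>\<^sub>M W"
  unfolding R_def W_def using indep1 by (intro P.distr_pair_indep) measurable

lemma W_eq: "W = (\<Pi>\<^sub>M i\<in>UNIV. measure_pmf (bernoulli_pmf p)) \<Otimes>\<^sub>M distr P N \<zeta>"
  unfolding U_distr[symmetric] W_def using indep2 by (intro P.distr_pair_indep) measurable

lemma full_meas [measurable]: "full \<in> measurable ES N"
  unfolding full_def by (rule measurable_pts) measurable

lemma thin_meas:
  assumes [measurable]: "T \<in> sets L"
  shows "(\<lambda>z. thin L T (fst (fst z)) (snd (fst z)) (snd z)) \<in> measurable (ES \<Otimes>\<^sub>M CS) N"
  unfolding thin_def by (rule measurable_pts) measurable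

lemma refresh_meas:
  assumes [measurable]: "T \<in> sets L"
  shows "(\<lambda>z. refresh T (fst z) (snd z)) \<in> measurable RS N"
proof -
  have "(\<lambda>z. (fst z, fst (snd z))) \<in> measurable RS (ES \<Otimes>\<^sub>M CS)" by measurable
  from measurable_compose[OF this thin_meas[OF assms]]
  have [measurable]: "(\<lambda>z. thin L T (fst (fst z)) (snd (fst z)) (fst (snd z))) \<in> measurable RS N"
    by simp
  have "(\<lambda>z. snd (snd z)) \<in> measurable RS N" by measurable
  from measurable_compose[OF this measurable_restr[OF assms]]
  have [measurable]: "(\<lambda>z. restr L T (snd (snd z))) \<in> measurable RS N" .
  show ?thesis unfolding refresh_def by measurable
qed

lemma lap_full: "set Bs \<subseteq> loc \<Longrightarrow> lap Bs (full e) = prod_full (expw Bs) e"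
  unfolding full_def by (intro lap_pts loc_list_sets)

lemma R_prodw:
  assumes w: "weight L w"
  shows "(\<integral>e. prod_full w e \<partial>R) = exp (- (\<integral>x. 1 - w x \<partial>L))"
proof -
  note [measurable] = weight_measurable[OF w]
  have [measurable]: "(\<lambda>e. prod_full w e) \<in> borel_measurable ES"
    by (rule measurable_prodw[where L=L]) measurable
  have "(\<integral>e. prod_full w e \<partial>R) = (\<integral>\<omega>. prodw w (\<lambda>i. enat i < \<kappa> \<omega>) (X \<omega>) \<partial>P)"
    unfolding R_def by (subst integral_distr) auto
  also have "\<dots> = exp (- (\<integral>x. 1 - w x \<partial>L))"
  proof (rule poisson_points[OF pp eta_pts])
    fix \<omega> i assume "\<omega> \<in> space P"
    from measurable_space[OF KX this] show "X \<omega> i \<in> space L"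
      by (auto simp: space_pair_measure space_PiM)
  qed (use w in \<open>auto simp: weight_def\<close>)
  finally show ?thesis .
qed

lemma integral_marks:
  fixes f :: "_ \<Rightarrow> real"
  assumes f: "f \<in> borel_measurable RS" and bd: "\<And>z. z \<in> space RS \<Longrightarrow> \<bar>f z\<bar> \<le> C"
  shows "(\<integral>\<omega>. f ((\<kappa> \<omega>, X \<omega>), (U \<omega>, \<zeta> \<omega>)) \<partial>P) = (\<integral>e. (\<integral>w. f (e, w) \<partial>W) \<partial>R)"
proof -
  have "(\<integral>\<omega>. f ((\<kappa> \<omega>, X \<omega>), (U \<omega>, \<zeta> \<omega>)) \<partial>P) = (\<integral>z. f z \<partial>(R \<Otimes>\<^sub>M W))"
    unfolding distr_RW[symmetric] by (rule integral_distr[OF _ f, symmetric]) measurable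
  also have "\<dots> = (\<integral>e. (\<integral>w. f (e, w) \<partial>W) \<partial>R)"
    using f bd by (intro integral_pair_bounded[OF prob_R prob_W]) (auto simp: space_pair_measure)
  finally show ?thesis .
qed

text \<open>Retained points and noise get separate lists: the noise enters a refreshment only
  through sets intersected with \<open>T\<close>, and an empty list \<open>Ds\<close> isolates the
  retained points.\<close>

lemma W_lap:
  assumes Bs: "set Bs \<subseteq> loc" and Ds: "set Ds \<subseteq> loc" and T: "T \<in> sets L" and e: "e \<in> space ES"
  shows "(\<integral>w. lap Bs (thin L T (fst e) (snd e) (fst w)) * lap Ds (snd w) \<partial>W)
    = prod_full (thinw T p (expw Bs)) e * exp (- (1 - p) * (\<integral>x. 1 - expw Ds x \<partial>L))"
proof -
  let ?C = "\<Pi>\<^sub>M i\<in>(UNIV::nat set). measure_pmf (bernoulli_pmf p)"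
  have pC: "prob_space ?C" by (rule prob_space_PiM) (rule prob_space_measure_pmf)
  have pZ: "prob_space (distr P N \<zeta>)" by (rule P.prob_space_distr) measurable
  have BsL: "set Bs \<subseteq> sets L" by (rule loc_list_sets[OF Bs])
  have lm[measurable]: "lap Bs \<in> borel_measurable N" "lap Ds \<in> borel_measurable N"
    using Bs Ds by (auto intro!: lap_measurable loc_sets)
  have "(\<lambda>w. (e, fst w)) \<in> measurable WS (ES \<Otimes>\<^sub>M CS)" using e by measurable
  from measurable_compose[OF measurable_compose[OF this thin_meas[OF T]] lm(1)]
  have [measurable]: "(\<lambda>w. lap Bs (thin L T (fst e) (snd e) (fst w))) \<in> borel_measurable WS" by simp
  have sC: "sets (?C \<Otimes>\<^sub>M distr P N \<zeta>) = sets WS"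
    by (intro sets_pair_measure_cong sets_PiM_cong) auto
  have "(\<integral>w. lap Bs (thin L T (fst e) (snd e) (fst w)) * lap Ds (snd w) \<partial>W)
      = (\<integral>u. (\<integral>z. lap Bs (thin L T (fst e) (snd e) (fst (u, z))) * lap Ds (snd (u, z)) \<partial>distr P N \<zeta>) \<partial>?C)"
    unfolding W_eq
  proof (rule integral_pair_bounded[OF pC pZ, where C=1])
    show "(\<lambda>w. lap Bs (thin L T (fst e) (snd e) (fst w)) * lap Ds (snd w)) \<in> borel_measurable (?C \<Otimes>\<^sub>M distr P N \<zeta>)"
      unfolding measurable_cong_sets[OF sC refl] by measurable
  qed (simp add: mult_le_one)
  also have "\<dots> = (\<integral>u. lap Bs (thin L T (fst e) (snd e) u) \<partial>?C) * (\<integral>z. lap Ds z \<partial>distr P N \<zeta>)"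
    by simp
  also have "(\<integral>u. lap Bs (thin L T (fst e) (snd e) u) \<partial>?C) = prod_full (thinw T p (expw Bs)) e"
    unfolding thin_def lap_pts[OF BsL] using p_pos p_le by (intro coin_expectation) auto
  also have "(\<integral>z. lap Ds z \<partial>distr P N \<zeta>) = (\<integral>\<omega>. lap Ds (\<zeta> \<omega>) \<partial>P)"
    by (rule integral_distr) measurable
  also have "\<dots> = exp (- (1 - p) * (\<integral>x. 1 - expw Ds x \<partial>L))"
    using Ds p_le by (intro poisson_lap[OF pp_zeta]) auto
  finally show ?thesis .
qed

lemma W_refresh:
  assumes Cs: "set Cs \<subseteq> loc" and T: "T \<in> sets L" and e: "e \<in> space ES"
  shows "(\<integral>w. lap Cs (refresh T e w) \<partial>W) = prod_full (thinw T p (expw Cs)) e * noise T Cs"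
  using W_lap[OF Cs _ T e, of "map (\<lambda>B. B \<inter> T) Cs"] Cs T
  by (auto simp: refresh_def lap_cm_add lap_restr[OF loc_list_sets[OF Cs]] expw_map_Int restrw_def intro!: loc_Int)

lemma thinw_unit:
  assumes c: "\<And>y. 0 < c y" "\<And>y. c y \<le> 1"
  shows "0 \<le> thinw T p c y" "thinw T p c y \<le> 1"
  using c[of y] convex_unit[OF p_pos p_le, of "c y"] by (auto simp: thinw_def)

text \<open>Averaging the marks first turns the weight c on the points into p c + (1 - p) on
  \<open>T\<close>. Together with the noise, 1 - b (p c + 1 - p) + (1 - p)(1 - c) is the required
  rate.\<close>

lemma pair_law_eta:
  assumes T: "T \<in> sets L"
  shows "pair_law p T P \<eta> (\<lambda>\<omega>. refresh T (\<kappa> \<omega>, X \<omega>) (U \<omega>, \<zeta> \<omega>))"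
  unfolding pair_law_def
proof (intro conjI allI impI)
  show "prob_space P" by (rule P.prob_space_axioms)
  note [measurable] = refresh_meas[OF T]
  have "(\<lambda>\<omega>. ((\<kappa> \<omega>, X \<omega>), (U \<omega>, \<zeta> \<omega>))) \<in> measurable P RS" by measurable
  from measurable_compose[OF this refresh_meas[OF T]]
  show [measurable]: "(\<lambda>\<omega>. refresh T (\<kappa> \<omega>, X \<omega>) (U \<omega>, \<zeta> \<omega>)) \<in> measurable P N" by simp
  fix Bs Cs assume Bs: "set Bs \<subseteq> loc" and Cs: "set Cs \<subseteq> loc"
  have [measurable]: "lap Bs \<in> borel_measurable N" "lap Cs \<in> borel_measurable N"
    using Bs Cs by (auto intro!: lap_measurable loc_sets)
  have twB: "weight L (expw Bs)" and twC: "weight L (thinw T p (expw Cs))" and twR: "weight L (restrw T (expw Cs))"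
    using Bs Cs T p_pos p_le by (auto intro!: weight_expw weight_thinw weight_restrw)
  have "(\<integral>\<omega>. lap Bs (\<eta> \<omega>) * lap Cs (refresh T (\<kappa> \<omega>, X \<omega>) (U \<omega>, \<zeta> \<omega>)) \<partial>P)
      = (\<integral>\<omega>. (\<lambda>z. lap Bs (full (fst z)) * lap Cs (refresh T (fst z) (snd z))) ((\<kappa> \<omega>, X \<omega>), (U \<omega>, \<zeta> \<omega>)) \<partial>P)"
    by (intro Bochner_Integration.integral_cong refl) (simp add: full_def eta_pts)
  also have "\<dots> = (\<integral>e. (\<integral>w. lap Bs (full e) * lap Cs (refresh T e w) \<partial>W) \<partial>R)"
    by (subst integral_marks[where C=1]) (auto simp: mult_le_one)
  also have "\<dots> = (\<integral>e. prod_full (\<lambda>x. expw Bs x * thinw T p (expw Cs) x) e * noise T Cs \<partial>R)"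
  proof (rule Bochner_Integration.integral_cong[OF refl])
    fix e assume "e \<in> space R"
    then have "e \<in> space ES" by simp
    from W_refresh[OF Cs T this]
    show "(\<integral>w. lap Bs (full e) * lap Cs (refresh T e w) \<partial>W)
        = prod_full (\<lambda>x. expw Bs x * thinw T p (expw Cs) x) e * noise T Cs"
      using thinw_unit[of "expw Cs" T] by (subst prodw_mult[symmetric]) (auto simp: less_imp_le lap_full[OF Bs])
  qed
  \<comment> \<open>The factor \<open>noise T []\<close> equals 1; it supplies the second noise term
    that \<open>exp_weight_combine\<close> expects.\<close>
  also have "\<dots> = exp (- (\<integral>x. 1 - expw Bs x * thinw T p (expw Cs) x \<partial>L)) * (noise T Cs * noise T [])"
    by (simp add: R_prodw[OF weight_mult[OF twB twC]] restrw_def cong: if_cong)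
  also have "\<dots> = exp (- (\<integral>x. (1 - expw Bs x * thinw T p (expw Cs) x)
      + (1 - p) * (1 - restrw T (expw Cs) x) + (1 - p) * (1 - restrw T (expw []) x) \<partial>L))"
    using T by (intro exp_weight_combine weight_mult twB twC twR weight_restrw weight_expw) auto
  also have "(\<lambda>x. (1 - expw Bs x * thinw T p (expw Cs) x)
      + (1 - p) * (1 - restrw T (expw Cs) x) + (1 - p) * (1 - restrw T (expw []) x))
      = (\<lambda>x. if x \<in> T then pair_rate p (expw Bs x) (expw Cs x) else 1 - expw Bs x * expw Cs x)"
    by (auto simp: fun_eq_iff thinw_def restrw_def pair_rate_def algebra_simps)
  finally show "(\<integral>\<omega>. lap Bs (\<eta> \<omega>) * lap Cs (refresh T (\<kappa> \<omega>, X \<omega>) (U \<omega>, \<zeta> \<omega>)) \<partial>P)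
      = exp (- (\<integral>x. (if x \<in> T then pair_rate p (expw Bs x) (expw Cs x) else 1 - expw Bs x * expw Cs x) \<partial>L))" .
qed (rule eta_meas)

text \<open>A point survives both refreshments with probability p^2. Points of one refreshment only
  have rate p (1 - p) from the shared points and 1 - p from the noise, together 1 - p^2. With p =
  e^(-t/2) this is the law at time t.\<close>

lemma pair_law_two:
  assumes T: "T \<in> sets L"
  shows "pair_law (p\<^sup>2) T (R \<Otimes>\<^sub>M (W \<Otimes>\<^sub>M W)) (\<lambda>z. refresh T (fst z) (fst (snd z))) (\<lambda>z. refresh T (fst z) (snd (snd z)))"
  unfolding pair_law_def
proof (intro conjI allI impI)
  have pWW: "prob_space (W \<Otimes>\<^sub>M W)" by (intro prob_space_pair prob_W)
  show "prob_space (R \<Otimes>\<^sub>M (W \<Otimes>\<^sub>M W))" by (intro prob_space_pair prob_R pWW)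
  have "(\<lambda>z. (fst z, fst (snd z))) \<in> measurable (R \<Otimes>\<^sub>M (W \<Otimes>\<^sub>M W)) RS"
    "(\<lambda>z. (fst z, snd (snd z))) \<in> measurable (R \<Otimes>\<^sub>M (W \<Otimes>\<^sub>M W)) RS"
    by measurable
  from this[THEN measurable_compose[OF _ refresh_meas[OF T]]]
  show [measurable]: "(\<lambda>z. refresh T (fst z) (fst (snd z))) \<in> measurable (R \<Otimes>\<^sub>M (W \<Otimes>\<^sub>M W)) N"
    "(\<lambda>z. refresh T (fst z) (snd (snd z))) \<in> measurable (R \<Otimes>\<^sub>M (W \<Otimes>\<^sub>M W)) N" by simp_all
  fix Bs Cs assume Bs: "set Bs \<subseteq> loc" and Cs: "set Cs \<subseteq> loc"
  have lm[measurable]: "lap Bs \<in> borel_measurable N" "lap Cs \<in> borel_measurable N"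
    using Bs Cs by (auto intro!: lap_measurable loc_sets)
  have twB: "weight L (thinw T p (expw Bs))" and twC: "weight L (thinw T p (expw Cs))"
    and twRB: "weight L (restrw T (expw Bs))" and twR: "weight L (restrw T (expw Cs))"
    using Bs Cs T p_pos p_le by (auto intro!: weight_expw weight_thinw weight_restrw)
  have "(\<integral>z. lap Bs (refresh T (fst z) (fst (snd z))) * lap Cs (refresh T (fst z) (snd (snd z))) \<partial>(R \<Otimes>\<^sub>M (W \<Otimes>\<^sub>M W)))
      = (\<integral>e. (\<integral>ww. lap Bs (refresh T e (fst ww)) * lap Cs (refresh T e (snd ww)) \<partial>(W \<Otimes>\<^sub>M W)) \<partial>R)"
    by (subst integral_pair_bounded[OF prob_R pWW, of _ 1]) (auto simp: mult_le_one)
  also have "\<dots> = (\<integral>e. prod_full (\<lambda>x. thinw T p (expw Bs) x * thinw T p (expw Cs) x) e * (noise T Bs * noise T Cs) \<partial>R)"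
  proof (rule Bochner_Integration.integral_cong[OF refl])
    fix e assume "e \<in> space R"
    then have e: "e \<in> space ES" by simp
    have "(\<lambda>w. (e, w)) \<in> measurable WS RS" using e by measurable
    from measurable_compose[OF this refresh_meas[OF T]]
    have rm: "refresh T e \<in> measurable W N" by simp
    have [measurable]: "(\<lambda>w. lap Bs (refresh T e w)) \<in> borel_measurable W" "(\<lambda>w. lap Cs (refresh T e w)) \<in> borel_measurable W"
      using lm[THEN measurable_compose[OF rm]] by auto
    have "(\<integral>ww. lap Bs (refresh T e (fst ww)) * lap Cs (refresh T e (snd ww)) \<partial>(W \<Otimes>\<^sub>M W))
        = (\<integral>w. (\<integral>w'. lap Bs (refresh T e w) * lap Cs (refresh T e w') \<partial>W) \<partial>W)"
      by (subst integral_pair_bounded[OF prob_W prob_W, of _ 1]) (auto simp: mult_le_one)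
    also have "\<dots> = (prod_full (thinw T p (expw Bs)) e * prod_full (thinw T p (expw Cs)) e) * (noise T Bs * noise T Cs)"
      by (simp add: W_refresh[OF Cs T e] W_refresh[OF Bs T e])
    also have "\<dots> = prod_full (\<lambda>x. thinw T p (expw Bs) x * thinw T p (expw Cs) x) e * (noise T Bs * noise T Cs)"
      using thinw_unit[of "expw Cs" T] thinw_unit[of "expw Bs" T] by (subst prodw_mult) auto
    finally show "(\<integral>ww. lap Bs (refresh T e (fst ww)) * lap Cs (refresh T e (snd ww)) \<partial>(W \<Otimes>\<^sub>M W)) = \<dots>" .
  qed
  also have "\<dots> = exp (- (\<integral>x. 1 - thinw T p (expw Bs) x * thinw T p (expw Cs) x \<partial>L)) * (noise T Bs * noise T Cs)"
    by (simp add: R_prodw[OF weight_mult[OF twB twC]])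
  also have "\<dots> = exp (- (\<integral>x. (1 - thinw T p (expw Bs) x * thinw T p (expw Cs) x)
      + (1 - p) * (1 - restrw T (expw Bs) x) + (1 - p) * (1 - restrw T (expw Cs) x) \<partial>L))"
    by (intro exp_weight_combine weight_mult twB twC twR twRB)
  also have "(\<lambda>x. (1 - thinw T p (expw Bs) x * thinw T p (expw Cs) x)
      + (1 - p) * (1 - restrw T (expw Bs) x) + (1 - p) * (1 - restrw T (expw Cs) x))
      = (\<lambda>x. if x \<in> T then pair_rate (p\<^sup>2) (expw Bs x) (expw Cs x) else 1 - expw Bs x * expw Cs x)"
    by (auto simp: fun_eq_iff thinw_def restrw_def pair_rate_def algebra_simps power2_eq_square)
  finally show "(\<integral>z. lap Bs (refresh T (fst z) (fst (snd z))) * lap Cs (refresh T (fst z) (snd (snd z))) \<partial>(R \<Otimes>\<^sub>M (W \<Otimes>\<^sub>M W)))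
      = exp (- (\<integral>x. (if x \<in> T then pair_rate (p\<^sup>2) (expw Bs x) (expw Cs x) else 1 - expw Bs x * expw Cs x) \<partial>L))" .
qed

end

section \<open>Log-convexity of the correlation\<close>

lemma integral_Cauchy_Schwarz:
  fixes u h :: "'b \<Rightarrow> real"
  assumes M: "prob_space M" and [measurable]: "u \<in> borel_measurable M" "h \<in> borel_measurable M"
    and u: "\<And>x. x \<in> space M \<Longrightarrow> 0 \<le> u x \<and> u x \<le> C" and h: "\<And>x. x \<in> space M \<Longrightarrow> 0 \<le> h x \<and> h x \<le> D"
  shows "(\<integral>x. u x * h x \<partial>M)\<^sup>2 \<le> (\<integral>x. (u x)\<^sup>2 \<partial>M) * (\<integral>x. (h x)\<^sup>2 \<partial>M)"
proof -
  interpret M: prob_space M by fact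
  have iuh: "integrable M (\<lambda>x. u x * h x)"
    using u h by (intro M.integrable_bounded[of _ "C * D"]) (auto simp: abs_mult intro!: mult_mono order_trans[OF _ conjunct2[OF u]])
  have iu: "integrable M (\<lambda>x. (u x)\<^sup>2)"
    using u by (intro M.integrable_bounded[of _ "C\<^sup>2"]) (auto intro!: power_mono)
  have ih: "integrable M (\<lambda>x. (h x)\<^sup>2)"
    using h by (intro M.integrable_bounded[of _ "D\<^sup>2"]) (auto intro!: power_mono)
  have e1: "(\<integral>\<^sup>+x. ennreal (u x) * ennreal (h x) \<partial>M) = ennreal (\<integral>x. u x * h x \<partial>M)"
    using u h by (subst nn_integral_eq_integral[OF iuh, symmetric]) (auto intro!: nn_integral_cong simp: ennreal_mult)
  have e2: "(\<integral>\<^sup>+x. (ennreal (u x))\<^sup>2 \<partial>M) = ennreal (\<integral>x. (u x)\<^sup>2 \<partial>M)"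
    using u by (subst nn_integral_eq_integral[OF iu, symmetric]) (auto intro!: nn_integral_cong simp: ennreal_power)
  have e3: "(\<integral>\<^sup>+x. (ennreal (h x))\<^sup>2 \<partial>M) = ennreal (\<integral>x. (h x)\<^sup>2 \<partial>M)"
    using h by (subst nn_integral_eq_integral[OF ih, symmetric]) (auto intro!: nn_integral_cong simp: ennreal_power)
  have nn: "0 \<le> (\<integral>x. u x * h x \<partial>M)" using u h by (intro Bochner_Integration.integral_nonneg_AE AE_I2) auto
  have "(\<integral>\<^sup>+x. ennreal (u x) * ennreal (h x) \<partial>M)\<^sup>2 \<le> (\<integral>\<^sup>+x. (ennreal (u x))\<^sup>2 \<partial>M) * (\<integral>\<^sup>+x. (ennreal (h x))\<^sup>2 \<partial>M)"
    by (rule Cauchy_Schwarz_nn_integral) measurable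
  then show ?thesis
    unfolding e1 e2 e3 using nn by (simp add: ennreal_power flip: ennreal_mult)
qed

context exhaustion
begin

lemma pair_law_integral_eq:
  fixes h :: "_ \<Rightarrow> real"
  assumes "pair_law p T M X Y" "pair_law p T M' X' Y'" and h: "h \<in> borel_measurable (N \<Otimes>\<^sub>M N)"
  shows "(\<integral>\<omega>. h (X \<omega>, Y \<omega>) \<partial>M) = (\<integral>\<omega>. h (X' \<omega>, Y' \<omega>) \<partial>M')"
proof -
  have [measurable]: "X \<in> measurable M N" "Y \<in> measurable M N" "X' \<in> measurable M' N" "Y' \<in> measurable M' N"
    using assms by (auto simp: pair_law_def)
  have "(\<integral>\<omega>. h (X \<omega>, Y \<omega>) \<partial>M) = (\<integral>z. h z \<partial>distr M (N \<Otimes>\<^sub>M N) (\<lambda>\<omega>. (X \<omega>, Y \<omega>)))"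
    using h by (subst integral_distr) auto
  also have "\<dots> = (\<integral>\<omega>. h (X' \<omega>, Y' \<omega>) \<partial>M')"
    using h by (subst pair_law_distr_eq[OF assms(1,2)], subst integral_distr) auto
  finally show ?thesis .
qed

lemma pair_law_nn_integral_eq:
  assumes "pair_law p T M X Y" "pair_law p T M' X' Y'" and h: "h \<in> borel_measurable (N \<Otimes>\<^sub>M N)"
  shows "(\<integral>\<^sup>+\<omega>. h (X \<omega>, Y \<omega>) \<partial>M) = (\<integral>\<^sup>+\<omega>. h (X' \<omega>, Y' \<omega>) \<partial>M')"
proof -
  have [measurable]: "X \<in> measurable M N" "Y \<in> measurable M N" "X' \<in> measurable M' N" "Y' \<in> measurable M' N"
    using assms by (auto simp: pair_law_def)
  have "(\<integral>\<^sup>+\<omega>. h (X \<omega>, Y \<omega>) \<partial>M) = (\<integral>\<^sup>+z. h z \<partial>distr M (N \<Otimes>\<^sub>M N) (\<lambda>\<omega>. (X \<omega>, Y \<omega>)))"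
    using h by (subst nn_integral_distr) auto
  also have "\<dots> = (\<integral>\<^sup>+\<omega>. h (X' \<omega>, Y' \<omega>) \<partial>M')"
    using h by (subst pair_law_distr_eq[OF assms(1,2)], subst nn_integral_distr) auto
  finally show ?thesis .
qed

text \<open>Reversibility, from the symmetry of \<open>pair_rate\<close> in its two factors.
  Compared with a pair whose first coordinate is \<eta>, it shows that the second coordinate has the
  law of \<eta> too.\<close>

lemma pair_law_sym: "pair_law p T M X Y \<Longrightarrow> pair_law p T M Y X"
  unfolding pair_law_def
proof (elim conjE, intro conjI allI impI)
  fix Bs Cs
  assume *: "\<forall>Bs Cs. set Bs \<subseteq> loc \<longrightarrow> set Cs \<subseteq> loc \<longrightarrow> (\<integral>\<omega>. lap Bs (X \<omega>) * lap Cs (Y \<omega>) \<partial>M)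
         = exp (- (\<integral>x. (if x \<in> T then pair_rate p (expw Bs x) (expw Cs x) else 1 - expw Bs x * expw Cs x) \<partial>L))"
    and BC: "set Bs \<subseteq> loc" "set Cs \<subseteq> loc"
  have "pair_rate p a b = pair_rate p b a" for a b by (simp add: pair_rate_def algebra_simps)
  then show "(\<integral>\<omega>. lap Bs (Y \<omega>) * lap Cs (X \<omega>) \<partial>M)
         = exp (- (\<integral>x. (if x \<in> T then pair_rate p (expw Bs x) (expw Cs x) else 1 - expw Bs x * expw Cs x) \<partial>L))"
    using *[rule_format, OF BC(2,1)] by (simp add: mult.commute cong: if_cong)
qed

end

context thinning
begin

abbreviation "xi T \<omega> \<equiv> refresh T (\<kappa> \<omega>, X \<omega>) (U \<omega>, \<zeta> \<omega>)"

lemma xi_meas: "T \<in> sets L \<Longrightarrow> xi T \<in> measurable P N"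
  using pair_law_eta by (simp add: pair_law_def)

text \<open>Given the points of \<open>\<eta>\<close>, two independent refreshments form a pair with retention \<open>p\<^sup>2\<close>,
  so Cauchy--Schwarz in the points of \<open>\<eta>\<close> gives log-convexity.\<close>

lemma correlation_square_le:
  fixes F :: "('a set \<Rightarrow> ennreal) \<Rightarrow> real"
  assumes T: "T \<in> sets L" and F[measurable]: "F \<in> borel_measurable N"
    and Fb: "\<And>\<mu>. \<mu> \<in> Nset L \<Longrightarrow> 0 \<le> F \<mu> \<and> F \<mu> \<le> M"
    and pl: "pair_law (p\<^sup>2) T M' X' Y'"
  shows "(\<integral>\<omega>. F (\<eta> \<omega>) * F (xi T \<omega>) \<partial>P)\<^sup>2 \<le> (\<integral>\<omega>. (F (\<eta> \<omega>))\<^sup>2 \<partial>P) * (\<integral>\<omega>. F (X' \<omega>) * F (Y' \<omega>) \<partial>M')"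
proof -
  note [measurable] = refresh_meas[OF T]
  \<comment> \<open>The empty configuration witnesses that \<open>Nset L\<close> is
    inhabited.\<close>
  have M0: "0 \<le> M" using Fb[of "pts L (\<lambda>_. False) (\<lambda>_. undefined)"] by force
  have rN: "refresh T e w \<in> Nset L" if "e \<in> space ES" "w \<in> space WS" for e w
    using measurable_space[OF refresh_meas[OF T], of "(e, w)"] that by (simp add: space_pair_measure)
  have fN: "full e \<in> Nset L" for e by (simp add: full_def)
  \<comment> \<open>The conditional expectation of \<open>F\<close> after refreshing, given the
    enumerated points.\<close>
  define h where "h e = (\<integral>w. F (refresh T e w) \<partial>W)" for e
  interpret R: prob_space R by (rule prob_R)
  interpret W: prob_space W by (rule prob_W)
  have pWW: "prob_space (W \<Otimes>\<^sub>M W)" by (intro prob_space_pair prob_W)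
  have Fr: "(\<lambda>w. F (refresh T e w)) \<in> borel_measurable W" if e: "e \<in> space ES" for e
  proof -
    have "(\<lambda>w. (e, w)) \<in> measurable WS RS" using e by measurable
    from measurable_compose[OF measurable_compose[OF this refresh_meas[OF T]] F] show ?thesis by simp
  qed
  have hb: "0 \<le> h e \<and> h e \<le> M" if e: "e \<in> space R" for e
  proof -
    have i: "integrable W (\<lambda>w. F (refresh T e w))"
      using e Fb rN M0 by (intro W.integrable_bounded[OF Fr, of _ M]) (auto simp: abs_le_iff intro: order_trans[of _ 0])
    have "0 \<le> h e" unfolding h_def using e Fb rN by (intro Bochner_Integration.integral_nonneg_AE AE_I2) auto
    moreover have "h e \<le> (\<integral>w. M \<partial>W)" unfolding h_def using e Fb rN by (intro integral_mono i) auto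
    ultimately show ?thesis using W.prob_space by simp
  qed
  have hm[measurable]: "h \<in> borel_measurable R"
    unfolding h_def by (rule W.borel_measurable_lebesgue_integral) (simp add: split_beta')
  have mF: "(\<lambda>z. F (full (fst z)) * F (refresh T (fst z) (snd z))) \<in> borel_measurable RS"
    by measurable
  have bound2: "\<bar>F \<mu> * F \<nu>\<bar> \<le> M * M" if "\<mu> \<in> Nset L" "\<nu> \<in> Nset L" for \<mu> \<nu>
    using Fb[OF that(1)] Fb[OF that(2)] M0 by (auto simp: abs_mult intro!: mult_mono)
  have "(\<integral>\<omega>. F (\<eta> \<omega>) * F (xi T \<omega>) \<partial>P)
      = (\<integral>\<omega>. (\<lambda>z. F (full (fst z)) * F (refresh T (fst z) (snd z))) ((\<kappa> \<omega>, X \<omega>), (U \<omega>, \<zeta> \<omega>)) \<partial>P)"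
    by (intro Bochner_Integration.integral_cong refl) (simp add: full_def eta_pts)
  also have "\<dots> = (\<integral>e. (\<integral>w. F (full e) * F (refresh T e w) \<partial>W) \<partial>R)"
    by (subst integral_marks[where C="M * M"]) (use mF bound2 fN rN in \<open>auto simp: space_pair_measure\<close>)
  also have "\<dots> = (\<integral>e. F (full e) * h e \<partial>R)" by (simp add: h_def)
  finally have eq1: "(\<integral>\<omega>. F (\<eta> \<omega>) * F (xi T \<omega>) \<partial>P) = (\<integral>e. F (full e) * h e \<partial>R)" .
  have eq2: "(\<integral>e. (F (full e))\<^sup>2 \<partial>R) = (\<integral>\<omega>. (F (\<eta> \<omega>))\<^sup>2 \<partial>P)"
    unfolding R_def
  proof (subst integral_distr)
    show "(\<lambda>e. (F (full e))\<^sup>2) \<in> borel_measurable ES" by measurable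
  qed (auto simp: full_def eta_pts intro!: Bochner_Integration.integral_cong)
  have m3: "(\<lambda>z. (fst z, fst (snd z))) \<in> measurable (R \<Otimes>\<^sub>M (W \<Otimes>\<^sub>M W)) RS"
    "(\<lambda>z. (fst z, snd (snd z))) \<in> measurable (R \<Otimes>\<^sub>M (W \<Otimes>\<^sub>M W)) RS"
    by measurable
  note m4 = m3[THEN measurable_compose[OF _ measurable_compose[OF refresh_meas[OF T] F]]]
  \<comment> \<open>Only the law of the given pair matters, so it may be replaced by two
    refreshments of the same points. Given the points these are independent, and the correlation
    becomes the mean of the square of \<open>h\<close>.\<close>
  have "(\<integral>\<omega>. F (X' \<omega>) * F (Y' \<omega>) \<partial>M')
      = (\<integral>z. F (refresh T (fst z) (fst (snd z))) * F (refresh T (fst z) (snd (snd z))) \<partial>(R \<Otimes>\<^sub>M (W \<Otimes>\<^sub>M W)))"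
    using pair_law_integral_eq[OF pl pair_law_two[OF T], of "\<lambda>z. F (fst z) * F (snd z)"] by simp
  also have "\<dots> = (\<integral>e. (\<integral>ww. F (refresh T e (fst ww)) * F (refresh T e (snd ww)) \<partial>(W \<Otimes>\<^sub>M W)) \<partial>R)"
    by (subst integral_pair_bounded[OF prob_R pWW, of _ "M * M"])
      (use m4 bound2 rN in \<open>auto simp: space_pair_measure\<close>)
  also have "\<dots> = (\<integral>e. (h e)\<^sup>2 \<partial>R)"
  proof (rule Bochner_Integration.integral_cong[OF refl])
    fix e assume "e \<in> space R"
    then have e: "e \<in> space ES" by simp
    note [measurable] = Fr[OF e]
    have "(\<integral>ww. F (refresh T e (fst ww)) * F (refresh T e (snd ww)) \<partial>(W \<Otimes>\<^sub>M W))
        = (\<integral>w. (\<integral>w'. F (refresh T e w) * F (refresh T e w') \<partial>W) \<partial>W)"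
      by (subst integral_pair_bounded[OF prob_W prob_W, of _ "M * M"])
        (use bound2 rN e in \<open>auto simp: space_pair_measure\<close>)
    then show "(\<integral>ww. F (refresh T e (fst ww)) * F (refresh T e (snd ww)) \<partial>(W \<Otimes>\<^sub>M W)) = (h e)\<^sup>2"
      by (simp add: h_def power2_eq_square)
  qed
  finally have eq3: "(\<integral>\<omega>. F (X' \<omega>) * F (Y' \<omega>) \<partial>M') = (\<integral>e. (h e)\<^sup>2 \<partial>R)" .
  show ?thesis
    unfolding eq1 eq2[symmetric] eq3
    using Fb fN hb by (intro integral_Cauchy_Schwarz[OF prob_R, where C=M and D=M]) auto
qed

end

section \<open>The infinitesimal bound\<close>

text \<open>Models a Poisson process of finite mass as a Poisson number of independent uniform
  points, so that an event such as "exactly one point" can be integrated explicitly.\<close>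

definition cluster_measure :: "'a measure \<Rightarrow> 'a set \<Rightarrow> real \<Rightarrow> (nat \<times> (nat \<Rightarrow> 'a)) measure" where
  "cluster_measure L T r = measure_pmf (poisson_pmf r) \<Otimes>\<^sub>M (\<Pi>\<^sub>M i\<in>UNIV. uniform_measure L T)"

definition cluster :: "'a measure \<Rightarrow> nat \<times> (nat \<Rightarrow> 'a) \<Rightarrow> 'a set \<Rightarrow> ennreal" where
  "cluster L b = pts L (\<lambda>i. i < fst b) (snd b)"

lemma poisson_pmf_power:
  assumes r: "0 < r" and \<beta>: "0 \<le> \<beta>" "\<beta> \<le> 1"
  shows "(\<integral>k. \<beta> ^ k \<partial>measure_pmf (poisson_pmf r)) = exp (- r * (1 - \<beta>))"
proof -
  have "(\<lambda>k. (r * \<beta>) ^ k /\<^sub>R fact k) sums exp (r * \<beta>)" by (rule exp_converges)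
  then have "(\<lambda>k. exp (- r) * ((r * \<beta>) ^ k /\<^sub>R fact k)) sums (exp (- r) * exp (r * \<beta>))" by (rule sums_mult)
  moreover have "exp (- r) * exp (r * \<beta>) = exp (- r * (1 - \<beta>))"
    by (simp add: exp_add[symmetric] algebra_simps)
  moreover have "exp (- r) * ((r * \<beta>) ^ k /\<^sub>R fact k) = pmf (poisson_pmf r) k * \<beta> ^ k" for k
    using r by (simp add: power_mult_distrib field_simps)
  ultimately have s: "(\<lambda>k. pmf (poisson_pmf r) k * \<beta> ^ k) sums exp (- r * (1 - \<beta>))" by simp
  have "(\<integral>k. \<beta> ^ k \<partial>measure_pmf (poisson_pmf r)) = (\<integral>k. pmf (poisson_pmf r) k * \<beta> ^ k \<partial>count_space UNIV)"
    unfolding measure_pmf_eq_density by (subst integral_density) (auto simp: )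
  also have "\<dots> = (\<Sum>k. pmf (poisson_pmf r) k * \<beta> ^ k)"
    using s \<beta> by (intro integral_count_space_nat) (simp add: integrable_count_space_nat_iff sums_iff)
  finally show ?thesis using s by (simp add: sums_iff)
qed

locale finite_cluster = exhaustion L S for L :: "'a measure" and S +
  fixes T :: "'a set" and q :: real
  assumes T_sets [measurable, simp]: "T \<in> sets L" and T_pos: "0 < emeasure L T" and T_fin: "emeasure L T < \<infinity>"
    and q_pos: "0 < q" and q_le: "q \<le> 1"
begin

abbreviation "\<Lambda> \<equiv> measure L T"
abbreviation "r \<equiv> q * \<Lambda>"
abbreviation "\<nu> \<equiv> uniform_measure L T"
abbreviation "MB \<equiv> cluster_measure L T r"
abbreviation "pois \<equiv> measure_pmf (poisson_pmf r)"

lemma Lam_pos: "0 < \<Lambda>"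
  using T_pos T_fin by (simp add: measure_def enn2real_positive_iff)

lemma r_pos: "0 < r"
  using Lam_pos q_pos by simp

lemma prob_nu: "prob_space \<nu>"
  using T_pos T_fin by (intro prob_space_uniform_measure) auto

lemma prob_PiM_nu: "prob_space (\<Pi>\<^sub>M i\<in>(UNIV::nat set). \<nu>)"
  by (intro prob_space_PiM prob_nu)

lemma prob_MB: "prob_space MB"
  unfolding cluster_measure_def by (intro prob_space_pair prob_space_measure_pmf prob_PiM_nu)

lemma sets_MB [measurable_cong]: "sets MB = sets ((count_space UNIV :: nat measure) \<Otimes>\<^sub>M (\<Pi>\<^sub>M i\<in>(UNIV::nat set). L))"
  unfolding cluster_measure_def by (intro sets_pair_measure_cong sets_PiM_cong) auto

lemma cluster_meas [measurable]: "cluster L \<in> measurable MB N"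
proof -
  have "cluster L \<in> measurable ((count_space UNIV :: nat measure) \<Otimes>\<^sub>M (\<Pi>\<^sub>M i\<in>(UNIV::nat set). L)) N"
    unfolding cluster_def by (rule measurable_pts) measurable
  then show ?thesis unfolding measurable_cong_sets[OF sets_MB refl] .
qed

lemma fst_MB: "fst \<in> measurable MB (count_space UNIV)"
  by measurable

lemma snd_MB: "(\<lambda>b. snd b i) \<in> measurable MB L"
  by measurable

lemma indicator_fst_MB [measurable]: "(\<lambda>b. indicator A (fst b) :: ennreal) \<in> borel_measurable MB"
  by (rule measurable_compose[OF fst_MB]) simp

lemma integral_nu:
  fixes f :: "'a \<Rightarrow> real"
  assumes [measurable]: "f \<in> borel_measurable L"
  shows "(\<integral>x. f x \<partial>\<nu>) = (\<integral>x. indicator T x * f x \<partial>L) / \<Lambda>"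
proof -
  have e: "emeasure L T = ennreal \<Lambda>" using T_fin by (simp add: emeasure_eq_ennreal_measure top.not_eq_extremum)
  have "\<nu> = density L (\<lambda>x. ennreal (indicator T x / \<Lambda>))"
    unfolding uniform_measure_def e using Lam_pos divide_ennreal[of 1 \<Lambda>]
    by (intro density_cong) (auto simp: indicator_def)
  then have "(\<integral>x. f x \<partial>\<nu>) = (\<integral>x. (indicator T x / \<Lambda>) * f x \<partial>L)"
    by (simp add: integral_density)
  then show ?thesis by simp
qed

text \<open>Given k points the functional is the k-th power of the mean \<beta> of one factor, and
  the Poisson mixture of these powers is exp(- r (1 - \<beta>)). The factor \<Lambda> in r = q
  \<Lambda> undoes the normalisation of the uniform law.\<close>

lemma MB_lap:
  assumes Bs: "set Bs \<subseteq> loc"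
  shows "(\<integral>b. lap Bs (cluster L b) \<partial>MB) = exp (- q * (\<integral>x. 1 - restrw T (expw Bs) x \<partial>L))"
proof -
  interpret nu: prob_space \<nu> by (rule prob_nu)
  interpret PN: prob_space "\<Pi>\<^sub>M i\<in>(UNIV::nat set). \<nu>" by (rule prob_PiM_nu)
  have BsL: "set Bs \<subseteq> sets L" by (rule loc_list_sets[OF Bs])
  have lm[measurable]: "lap Bs \<in> borel_measurable N" by (rule lap_measurable[OF BsL])
  have bm[measurable]: "expw Bs \<in> borel_measurable L" by (rule expw_measurable[OF BsL])
  define \<beta> where "\<beta> = (\<integral>x. expw Bs x \<partial>\<nu>)"
  have bi: "integrable \<nu> (expw Bs)" by (rule nu.integrable_bounded[of _ 1]) (auto simp: less_imp_le)
  have "\<beta> \<le> (\<integral>x. 1 \<partial>\<nu>)" unfolding \<beta>_def by (intro integral_mono bi) auto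
  then have \<beta>: "0 \<le> \<beta>" "\<beta> \<le> 1"
    using nu.prob_space by (auto simp: \<beta>_def less_imp_le)
  have "(\<integral>b. lap Bs (cluster L b) \<partial>MB) = (\<integral>k. (\<integral>x. lap Bs (cluster L (k, x)) \<partial>(\<Pi>\<^sub>M i\<in>UNIV. \<nu>)) \<partial>pois)"
    unfolding cluster_measure_def
  proof (rule integral_pair_bounded[OF prob_space_measure_pmf prob_PiM_nu, where C=1])
    show "(\<lambda>b. lap Bs (cluster L b)) \<in> borel_measurable (pois \<Otimes>\<^sub>M (\<Pi>\<^sub>M i\<in>UNIV. \<nu>))"
      using measurable_compose[OF cluster_meas lm] by (simp add: cluster_measure_def)
  qed simp
  also have "\<dots> = (\<integral>k. \<beta> ^ k \<partial>pois)"
  proof (rule Bochner_Integration.integral_cong[OF refl])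
    fix k
    have "lap Bs (cluster L (k, x)) = (\<Prod>i<k. expw Bs (x i))" for x
    proof -
      have "(\<lambda>n. \<Prod>i<n. if i < k then expw Bs (x i) else 1) \<longlonglongrightarrow> lap Bs (cluster L (k, x))"
        unfolding cluster_def lap_pts[OF BsL] fst_conv snd_conv
        by (rule prodw_tendsto) (auto simp: less_imp_le)
      moreover have "(\<Prod>i<n. if i < k then expw Bs (x i) else 1) = (\<Prod>i<k. expw Bs (x i))" if "n \<ge> k" for n
        using that by (intro prod.mono_neutral_cong_right) auto
      then have "(\<lambda>n. \<Prod>i<n. if i < k then expw Bs (x i) else 1) \<longlonglongrightarrow> (\<Prod>i<k. expw Bs (x i))"
        by (intro tendsto_eventually) (auto simp: eventually_sequentially)
      ultimately show ?thesis by (rule LIMSEQ_unique)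
    qed
    then have "(\<integral>x. lap Bs (cluster L (k, x)) \<partial>(\<Pi>\<^sub>M i\<in>UNIV. \<nu>)) = (\<integral>x. (\<Prod>i<k. expw Bs (x i)) \<partial>(\<Pi>\<^sub>M i\<in>UNIV. \<nu>))"
      by simp
    also have "\<dots> = (\<Prod>i<k. \<beta>)"
      unfolding \<beta>_def by (rule PiM_prod_expectation[OF prob_nu, of _ 1]) (auto simp: less_imp_le)
    finally show "(\<integral>x. lap Bs (cluster L (k, x)) \<partial>(\<Pi>\<^sub>M i\<in>UNIV. \<nu>)) = \<beta> ^ k" by simp
  qed
  also have "\<dots> = exp (- r * (1 - \<beta>))" by (rule poisson_pmf_power[OF r_pos \<beta>])
  also have "1 - \<beta> = (\<integral>x. 1 - expw Bs x \<partial>\<nu>)"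
    unfolding \<beta>_def using bi nu.prob_space by simp
  also have "\<dots> = (\<integral>x. indicator T x * (1 - expw Bs x) \<partial>L) / \<Lambda>"
    by (rule integral_nu) measurable
  also have "(\<lambda>x. indicator T x * (1 - expw Bs x)) = (\<lambda>x. 1 - restrw T (expw Bs) x)"
    by (auto simp: restrw_def fun_eq_iff)
  finally show ?thesis using Lam_pos by simp
qed

lemma MB_nn_fubini:
  assumes "f \<in> borel_measurable MB"
  shows "(\<integral>\<^sup>+b. f b \<partial>MB) = (\<integral>\<^sup>+k. (\<integral>\<^sup>+x. f (k, x) \<partial>(\<Pi>\<^sub>M i\<in>UNIV. \<nu>)) \<partial>pois)"
proof -
  interpret PN: prob_space "\<Pi>\<^sub>M i\<in>(UNIV::nat set). \<nu>" by (rule prob_PiM_nu)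
  show ?thesis using assms unfolding cluster_measure_def by (rule PN.nn_integral_fst[symmetric])
qed

lemma pmf_pois: "pmf (poisson_pmf r) k = r ^ k / fact k * exp (- r)"
  using r_pos by (rule pmf_poisson)

lemma MB_fst_emeasure: "emeasure MB {b \<in> space MB. fst b \<in> A} = ennreal (measure pois A)"
proof -
  interpret PN: prob_space "\<Pi>\<^sub>M i\<in>(UNIV::nat set). \<nu>" by (rule prob_PiM_nu)
  have "emeasure MB {b \<in> space MB. fst b \<in> A} = (\<integral>\<^sup>+b. indicator {b \<in> space MB. fst b \<in> A} b \<partial>MB)"
    by simp
  also have "\<dots> = (\<integral>\<^sup>+b. indicator A (fst b) \<partial>MB)"
    by (intro nn_integral_cong) (auto split: split_indicator)
  also have "\<dots> = (\<integral>\<^sup>+k. indicator A k \<partial>pois)"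
    by (subst MB_nn_fubini) (auto simp: PN.emeasure_space_1)
  also have "\<dots> = ennreal (measure pois A)"
    by (simp add: measure_pmf.emeasure_eq_measure)
  finally show ?thesis .
qed

lemma pois_ge_1: "measure pois {1..} \<le> r"
proof -
  have "{1..} = UNIV - {0::nat}" by auto
  then have "measure pois {1..} = 1 - measure pois {0}"
    using measure_pmf.prob_compl[of "{0}" "poisson_pmf r"] by simp
  also have "\<dots> = 1 - exp (- r)" by (simp add: measure_pmf_single pmf_pois)
  also have "\<dots> \<le> r" using exp_ge_add_one_self[of "- r"] by simp
  finally show ?thesis .
qed

text \<open>From e^(-r) \<ge> 1 - r, since 1 - (1 + r)(1 - r) = r^2.\<close>

lemma pois_ge_2: "measure pois {2..} \<le> r\<^sup>2"
proof -
  have "{2..} = UNIV - {0, 1::nat}" by auto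
  then have "measure pois {2..} = 1 - measure pois {0, 1}"
    using measure_pmf.prob_compl[of "{0, 1}" "poisson_pmf r"] by simp
  also have "measure pois {0, 1} = (1 + r) * exp (- r)"
    by (subst measure_measure_pmf_finite) (simp_all add: pmf_pois algebra_simps)
  also have "1 - (1 + r) * exp (- r) \<le> 1 - (1 + r) * (1 - r)"
    using exp_ge_add_one_self[of "- r"] r_pos by (intro diff_left_mono mult_left_mono) auto
  also have "\<dots> = r\<^sup>2" by (simp add: power2_eq_square algebra_simps)
  finally show ?thesis .
qed

text \<open>The Poisson weight r e^(-r) of one point times the uniform mean over \<open>T\<close>.
  With r = q \<Lambda> the mass of \<open>T\<close> cancels outside the exponential, so the main
  term of the increment is bounded by an energy integral without a factor growing with
  \<open>T\<close>.\<close>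

lemma MB_one:
  assumes f[measurable]: "f \<in> borel_measurable L"
  shows "(\<integral>\<^sup>+b. indicator {1} (fst b) * f (snd b 0) \<partial>MB) = ennreal (q * exp (- r)) * (\<integral>\<^sup>+x\<in>T. f x \<partial>L)"
proof -
  interpret nu: prob_space \<nu> by (rule prob_nu)
  interpret PN: prob_space "\<Pi>\<^sub>M i\<in>(UNIV::nat set). \<nu>" by (rule prob_PiM_nu)
  have "(\<integral>\<^sup>+x. f (x 0) \<partial>(\<Pi>\<^sub>M i\<in>(UNIV::nat set). \<nu>)) = (\<integral>\<^sup>+y. f y \<partial>distr (\<Pi>\<^sub>M i\<in>(UNIV::nat set). \<nu>) \<nu> (\<lambda>x. x 0))"
    by (subst nn_integral_distr) auto
  also have "distr (\<Pi>\<^sub>M i\<in>(UNIV::nat set). \<nu>) \<nu> (\<lambda>x. x 0) = \<nu>"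
    using prob_nu by (intro distr_PiM_component) auto
  also have "(\<integral>\<^sup>+y. f y \<partial>\<nu>) = (\<integral>\<^sup>+x\<in>T. f x \<partial>L) / emeasure L T"
    using T_pos T_fin by (subst nn_integral_uniform_measure) auto
  finally have *: "(\<integral>\<^sup>+x. f (x 0) \<partial>(\<Pi>\<^sub>M i\<in>(UNIV::nat set). \<nu>)) = (\<integral>\<^sup>+x\<in>T. f x \<partial>L) / emeasure L T" .
  have e: "emeasure L T = ennreal \<Lambda>" using T_fin by (simp add: emeasure_eq_ennreal_measure top.not_eq_extremum)
  have m: "(\<lambda>b. indicator {1} (fst b) * f (snd b 0)) \<in> borel_measurable MB"
    by (intro borel_measurable_times_ennreal indicator_fst_MB measurable_compose[OF snd_MB f])
  have "(\<integral>\<^sup>+b. indicator {1} (fst b) * f (snd b 0) \<partial>MB)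
      = (\<integral>\<^sup>+k. indicator {1} k * ((\<integral>\<^sup>+x\<in>T. f x \<partial>L) / emeasure L T) \<partial>pois)"
    unfolding MB_nn_fubini[OF m] by (simp add: nn_integral_cmult *)
  also have "\<dots> = ennreal (r * exp (- r)) * ((\<integral>\<^sup>+x\<in>T. f x \<partial>L) / emeasure L T)"
    by (subst nn_integral_multc) (simp_all add: emeasure_pmf_single pmf_pois)
  also have "\<dots> = ennreal (q * exp (- r)) * (\<integral>\<^sup>+x\<in>T. f x \<partial>L)"
  proof -
    have "ennreal (r * exp (- r)) = ennreal (q * exp (- r)) * ennreal \<Lambda>"
      using q_pos Lam_pos by (simp add: ennreal_mult[symmetric] mult_ac)
    moreover have "ennreal \<Lambda> * ((\<integral>\<^sup>+x\<in>T. f x \<partial>L) / ennreal \<Lambda>) = (\<integral>\<^sup>+x\<in>T. f x \<partial>L)"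
      using Lam_pos by (simp add: ennreal_times_divide mult.commute[of "ennreal \<Lambda>"] mult_divide_eq_ennreal)
    ultimately show ?thesis
      unfolding e by (simp only: mult.assoc)
  qed
  finally show ?thesis .
qed

end

lemma half_le: "2 * a \<le> 2 * u + 3 * v \<Longrightarrow> 0 \<le> v \<Longrightarrow> a \<le> u + 2 * (v::real)"
  by linarith

text \<open>Kept in \<open>ennreal\<close> because it may be infinite for a single first argument of
  \<open>g\<close>; the decay bound is trivial there.\<close>

definition energy :: "'w measure \<Rightarrow> 'a measure \<Rightarrow> ('w \<Rightarrow> 'a set \<Rightarrow> ennreal) \<Rightarrow> (('a set \<Rightarrow> ennreal) \<Rightarrow> real) \<Rightarrow> ennreal" where
  "energy P L \<eta> F = (\<integral>\<^sup>+\<omega>. (\<integral>\<^sup>+y. ennreal ((F (cm_add (\<eta> \<omega>) (cm_dirac L y)) - F (\<eta> \<omega>))\<^sup>2) \<partial>L) \<partial>P)"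

context thinning
begin

text \<open>The common part of \<eta> and its refreshment: the points outside \<open>T\<close> and
  the surviving points in \<open>T\<close>, without noise.\<close>

definition retained :: "'a set \<Rightarrow> 'w \<Rightarrow> 'a set \<Rightarrow> ennreal" where
  "retained T \<omega> = thin L T (\<kappa> \<omega>) (X \<omega>) (U \<omega>)"

lemma retained_meas:
  assumes T: "T \<in> sets L" shows "retained T \<in> measurable P N"
proof -
  have "(\<lambda>\<omega>. ((\<kappa> \<omega>, X \<omega>), U \<omega>)) \<in> measurable P (ES \<Otimes>\<^sub>M CS)" by measurable
  from measurable_compose[OF this thin_meas[OF T]] show ?thesis
    by (simp add: retained_def[abs_def])
qed

lemma retained_lap:
  assumes T: "T \<in> sets L" and Bs: "set Bs \<subseteq> loc"
  shows "(\<integral>\<omega>. lap Bs (retained T \<omega>) \<partial>P) = exp (- (\<integral>x. 1 - thinw T p (expw Bs) x \<partial>L))"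
proof -
  have lm: "lap Bs \<in> borel_measurable N" using loc_list_sets[OF Bs] by (rule lap_measurable)
  have "(\<lambda>z. (fst z, fst (snd z))) \<in> measurable RS (ES \<Otimes>\<^sub>M CS)" by measurable
  from measurable_compose[OF measurable_compose[OF this thin_meas[OF T]] lm]
  have m: "(\<lambda>z. lap Bs (thin L T (fst (fst z)) (snd (fst z)) (fst (snd z)))) \<in> borel_measurable RS"
    by simp
  have "(\<integral>\<omega>. lap Bs (retained T \<omega>) \<partial>P) = (\<integral>e. (\<integral>w. lap Bs (thin L T (fst e) (snd e) (fst w)) \<partial>W) \<partial>R)"
    using integral_marks[OF m, of 1] by (simp add: retained_def)
  also have "\<dots> = (\<integral>e. prod_full (thinw T p (expw Bs)) e \<partial>R)"
    using W_lap[OF Bs _ T, where Ds="[]"] by (intro Bochner_Integration.integral_cong refl) simp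
  also have "\<dots> = exp (- (\<integral>x. 1 - thinw T p (expw Bs) x \<partial>L))"
    using Bs T p_pos p_le by (intro R_prodw weight_thinw weight_expw)
  finally show ?thesis .
qed

end

section \<open>The pair as a common part with two independent clusters\<close>

locale thinning_cluster = thinning L S P \<eta> p \<kappa> X U \<zeta> + finite_cluster L S T "1 - p"
  for L :: "'a measure" and S and P :: "'w measure" and \<eta> p \<kappa> X U \<zeta> T
begin

abbreviation "M3 \<equiv> P \<Otimes>\<^sub>M (MB \<Otimes>\<^sub>M MB)"

text \<open>Removed points and added noise become two independent clusters on the same common part,
  so \<open>X3\<close> and \<open>Y3\<close> can differ only if a cluster is nonempty.\<close>

definition X3 :: "'w \<times> (nat \<times> (nat \<Rightarrow> 'a)) \<times> (nat \<times> (nat \<Rightarrow> 'a)) \<Rightarrow> 'a set \<Rightarrow> ennreal" where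
  "X3 z = cm_add (retained T (fst z)) (cluster L (fst (snd z)))"
definition Y3 :: "'w \<times> (nat \<times> (nat \<Rightarrow> 'a)) \<times> (nat \<times> (nat \<Rightarrow> 'a)) \<Rightarrow> 'a set \<Rightarrow> ennreal" where
  "Y3 z = cm_add (retained T (fst z)) (cluster L (snd (snd z)))"

lemma ret_meas [measurable]: "retained T \<in> measurable P N"
  by (rule retained_meas) simp

lemma X3_meas [measurable]: "X3 \<in> measurable M3 N" and Y3_meas [measurable]: "Y3 \<in> measurable M3 N"
  unfolding X3_def[abs_def] Y3_def[abs_def] by measurable

text \<open>The common part occurs in both coordinates and is therefore tested with
  \<open>Bs @ Cs\<close>. Its thinned weight gives 1 - (p b c + 1 - p) = p (1 - b c) on
  \<open>T\<close>, and each cluster adds one noise term.\<close>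

lemma pair_law_cluster: "pair_law p T M3 X3 Y3"
  unfolding pair_law_def
proof (intro conjI allI impI)
  have pBB: "prob_space (MB \<Otimes>\<^sub>M MB)" by (intro prob_space_pair prob_MB)
  show "prob_space M3" by (intro prob_space_pair P.prob_space_axioms pBB)
  show "X3 \<in> measurable M3 N" "Y3 \<in> measurable M3 N" by measurable
  fix Bs Cs assume Bs: "set Bs \<subseteq> loc" and Cs: "set Cs \<subseteq> loc"
  have BC: "set (Bs @ Cs) \<subseteq> loc" using Bs Cs by simp
  have lm[measurable]: "lap Bs \<in> borel_measurable N" "lap Cs \<in> borel_measurable N"
    using Bs Cs by (auto intro!: lap_measurable loc_sets)
  have twBC: "weight L (thinw T p (expw (Bs @ Cs)))"
    and twRB: "weight L (restrw T (expw Bs))" and twR: "weight L (restrw T (expw Cs))"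
    using Bs Cs p_pos p_le by (auto intro!: weight_expw weight_thinw weight_restrw)
  have kB: "(\<integral>b. lap Bs (cluster L b) \<partial>MB) = noise T Bs" "(\<integral>b. lap Cs (cluster L b) \<partial>MB) = noise T Cs"
    by (rule MB_lap[OF Bs], rule MB_lap[OF Cs])
  have "(\<integral>z. lap Bs (X3 z) * lap Cs (Y3 z) \<partial>M3)
      = (\<integral>\<omega>. (\<integral>bc. lap Bs (X3 (\<omega>, bc)) * lap Cs (Y3 (\<omega>, bc)) \<partial>(MB \<Otimes>\<^sub>M MB)) \<partial>P)"
    by (subst integral_pair_bounded[OF P.prob_space_axioms pBB, where C=1]) (auto simp: mult_le_one)
  also have "\<dots> = (\<integral>\<omega>. lap (Bs @ Cs) (retained T \<omega>) * (noise T Bs * noise T Cs) \<partial>P)"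
  proof (rule Bochner_Integration.integral_cong[OF refl])
    fix \<omega> assume "\<omega> \<in> space P"
    have "(\<integral>bc. lap Bs (X3 (\<omega>, bc)) * lap Cs (Y3 (\<omega>, bc)) \<partial>(MB \<Otimes>\<^sub>M MB))
        = (\<integral>bc. lap (Bs @ Cs) (retained T \<omega>) * (lap Bs (cluster L (fst bc)) * lap Cs (cluster L (snd bc))) \<partial>(MB \<Otimes>\<^sub>M MB))"
      by (intro Bochner_Integration.integral_cong) (auto simp: X3_def Y3_def lap_cm_add lap_append)
    also have "\<dots> = lap (Bs @ Cs) (retained T \<omega>) * (\<integral>bc. lap Bs (cluster L (fst bc)) * lap Cs (cluster L (snd bc)) \<partial>(MB \<Otimes>\<^sub>M MB))"
      by (rule integral_mult_right_zero)
    also have "(\<integral>bc. lap Bs (cluster L (fst bc)) * lap Cs (cluster L (snd bc)) \<partial>(MB \<Otimes>\<^sub>M MB))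
        = (\<integral>b. (\<integral>c. lap Bs (cluster L b) * lap Cs (cluster L c) \<partial>MB) \<partial>MB)"
      by (subst integral_pair_bounded[OF prob_MB prob_MB, where C=1]) (auto simp: mult_le_one)
    also have "\<dots> = noise T Bs * noise T Cs" by (simp add: kB)
    finally show "(\<integral>bc. lap Bs (X3 (\<omega>, bc)) * lap Cs (Y3 (\<omega>, bc)) \<partial>(MB \<Otimes>\<^sub>M MB))
        = lap (Bs @ Cs) (retained T \<omega>) * (noise T Bs * noise T Cs)" .
  qed
  also have "\<dots> = exp (- (\<integral>x. 1 - thinw T p (expw (Bs @ Cs)) x \<partial>L)) * (noise T Bs * noise T Cs)"
    by (simp add: retained_lap[OF T_sets BC])
  also have "\<dots> = exp (- (\<integral>x. (1 - thinw T p (expw (Bs @ Cs)) x)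
      + (1 - p) * (1 - restrw T (expw Bs) x) + (1 - p) * (1 - restrw T (expw Cs) x) \<partial>L))"
    by (intro exp_weight_combine twBC twR twRB)
  also have "(\<lambda>x. (1 - thinw T p (expw (Bs @ Cs)) x)
      + (1 - p) * (1 - restrw T (expw Bs) x) + (1 - p) * (1 - restrw T (expw Cs) x))
      = (\<lambda>x. if x \<in> T then pair_rate p (expw Bs x) (expw Cs x) else 1 - expw Bs x * expw Cs x)"
    by (auto simp: fun_eq_iff thinw_def restrw_def pair_rate_def expw_append algebra_simps)
  finally show "(\<integral>z. lap Bs (X3 z) * lap Cs (Y3 z) \<partial>M3)
      = exp (- (\<integral>x. (if x \<in> T then pair_rate p (expw Bs x) (expw Cs x) else 1 - expw Bs x * expw Cs x) \<partial>L))" .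
qed

lemma cluster_zero: "fst b = 0 \<Longrightarrow> cm_add \<mu> (cluster L b) = \<mu>"
  by (simp add: cluster_def pts_def cm_add_def fun_eq_iff)

lemma cluster_one: "fst b = 1 \<Longrightarrow> cluster L b = cm_dirac L (snd b 0)"
proof -
  assume "fst b = 1"
  have "(\<Sum>i::nat. if i = 0 then indicator B (snd b i) else 0) = (indicator B (snd b 0) :: ennreal)" for B
    using suminf_finite[of "{0}" "\<lambda>i::nat. if i = 0 then indicator B (snd b i) else 0 :: ennreal"] by simp
  with \<open>fst b = 1\<close> show ?thesis by (simp add: cm_dirac_def pts_def cluster_def fun_eq_iff)
qed

lemma M3_fubini:
  assumes "f \<in> borel_measurable M3"
  shows "(\<integral>\<^sup>+z. f z \<partial>M3) = (\<integral>\<^sup>+\<omega>. (\<integral>\<^sup>+b. (\<integral>\<^sup>+c. f (\<omega>, b, c) \<partial>MB) \<partial>MB) \<partial>P)"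
proof -
  interpret MB: prob_space MB by (rule prob_MB)
  interpret BB: pair_prob_space MB MB ..
  have "(\<integral>\<^sup>+z. f z \<partial>M3) = (\<integral>\<^sup>+\<omega>. (\<integral>\<^sup>+bc. f (\<omega>, bc) \<partial>(MB \<Otimes>\<^sub>M MB)) \<partial>P)"
    using assms by (rule BB.P.nn_integral_fst[symmetric])
  also have "\<dots> = (\<integral>\<^sup>+\<omega>. (\<integral>\<^sup>+b. (\<integral>\<^sup>+c. f (\<omega>, b, c) \<partial>MB) \<partial>MB) \<partial>P)"
  proof (rule nn_integral_cong)
    fix \<omega> assume "\<omega> \<in> space P"
    then have "(\<lambda>bc. f (\<omega>, bc)) \<in> borel_measurable (MB \<Otimes>\<^sub>M MB)"
      using assms by measurable
    then show "(\<integral>\<^sup>+bc. f (\<omega>, bc) \<partial>(MB \<Otimes>\<^sub>M MB)) = (\<integral>\<^sup>+b. (\<integral>\<^sup>+c. f (\<omega>, b, c) \<partial>MB) \<partial>MB)"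
      by (rule MB.nn_integral_fst[symmetric])
  qed
  finally show ?thesis .
qed

lemma MB_space: "emeasure MB (space MB) = 1"
  using prob_space.emeasure_space_1[OF prob_MB] .

lemma MB_ind: "(\<integral>\<^sup>+b. indicator A (fst b) \<partial>MB) = ennreal (measure pois A)"
proof -
  have "(\<integral>\<^sup>+b. indicator A (fst b) \<partial>MB) = (\<integral>\<^sup>+b. indicator {b \<in> space MB. fst b \<in> A} b \<partial>MB)"
    by (intro nn_integral_cong) (auto split: split_indicator)
  also have "\<dots> = emeasure MB {b \<in> space MB. fst b \<in> A}"
  proof (rule nn_integral_indicator)
    have "fst -` A \<inter> space MB \<in> sets MB" by (rule measurable_sets[OF fst_MB]) simp
    then show "{b \<in> space MB. fst b \<in> A} \<in> sets MB" by (simp add: vimage_def Int_def conj_commute)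
  qed
  finally show ?thesis by (simp add: MB_fst_emeasure)
qed

lemma MB_product:
  assumes "u \<in> borel_measurable MB" "v \<in> borel_measurable MB"
  shows "(\<integral>\<^sup>+b. (\<integral>\<^sup>+c. u b * v c \<partial>MB) \<partial>MB) = (\<integral>\<^sup>+b. u b \<partial>MB) * (\<integral>\<^sup>+c. v c \<partial>MB)"
  using assms by (simp add: nn_integral_cmult nn_integral_multc)

text \<open>Up to an event of probability \<open>O((1 - p)\<^sup>2)\<close> at most one point is removed or added.\<close>

lemma correlation_increment:
  fixes F :: "('a set \<Rightarrow> ennreal) \<Rightarrow> real"
  assumes F[measurable]: "F \<in> borel_measurable N"
    and Fb: "\<And>\<mu>. \<mu> \<in> Nset L \<Longrightarrow> 0 \<le> F \<mu> \<and> F \<mu> \<le> M"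
    and D: "0 \<le> D" "energy P L \<eta> F \<le> ennreal D"
  shows "(\<integral>\<omega>. (F (\<eta> \<omega>))\<^sup>2 \<partial>P) - (\<integral>\<omega>. F (\<eta> \<omega>) * F (xi T \<omega>) \<partial>P) \<le> (1 - p) * D + 2 * M\<^sup>2 * r\<^sup>2"
proof -
  define A where "A = (\<integral>\<omega>. (F (\<eta> \<omega>))\<^sup>2 \<partial>P)"
  define \<phi> where "\<phi> = (\<integral>\<omega>. F (\<eta> \<omega>) * F (xi T \<omega>) \<partial>P)"
  interpret MB: prob_space MB by (rule prob_MB)
  interpret M3: prob_space M3 using pair_law_cluster by (simp add: pair_law_def)
  note pl = pair_law_cluster pair_law_eta[OF T_sets]
  have M0: "0 \<le> M" using Fb[of "pts L (\<lambda>_. False) (\<lambda>_. undefined)"] by force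
  have retN: "retained T \<omega> \<in> Nset L" for \<omega> by (simp add: retained_def thin_def)
  have X3N: "X3 z \<in> Nset L" "Y3 z \<in> Nset L" for z by (simp_all add: X3_def Y3_def retN cluster_def)
  have iX: "integrable M3 (\<lambda>z. F (X3 z) * F (X3 z))" "integrable M3 (\<lambda>z. F (Y3 z) * F (Y3 z))"
    "integrable M3 (\<lambda>z. F (X3 z) * F (Y3 z))"
    using Fb X3N M0 by (intro M3.integrable_bounded[where C="M * M"]; auto simp: abs_mult intro!: mult_mono)+
  have EX: "(\<integral>z. F (X3 z) * F (X3 z) \<partial>M3) = A"
    using pair_law_integral_eq[OF pl, of "\<lambda>z. F (fst z) * F (fst z)"] by (simp add: A_def power2_eq_square)
  have EY: "(\<integral>z. F (Y3 z) * F (Y3 z) \<partial>M3) = A"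
    using pair_law_integral_eq[OF pair_law_sym[OF pl(1)] pl(2), of "\<lambda>z. F (fst z) * F (fst z)"]
    by (simp add: A_def power2_eq_square)
  have EXY: "(\<integral>z. F (X3 z) * F (Y3 z) \<partial>M3) = \<phi>"
    using pair_law_integral_eq[OF pl, of "\<lambda>z. F (fst z) * F (snd z)"] by (simp add: \<phi>_def)
  have sq: "(F (X3 z) - F (Y3 z))\<^sup>2 = F (X3 z) * F (X3 z) + F (Y3 z) * F (Y3 z) - 2 * (F (X3 z) * F (Y3 z))" for z
    by (simp add: power2_eq_square algebra_simps)
  have isq: "integrable M3 (\<lambda>z. (F (X3 z) - F (Y3 z))\<^sup>2)"
    unfolding sq using iX by auto
  \<comment> \<open>Both coordinates have the law of \<eta>, so the mean squared difference is twice
    the loss of correlation.\<close>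
  have "(\<integral>z. (F (X3 z) - F (Y3 z))\<^sup>2 \<partial>M3) = 2 * (A - \<phi>)"
    unfolding sq using iX by (simp add: EX EY EXY)
  then have main: "ennreal (2 * (A - \<phi>)) = (\<integral>\<^sup>+z. ennreal ((F (X3 z) - F (Y3 z))\<^sup>2) \<partial>M3)"
    using nn_integral_eq_integral[OF isq] by simp
  define h where "h \<mu> y = ennreal ((F (cm_add \<mu> (cm_dirac L y)) - F \<mu>)\<^sup>2)" for \<mu> y
  have hm[measurable]: "(\<lambda>z. h (fst z) (snd z)) \<in> borel_measurable (N \<Otimes>\<^sub>M L)"
  proof -
    have [measurable]: "(\<lambda>z. cm_dirac L (snd z)) \<in> measurable (N \<Otimes>\<^sub>M L) N"
      by (rule measurable_compose[OF measurable_snd measurable_cm_dirac])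
    show ?thesis unfolding h_def by measurable
  qed
  define H where "H \<mu> = (\<integral>\<^sup>+y\<in>T. h \<mu> y \<partial>L)" for \<mu>
  interpret LT: sigma_finite_measure L
  proof
    show "\<exists>A. countable A \<and> A \<subseteq> sets L \<and> \<Union> A = space L \<and> (\<forall>a\<in>A. emeasure L a \<noteq> \<infinity>)"
      using S_UN S_fin by (intro exI[of _ "range S"]) (auto simp: less_top)
  qed
  have Hm[measurable]: "H \<in> borel_measurable N"
    unfolding H_def by (rule LT.borel_measurable_nn_integral) (simp add: split_beta')
  have HD: "(\<integral>\<^sup>+\<omega>. H (\<eta> \<omega>) \<partial>P) \<le> ennreal D"
    unfolding H_def h_def
    by (rule order_trans[OF nn_integral_mono D(2)[unfolded energy_def]]) (auto intro!: nn_integral_mono split: split_indicator)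
  have EHX: "(\<integral>\<^sup>+z. H (X3 z) \<partial>M3) = (\<integral>\<^sup>+\<omega>. H (\<eta> \<omega>) \<partial>P)"
    using pair_law_nn_integral_eq[OF pl, of "\<lambda>z. H (fst z)"] by simp
  have mA: "(\<lambda>\<omega>. H (retained T \<omega>)) \<in> borel_measurable P" by measurable
  \<comment> \<open>Adding a point to the retained configuration has to be compared with adding one
    to \<eta>. With probability e^(-r) the first cluster is empty; then \<open>X3\<close> is the
    retained configuration, and \<open>X3\<close> has the law of \<eta>.\<close>
  have "ennreal (exp (- r)) * (\<integral>\<^sup>+\<omega>. H (retained T \<omega>) \<partial>P)
      = (\<integral>\<^sup>+\<omega>. (\<integral>\<^sup>+b. (\<integral>\<^sup>+c. indicator {0} (fst b) * H (retained T \<omega>) \<partial>MB) \<partial>MB) \<partial>P)"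
    by (simp add: nn_integral_multc nn_integral_cmult MB_space MB_ind measure_pmf_single pmf_pois mult.commute)
  also have "\<dots> \<le> (\<integral>\<^sup>+\<omega>. (\<integral>\<^sup>+b. (\<integral>\<^sup>+c. H (X3 (\<omega>, b, c)) \<partial>MB) \<partial>MB) \<partial>P)"
    by (intro nn_integral_mono) (auto simp: X3_def cluster_zero split: split_indicator)
  also have "\<dots> = (\<integral>\<^sup>+z. H (X3 z) \<partial>M3)"
    by (rule M3_fubini[symmetric]) measurable
  finally have HA: "ennreal (exp (- r)) * (\<integral>\<^sup>+\<omega>. H (retained T \<omega>) \<partial>P) \<le> ennreal D"
    using HD EHX by simp
  have hN: "(\<lambda>y. h (retained T \<omega>) y) \<in> borel_measurable L" if "\<omega> \<in> space P" for \<omega>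
  proof -
    have "(\<lambda>y. (retained T \<omega>, y)) \<in> measurable L (N \<Otimes>\<^sub>M L)" using retN by (intro measurable_Pair) auto
    from measurable_compose[OF this hm] show ?thesis by simp
  qed
  let ?n = "\<lambda>z::'w \<times> (nat \<times> (nat \<Rightarrow> 'a)) \<times> (nat \<times> (nat \<Rightarrow> 'a)). fst (fst (snd z))"
    and ?m = "\<lambda>z::'w \<times> (nat \<times> (nat \<Rightarrow> 'a)) \<times> (nat \<times> (nat \<Rightarrow> 'a)). fst (snd (snd z))"
  let ?G1 = "\<lambda>z. indicator {1} (?n z) * indicator {0} (?m z) * h (retained T (fst z)) (snd (fst (snd z)) 0)"
    and ?G2 = "\<lambda>z. indicator {0} (?n z) * indicator {1} (?m z) * h (retained T (fst z)) (snd (snd (snd z)) 0)"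
    and ?G3 = "\<lambda>z. indicator {1..} (?n z) * indicator {1..} (?m z) :: ennreal"
  \<comment> \<open>A majorant of the squared difference. One point in one cluster and none in the
    other gives \<open>h\<close>. In the remaining cases with a nonempty cluster there are two
    points in one cluster or a point in both, and the difference is at most
    \<open>M\<close>.\<close>
  define G where "G z = ?G1 z + ?G2 z + ennreal (M\<^sup>2) * (indicator {2..} (?n z) + indicator {2..} (?m z) + ?G3 z)" for z
  have ind[measurable]: "(\<lambda>z. indicator B (fst (fst (snd z))) :: ennreal) \<in> borel_measurable M3"
    "(\<lambda>z. indicator B (fst (snd (snd z))) :: ennreal) \<in> borel_measurable M3" for B
    by (rule measurable_compose[OF _ indicator_fst_MB], measurable)+
  have hz: "(\<lambda>z. h (retained T (fst z)) (snd (fst (snd z)) 0)) \<in> borel_measurable M3"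
    "(\<lambda>z. h (retained T (fst z)) (snd (snd (snd z)) 0)) \<in> borel_measurable M3"
  proof -
    have m: "(\<lambda>z. snd (fst (snd z)) 0) \<in> measurable M3 L" "(\<lambda>z. snd (snd (snd z)) 0) \<in> measurable M3 L"
      by (rule measurable_compose[OF _ snd_MB], measurable)+
    have "(\<lambda>z. (retained T (fst z), snd (fst (snd z)) 0)) \<in> measurable M3 (N \<Otimes>\<^sub>M L)"
      "(\<lambda>z. (retained T (fst z), snd (snd (snd z)) 0)) \<in> measurable M3 (N \<Otimes>\<^sub>M L)"
      using m by (auto intro!: measurable_Pair)
    from this[THEN measurable_compose[OF _ hm]]
    show "(\<lambda>z. h (retained T (fst z)) (snd (fst (snd z)) 0)) \<in> borel_measurable M3"
      "(\<lambda>z. h (retained T (fst z)) (snd (snd (snd z)) 0)) \<in> borel_measurable M3" by simp_all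
  qed
  have sqM: "(F \<mu> - F \<nu>)\<^sup>2 \<le> M\<^sup>2" if "\<mu> \<in> Nset L" "\<nu> \<in> Nset L" for \<mu> \<nu>
  proof -
    have "\<bar>F \<mu> - F \<nu>\<bar> \<le> M" using Fb[OF that(1)] Fb[OF that(2)] by auto
    then show ?thesis using M0 by (metis abs_le_square_iff abs_of_nonneg)
  qed
  have FG: "ennreal ((F (X3 z) - F (Y3 z))\<^sup>2) \<le> G z" for z
  proof -
    obtain \<omega> b c where z: "z = (\<omega>, b, c)" by (metis prod.exhaust)
    have bd: "ennreal ((F (X3 z) - F (Y3 z))\<^sup>2) \<le> ennreal (M\<^sup>2)"
      by (intro ennreal_leI sqM X3N)
    have key: "ennreal (M\<^sup>2) \<le> G z"
      if K: "1 \<le> (indicator {2..} (fst b) + indicator {2..} (fst c) + indicator {1..} (fst b) * indicator {1..} (fst c) :: ennreal)"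
    proof -
      have "ennreal (M\<^sup>2) * 1 \<le> ennreal (M\<^sup>2)
          * (indicator {2..} (fst b) + indicator {2..} (fst c) + indicator {1..} (fst b) * indicator {1..} (fst c))"
        by (intro mult_left_mono K) simp
      also have "\<dots> \<le> G z"
        unfolding G_def z fst_conv snd_conv by (rule add_increasing) simp_all
      finally show ?thesis by simp
    qed
    consider "fst b = 0" "fst c = 0" | "fst b = 1" "fst c = 0" | "fst b = 0" "fst c = 1"
      | "fst b \<ge> 2" | "fst c \<ge> 2" | "fst b \<ge> 1" "fst c \<ge> 1" by linarith
    then show ?thesis
    proof cases
      case 1
      then have "X3 z = Y3 z" by (simp add: z X3_def Y3_def cluster_zero)
      then show ?thesis by simp
    next
      case 2
      then show ?thesis by (simp add: z X3_def Y3_def cluster_zero cluster_one G_def h_def)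
    next
      case 3
      then show ?thesis
        by (simp add: z X3_def Y3_def cluster_zero cluster_one G_def h_def power2_commute)
    next
      case 4
      then show ?thesis by (intro order_trans[OF bd key]) (auto split: split_indicator)
    next
      case 5
      then show ?thesis by (intro order_trans[OF bd key]) (auto split: split_indicator)
    next
      case 6
      then show ?thesis by (intro order_trans[OF bd key]) (auto split: split_indicator)
    qed
  qed
  define one where "one \<omega> b = indicator {1} (fst b) * h (retained T \<omega>) (snd b 0)" for \<omega> and b :: "nat \<times> (nat \<Rightarrow> 'a)"
  have onem: "one \<omega> \<in> borel_measurable MB" if "\<omega> \<in> space P" for \<omega>
    unfolding one_def
    by (intro borel_measurable_times_ennreal indicator_fst_MB measurable_compose[OF snd_MB hN[OF that]])
  have I: "(\<integral>\<^sup>+\<omega>. (\<integral>\<^sup>+b. one \<omega> b \<partial>MB) * (\<integral>\<^sup>+c. indicator {0} (fst c) \<partial>MB) \<partial>P) \<le> ennreal ((1 - p) * D)"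
  proof -
    have "(\<integral>\<^sup>+\<omega>. (\<integral>\<^sup>+b. one \<omega> b \<partial>MB) * (\<integral>\<^sup>+c. indicator {0} (fst c) \<partial>MB) \<partial>P)
        = (\<integral>\<^sup>+\<omega>. ennreal ((1 - p) * exp (- r)) * (ennreal (exp (- r)) * H (retained T \<omega>)) \<partial>P)"
      unfolding one_def H_def
      by (intro nn_integral_cong) (simp only: MB_one[OF hN], simp add: MB_ind measure_pmf_single pmf_pois mult_ac)
    also have "\<dots> = ennreal ((1 - p) * exp (- r)) * (ennreal (exp (- r)) * (\<integral>\<^sup>+\<omega>. H (retained T \<omega>) \<partial>P))"
      using mA by (simp add: nn_integral_cmult)
    \<comment> \<open>One factor e^(-r), from the cluster that stays empty, is consumed by
      \<open>HA\<close>; the other, from the Poisson weight of a single point, is bounded by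
      1.\<close>
    also have "\<dots> \<le> ennreal (1 - p) * ennreal D"
      using r_pos p_le by (intro mult_mono HA ennreal_leI) (auto intro: mult_left_le)
    also have "\<dots> = ennreal ((1 - p) * D)"
      using p_le D by (simp add: ennreal_mult)
    finally show ?thesis .
  qed
  have I1: "(\<integral>\<^sup>+z. ?G1 z \<partial>M3) \<le> ennreal ((1 - p) * D)"
  proof -
    have "(\<integral>\<^sup>+z. ?G1 z \<partial>M3) = (\<integral>\<^sup>+\<omega>. (\<integral>\<^sup>+b. (\<integral>\<^sup>+c. one \<omega> b * indicator {0} (fst c) \<partial>MB) \<partial>MB) \<partial>P)"
      using hz by (subst M3_fubini) (auto simp: one_def mult_ac)
    also have "\<dots> = (\<integral>\<^sup>+\<omega>. (\<integral>\<^sup>+b. one \<omega> b \<partial>MB) * (\<integral>\<^sup>+c. indicator {0} (fst c) \<partial>MB) \<partial>P)"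
      by (intro nn_integral_cong MB_product onem indicator_fst_MB)
    finally show ?thesis using I by simp
  qed
  have I2: "(\<integral>\<^sup>+z. ?G2 z \<partial>M3) \<le> ennreal ((1 - p) * D)"
  proof -
    have "(\<integral>\<^sup>+z. ?G2 z \<partial>M3) = (\<integral>\<^sup>+\<omega>. (\<integral>\<^sup>+b. (\<integral>\<^sup>+c. indicator {0} (fst b) * one \<omega> c \<partial>MB) \<partial>MB) \<partial>P)"
      using hz by (subst M3_fubini) (auto simp: one_def mult_ac)
    also have "\<dots> = (\<integral>\<^sup>+\<omega>. (\<integral>\<^sup>+b. one \<omega> b \<partial>MB) * (\<integral>\<^sup>+c. indicator {0} (fst c) \<partial>MB) \<partial>P)"
      by (intro nn_integral_cong trans[OF MB_product mult.commute] onem indicator_fst_MB)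
    finally show ?thesis using I by simp
  qed
  have I3: "(\<integral>\<^sup>+z. indicator {2..} (?n z) \<partial>M3) \<le> ennreal (r\<^sup>2)" "(\<integral>\<^sup>+z. indicator {2..} (?m z) \<partial>M3) \<le> ennreal (r\<^sup>2)"
    by (subst M3_fubini; simp add: MB_ind MB_space P.emeasure_space_1 ennreal_leI pois_ge_2)+
  have I4: "(\<integral>\<^sup>+z. ?G3 z \<partial>M3) \<le> ennreal (r\<^sup>2)"
  proof -
    have "(\<integral>\<^sup>+z. ?G3 z \<partial>M3) = (\<integral>\<^sup>+\<omega>. (\<integral>\<^sup>+b. (\<integral>\<^sup>+c. indicator {1..} (fst b) * indicator {1..} (fst c) \<partial>MB) \<partial>MB) \<partial>P)"
      by (subst M3_fubini) auto
    also have "\<dots> = ennreal ((measure pois {1..})\<^sup>2)"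
      by (simp only: MB_product[OF indicator_fst_MB indicator_fst_MB] MB_ind nn_integral_const P.emeasure_space_1 mult_1_right)
        (simp add: ennreal_mult power2_eq_square)
    also have "\<dots> \<le> ennreal (r\<^sup>2)"
      by (intro ennreal_leI power_mono pois_ge_1) simp
    finally show ?thesis .
  qed
  have "ennreal (2 * (A - \<phi>)) \<le> (\<integral>\<^sup>+z. G z \<partial>M3)"
    unfolding main by (intro nn_integral_mono FG)
  also have "\<dots> = (\<integral>\<^sup>+z. ?G1 z \<partial>M3) + (\<integral>\<^sup>+z. ?G2 z \<partial>M3)
      + ennreal (M\<^sup>2) * ((\<integral>\<^sup>+z. indicator {2..} (?n z) \<partial>M3) + (\<integral>\<^sup>+z. indicator {2..} (?m z) \<partial>M3) + (\<integral>\<^sup>+z. ?G3 z \<partial>M3))"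
    unfolding G_def
    by (simp only: nn_integral_add nn_integral_cmult borel_measurable_times_ennreal borel_measurable_add ind hz borel_measurable_const)
  also have "\<dots> \<le> ennreal ((1 - p) * D) + ennreal ((1 - p) * D) + ennreal (M\<^sup>2) * (ennreal (r\<^sup>2) + ennreal (r\<^sup>2) + ennreal (r\<^sup>2))"
    by (intro add_mono mult_left_mono I1 I2 I3 I4) simp
  also have "\<dots> = ennreal (2 * ((1 - p) * D) + 3 * (M\<^sup>2 * r\<^sup>2))"
    using p_le D by (simp add: ennreal_plus[symmetric] ennreal_mult[symmetric] del: ennreal_plus)
  finally have "2 * (A - \<phi>) \<le> 2 * ((1 - p) * D) + 3 * (M\<^sup>2 * r\<^sup>2)"
    using p_le D by (subst (asm) ennreal_le_iff) auto
  moreover have "0 \<le> M\<^sup>2 * r\<^sup>2" by simp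
  \<comment> \<open>Three error events of probability at most r^2 each, halved by the factor 2 on
    the left; 3/2 is rounded up to 2.\<close>
  ultimately have "A - \<phi> \<le> (1 - p) * D + 2 * (M\<^sup>2 * r\<^sup>2)"
    by (rule half_le)
  then show ?thesis by (simp add: A_def \<phi>_def)
qed

end

section \<open>Refreshing on growing sets\<close>

text \<open>For x' > x the powers (1 - x'/2^n)^(2^n) tend to e^(-x'), and the gap x' - x absorbs the
  second-order term in y; then x' decreases to x. The premise is restricted to nonnegative bases,
  where powers are monotone.\<close>

lemma exp_le_limit_power:
  fixes x y R :: real
  assumes x: "0 \<le> x" and b: "\<And>n::nat. 0 \<le> 1 - x / 2 ^ n - y / (2 ^ n)\<^sup>2 \<Longrightarrow>
      (1 - x / 2 ^ n - y / (2 ^ n)\<^sup>2) ^ (2 ^ n) \<le> R"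
  shows "exp (- x) \<le> R"
proof -
  have step: "exp (- x') \<le> R" if x': "x < x'" for x'
  proof -
    have lim: "(\<lambda>n. (1 + (- x') / real (2 ^ n)) ^ (2 ^ n)) \<longlonglongrightarrow> exp (- x')"
      using LIMSEQ_subseq_LIMSEQ[OF tendsto_exp_limit_sequentially[of "- x'"], of "\<lambda>n. 2 ^ n"]
      by (simp add: o_def strict_mono_def)
    have "\<forall>\<^sub>F n in sequentially. (1 + (- x') / real (2 ^ n)) ^ (2 ^ n) \<le> R"
    proof -
      \<comment> \<open>Once 2^n exceeds x' the base 1 - x'/2^n is nonnegative, and once it exceeds
        y / (x' - x) the gap dominates the second-order term.\<close>
      obtain k where k: "max x' (y / (x' - x)) < real (2 ^ k)"
        using real_arch_pow[of 2 "max x' (y / (x' - x))"] by auto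
      have "(1 + (- x') / real (2 ^ n)) ^ (2 ^ n) \<le> R" if n: "n \<ge> k" for n
      proof -
        define m :: real where "m = 2 ^ n"
        have "real (2 ^ k) \<le> m" using n by (simp add: m_def)
        from less_le_trans[OF k this] have m: "0 < m" "max x' (y / (x' - x)) < m"
          by (simp_all add: m_def)
        have ym: "y \<le> m * (x' - x)"
          using m x' by (simp add: pos_divide_less_eq)
        have "y / m\<^sup>2 \<le> (x' - x) / m"
        proof -
          have "y / m\<^sup>2 \<le> (m * (x' - x)) / m\<^sup>2" using ym by (intro divide_right_mono) auto
          then show ?thesis using m by (simp add: power2_eq_square)
        qed
        then have le: "1 - x' / m \<le> 1 - x / m - y / m\<^sup>2" by (simp add: diff_divide_distrib)
        have nn: "0 \<le> 1 - x' / m" using m by simp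
        have "(1 - x' / m) ^ (2 ^ n) \<le> (1 - x / m - y / m\<^sup>2) ^ (2 ^ n)"
          by (intro power_mono le nn)
        also have "\<dots> \<le> R"
          by (rule b[of n, folded m_def]) (use le nn in linarith)
        finally show ?thesis by (simp add: m_def)
      qed
      then show ?thesis unfolding eventually_sequentially by blast
    qed
    then show ?thesis by (intro tendsto_upperbound[OF lim]) auto
  qed
  have "((\<lambda>x'. exp (- x')) \<longlongrightarrow> exp (- x)) (at_right x)"
    by (intro tendsto_intros)
  moreover have "\<forall>\<^sub>F x' in at_right x. exp (- x') \<le> R"
    using step by (auto simp: eventually_at_filter intro!: always_eventually)
  ultimately show ?thesis by (intro tendsto_upperbound) auto
qed

text \<open>Iterated halving gives (f (t / 2^n) / A)^(2^n) \<le> f t / A. Over the 2^n factors the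
  errors C (t / 2^n)^2 add up to order 2^(-n), so only the slope \<open>D\<close> survives, whatever
  the size of \<open>C\<close>.\<close>

lemma log_convex_decay:
  fixes f :: "real \<Rightarrow> real"
  assumes A: "0 \<le> A" and D: "0 \<le> D" and t: "0 < t"
    and nn: "\<And>s. 0 < s \<Longrightarrow> 0 \<le> f s"
    and conv: "\<And>s. 0 < s \<Longrightarrow> (f (s / 2))\<^sup>2 \<le> A * f s"
    and inc: "\<And>s. 0 < s \<Longrightarrow> A - f s \<le> s * D + C * s\<^sup>2"
  shows "exp (- a * t) * ((1 + a * t) * A - t * D) \<le> f t"
proof (cases "A = 0")
  case True
  have "exp (- a * t) * (- (t * D)) \<le> 0" using t D by (simp add: mult_nonneg_nonpos)
  then show ?thesis using nn[OF t] True by simp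
next
  case False
  then have A: "0 < A" using A by simp
  have pow: "(f (s / 2 ^ n) / A) ^ (2 ^ n) \<le> f s / A" if "0 < s" for s n
    using that
  proof (induction n arbitrary: s)
    case (Suc n)
    have "(f (s / 2 ^ Suc n) / A)\<^sup>2 \<le> f (s / 2 ^ n) / A"
      using conv[of "s / 2 ^ n"] Suc.prems A by (simp add: power_divide power2_eq_square field_simps)
    then have "((f (s / 2 ^ Suc n) / A)\<^sup>2) ^ (2 ^ n) \<le> (f (s / 2 ^ n) / A) ^ (2 ^ n)"
      by (intro power_mono) auto
    also have "\<dots> \<le> f s / A" by (rule Suc.IH[OF Suc.prems])
    finally show ?case by (simp add: power_mult[symmetric])
  qed simp
  have "exp (- (t * D / A)) \<le> f t / A"
  proof (rule exp_le_limit_power[where y="C * t\<^sup>2 / A"])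
    show "0 \<le> t * D / A" using t D A by simp
    fix n :: nat
    assume nn: "0 \<le> 1 - t * D / A / 2 ^ n - C * t\<^sup>2 / A / (2 ^ n)\<^sup>2"
    have "A - f (t / 2 ^ n) \<le> t / 2 ^ n * D + C * (t / 2 ^ n)\<^sup>2"
      using t by (intro inc) simp
    then have "(A - f (t / 2 ^ n)) / A \<le> (t / 2 ^ n * D + C * (t / 2 ^ n)\<^sup>2) / A"
      using A by (intro divide_right_mono) auto
    then have "1 - t * D / A / 2 ^ n - C * t\<^sup>2 / A / (2 ^ n)\<^sup>2 \<le> f (t / 2 ^ n) / A"
      using A by (simp add: diff_divide_distrib add_divide_distrib power_divide mult_ac)
    from power_mono[OF this nn] pow[OF t]
    show "(1 - t * D / A / 2 ^ n - C * t\<^sup>2 / A / (2 ^ n)\<^sup>2) ^ 2 ^ n \<le> f t / A"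
      by (rule order_trans)
  qed
  then have "A * exp (- (t * D / A)) \<le> f t" using A by (simp add: pos_le_divide_eq mult.commute)
  moreover have "exp (- a * t) * ((1 + a * t) * A - t * D) \<le> A * exp (- (t * D / A))"
  proof -
    \<comment> \<open>Equality holds for D = a A; multiplication by \<open>A\<close> then clears the
      ratio D / A.\<close>
    have "1 + (a * t - t * D / A) \<le> exp (a * t - t * D / A)" by (rule exp_ge_add_one_self)
    then have "A * exp (- a * t) * (1 + (a * t - t * D / A)) \<le> A * exp (- a * t) * exp (a * t - t * D / A)"
      using A by (intro mult_left_mono) auto
    also have "\<dots> = A * exp (- (t * D / A))"
      by (simp add: mult.assoc exp_add[symmetric])
    also have "A * exp (- a * t) * (1 + (a * t - t * D / A)) = exp (- a * t) * ((1 + a * t) * A - t * D)"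
      using A by (simp add: field_simps)
    finally show ?thesis .
  qed
  ultimately show ?thesis by linarith
qed

lemma abs_diff_le_half:
  fixes a b e :: real
  assumes "\<bar>2 * a / e - 2 * b / e\<bar> \<le> 1" "0 < e"
  shows "\<bar>a - b\<bar> \<le> e / 2"
proof -
  have "2 * a \<le> e + 2 * b \<and> 2 * b \<le> e + 2 * a"
    using assms by (simp add: abs_le_iff field_simps)
  then show ?thesis by (elim conjE) linarith
qed

section \<open>Convergence of local refreshments to the full one\<close>

context thinning
begin

lemma refresh_local:
  assumes B: "B \<in> sets L" "B \<subseteq> T" and T: "T \<in> sets L"
  shows "refresh T e w B = refresh (space L) e w B"
proof -
  have BL: "B \<subseteq> space L" using B(1) by (rule sets.sets_into_space)
  have "(\<Sum>i. if enat i < fst e \<and> (fst w i \<or> snd e i \<notin> T) then indicator B (snd e i) else 0)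
      = (\<Sum>i. if enat i < fst e \<and> (fst w i \<or> snd e i \<notin> space L) then indicator B (snd e i) else 0 :: ennreal)"
    using B(2) BL by (intro suminf_cong) (auto split: split_indicator)
  moreover have "B \<inter> T = B" "B \<inter> space L = B" using B BL by auto
  ultimately show ?thesis
    using B(1) by (simp add: refresh_def cm_add_def thin_def pts_def restr_def)
qed

text \<open>By reversibility the pairs (refreshed, \<eta>) and (\<eta>, refreshed) have the same
  law, hence the same first marginal.\<close>

lemma xi_distr:
  assumes "T \<in> sets L" shows "distr P N (xi T) = distr P N \<eta>"
proof (rule measure_eqI)
  note [measurable] = xi_meas[OF assms]
  note pl = pair_law_eta[OF assms]
  fix A assume "A \<in> sets (distr P N (xi T))"
  then have [measurable]: "A \<in> sets N" by simp
  have "(\<lambda>z. indicator A (fst z) :: ennreal) \<in> borel_measurable (N \<Otimes>\<^sub>M N)" by measurable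
  from pair_law_nn_integral_eq[OF pair_law_sym[OF pl] pl this]
  have "(\<integral>\<^sup>+\<omega>. indicator A (xi T \<omega>) \<partial>P) = (\<integral>\<^sup>+\<omega>. indicator A (\<eta> \<omega>) \<partial>P)" by simp
  moreover have "(\<integral>\<^sup>+\<omega>. indicator A (f \<omega>) \<partial>P) = emeasure (distr P N f) A" if "f \<in> measurable P N" for f
    using that by (subst nn_integral_distr[symmetric, of _ _ N]) auto
  ultimately show "emeasure (distr P N (xi T)) A = emeasure (distr P N \<eta>) A"
    by simp
qed simp

text \<open>\<open>F\<close> is merely measurable, so closeness of configurations does not pass
  through it by continuity. Convergence is measured instead by the probability that membership in a
  fixed measurable set changes.\<close>

definition discrepancy :: "nat \<Rightarrow> ('a set \<Rightarrow> ennreal) set \<Rightarrow> 'w set" where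
  "discrepancy n A = {\<omega> \<in> space P. (xi (S n) \<omega> \<in> A) \<noteq> (xi (space L) \<omega> \<in> A)}"

lemma discrepancy_sets: "A \<in> sets N \<Longrightarrow> discrepancy n A \<in> sets P"
proof -
  assume [measurable]: "A \<in> sets N"
  have [measurable]: "xi (S n) \<in> measurable P N" "xi (space L) \<in> measurable P N" by (auto intro: xi_meas)
  show ?thesis unfolding discrepancy_def by measurable
qed

text \<open>Induction over the generated sigma-algebra. For a generator the event is eventually
  empty. For a countable union, the part beyond the first J sets has a probability independent of
  \<open>n\<close>, because every refreshment has the law of \<eta>; so J can be fixed before
  \<open>n\<close> grows.\<close>

lemma discrepancy_tendsto:
  assumes "A \<in> sets N" shows "(\<lambda>n. measure P (discrepancy n A)) \<longlonglongrightarrow> 0"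
proof -
  have "A \<in> sigma_sets (Nset L) {{\<mu> \<in> Nset L. \<mu> B = a} | B a. B \<in> loc}"
    using assms unfolding sigma_loc_eq .
  then show ?thesis
  proof (induction rule: sigma_sets.induct)
    case (Basic A)
    then obtain B a where B: "B \<in> loc" and A: "A = {\<mu> \<in> Nset L. \<mu> B = a}" by blast
    then obtain m where m: "B \<in> sets L" "B \<subseteq> S m" by (auto simp: loc_def)
    have "discrepancy n A = {}" if "n \<ge> m" for n
    proof -
      have "B \<subseteq> S n" using m(2) S_mono that by (auto simp: incseq_def)
      moreover have "xi T \<omega> \<in> Nset L" if "\<omega> \<in> space P" "T \<in> sets L" for \<omega> T
        using measurable_space[OF xi_meas[OF that(2)] that(1)] by simp
      ultimately show ?thesis
        using refresh_local[OF m(1), of "S n"] by (auto simp: discrepancy_def A)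
    qed
    then show ?case
      by (intro tendsto_eventually) (auto simp: eventually_sequentially intro!: exI[of _ m])
  next
    case Empty
    then show ?case by (simp add: discrepancy_def)
  next
    case (Compl A)
    have "xi T \<omega> \<in> Nset L" if "\<omega> \<in> space P" "T \<in> sets L" for \<omega> T
      using measurable_space[OF xi_meas[OF that(2)] that(1)] by simp
    then have "discrepancy n (Nset L - A) = discrepancy n A" for n by (auto simp: discrepancy_def)
    then show ?case using Compl by simp
  next
    case (Union a)
    have aN[measurable]: "a i \<in> sets N" for i using Union(1) unfolding sigma_loc_eq .
    define Q where "Q = distr P N \<eta>"
    interpret Q: prob_space Q unfolding Q_def by (rule P.prob_space_distr) measurable
    define c where "c J = (\<Union>i. a i) - (\<Union>i<J. a i)" for J :: nat
    have cN: "c J \<in> sets N" for J unfolding c_def by measurable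
    have "(\<lambda>J. measure Q (c J)) \<longlonglongrightarrow> measure Q (\<Inter>J. c J)"
      by (rule Q.finite_Lim_measure_decseq) (use cN in \<open>auto simp: Q_def decseq_def c_def\<close>)
    moreover have "(\<Inter>J. c J) = {}" by (auto simp: c_def)
    ultimately have c0: "(\<lambda>J. measure Q (c J)) \<longlonglongrightarrow> 0" by simp
    have xc: "measure P {\<omega> \<in> space P. xi T \<omega> \<in> c J} = measure Q (c J)"
      "{\<omega> \<in> space P. xi T \<omega> \<in> c J} \<in> sets P" if T: "T \<in> sets L" for T J
    proof -
      have "measure Q (c J) = measure (distr P N (xi T)) (c J)" by (simp add: Q_def xi_distr[OF T])
      also have "\<dots> = measure P (xi T -` c J \<inter> space P)"
        using xi_meas[OF T] cN by (intro measure_distr)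
      also have "xi T -` c J \<inter> space P = {\<omega> \<in> space P. xi T \<omega> \<in> c J}" by auto
      finally show "measure P {\<omega> \<in> space P. xi T \<omega> \<in> c J} = measure Q (c J)" ..
      show "{\<omega> \<in> space P. xi T \<omega> \<in> c J} \<in> sets P"
        using measurable_sets[OF xi_meas[OF T] cN] by (simp add: vimage_def Int_def conj_commute)
    qed
    have bound: "measure P (discrepancy n (\<Union>i. a i)) \<le> (\<Sum>i<J. measure P (discrepancy n (a i))) + 2 * measure Q (c J)" for n J
    proof -
      let ?E = "\<lambda>T. {\<omega> \<in> space P. xi T \<omega> \<in> c J}"
      have sub: "discrepancy n (\<Union>i. a i) \<subseteq> (\<Union>i<J. discrepancy n (a i)) \<union> (?E (S n) \<union> ?E (space L))"
        by (auto simp: discrepancy_def c_def)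
      have "measure P (discrepancy n (\<Union>i. a i)) \<le> measure P ((\<Union>i<J. discrepancy n (a i)) \<union> (?E (S n) \<union> ?E (space L)))"
        using sub by (rule P.finite_measure_mono) (use xc(2) discrepancy_sets[OF aN] in auto)
      also have "\<dots> \<le> measure P (\<Union>i<J. discrepancy n (a i)) + measure P (?E (S n) \<union> ?E (space L))"
        by (rule measure_Un_le) (use xc(2) discrepancy_sets[OF aN] in auto)
      also have "\<dots> \<le> (\<Sum>i<J. measure P (discrepancy n (a i))) + (measure P (?E (S n)) + measure P (?E (space L)))"
        using discrepancy_sets[OF aN] xc(2)
        by (intro add_mono measure_UNION_le measure_Un_le) auto
      finally show ?thesis by (simp add: xc(1))
    qed
    show ?case
    proof (rule LIMSEQ_I)
      fix \<epsilon> :: real assume "0 < \<epsilon>"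
      then have "\<forall>\<^sub>F J in sequentially. measure Q (c J) < \<epsilon> / 4"
        using order_tendstoD(2)[OF c0, of "\<epsilon> / 4"] by simp
      then obtain J where J: "measure Q (c J) < \<epsilon> / 4" by (meson eventually_sequentially order_refl)
      have "(\<lambda>n. \<Sum>i<J. measure P (discrepancy n (a i))) \<longlonglongrightarrow> (\<Sum>i<J. 0)"
        by (intro tendsto_sum Union.IH)
      then have "\<forall>\<^sub>F n in sequentially. (\<Sum>i<J. measure P (discrepancy n (a i))) < \<epsilon> / 2"
        using order_tendstoD(2)[of _ 0 sequentially "\<epsilon> / 2"] \<open>0 < \<epsilon>\<close> by simp
      then obtain n0 where n0: "\<And>n. n \<ge> n0 \<Longrightarrow> (\<Sum>i<J. measure P (discrepancy n (a i))) < \<epsilon> / 2"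
        by (meson eventually_sequentially)
      have "norm (measure P (discrepancy n (\<Union>i. a i)) - 0) < \<epsilon>" if "n \<ge> n0" for n
        using bound[of n J] n0[OF that] J by simp
      then show "\<exists>no. \<forall>n\<ge>no. norm (measure P (discrepancy n (\<Union>i. a i)) - 0) < \<epsilon>" by blast
    qed
  qed
qed

text \<open>The values of \<open>F\<close> are sorted into finitely many bins of width e / 2. If
  both configurations fall into one bin, the difference is at most e / 2; otherwise the bin of the
  limiting one has a discrepancy, at a cost of at most \<open>M\<close>.\<close>

lemma refresh_L1_tendsto:
  fixes F :: "('a set \<Rightarrow> ennreal) \<Rightarrow> real"
  assumes F[measurable]: "F \<in> borel_measurable N"
    and Fb: "\<And>\<mu>. \<mu> \<in> Nset L \<Longrightarrow> 0 \<le> F \<mu> \<and> F \<mu> \<le> M"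
  shows "(\<lambda>n. \<integral>\<omega>. \<bar>F (xi (S n) \<omega>) - F (xi (space L) \<omega>)\<bar> \<partial>P) \<longlonglongrightarrow> 0"
proof (rule LIMSEQ_I)
  fix e :: real assume e: "0 < e"
  define A where "A j = {\<mu> \<in> space N. nat \<lfloor>2 * F \<mu> / e\<rfloor> = j}" for j
  have A[measurable]: "A j \<in> sets N" for j unfolding A_def by measurable
  define k where "k = nat \<lfloor>2 * M / e\<rfloor>"
  have xN: "xi T \<omega> \<in> Nset L" if "\<omega> \<in> space P" "T \<in> sets L" for \<omega> T
    using measurable_space[OF xi_meas[OF that(2)] that(1)] by simp
  have m[measurable]: "(\<lambda>\<omega>. F (xi T \<omega>)) \<in> borel_measurable P" if "T \<in> sets L" for T
    using xi_meas[OF that] F by (rule measurable_compose)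
  have M0: "0 \<le> M" using Fb[of "pts L (\<lambda>_. False) (\<lambda>_. undefined)"] by force
  have bound: "\<bar>F (xi (S n) \<omega>) - F (xi (space L) \<omega>)\<bar> \<le> e / 2 + (\<Sum>j\<le>k. M * indicator (discrepancy n (A j)) \<omega>)"
    if \<omega>: "\<omega> \<in> space P" for n \<omega>
  proof -
    let ?a = "F (xi (S n) \<omega>)" and ?b = "F (xi (space L) \<omega>)"
    have b: "0 \<le> ?a" "?a \<le> M" "0 \<le> ?b" "?b \<le> M" using Fb xN[OF \<omega>] by auto
    define j where "j = nat \<lfloor>2 * ?b / e\<rfloor>"
    show ?thesis
    proof (cases "\<omega> \<in> discrepancy n (A j)")
      case True
      have "j \<le> k" unfolding j_def k_def using b e by (intro nat_mono floor_mono divide_right_mono) auto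
      then have "M * indicator (discrepancy n (A j)) \<omega> \<le> (\<Sum>j\<le>k. M * indicator (discrepancy n (A j)) \<omega>)"
        using M0 by (intro member_le_sum) auto
      then show ?thesis using True b e by simp
    next
      case False
      then have "nat \<lfloor>2 * ?a / e\<rfloor> = nat \<lfloor>2 * ?b / e\<rfloor>"
        using \<omega> xN[OF \<omega>] by (auto simp: discrepancy_def A_def j_def)
      then have "\<lfloor>2 * ?a / e\<rfloor> = \<lfloor>2 * ?b / e\<rfloor>" using b e by (simp add: eq_nat_nat_iff)
      then have "\<bar>2 * ?a / e - 2 * ?b / e\<bar> \<le> 1" by linarith
      then have "\<bar>?a - ?b\<bar> \<le> e / 2" using e by (rule abs_diff_le_half)
      moreover have "0 \<le> (\<Sum>j\<le>k. M * indicator (discrepancy n (A j)) \<omega>)" using M0 by (intro sum_nonneg) auto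
      ultimately show ?thesis by simp
    qed
  qed
  have int: "(\<integral>\<omega>. \<bar>F (xi (S n) \<omega>) - F (xi (space L) \<omega>)\<bar> \<partial>P) \<le> e / 2 + (\<Sum>j\<le>k. M * measure P (discrepancy n (A j)))" for n
  proof -
    have i: "integrable P (\<lambda>\<omega>. M * indicator (discrepancy n (A j)) \<omega>)" for j
      using discrepancy_sets[OF A] by (intro integrable_mult_right integrable_real_indicator) (auto simp: P.emeasure_eq_measure)
    have "integrable P (\<lambda>\<omega>. F (xi T \<omega>))" if "T \<in> sets L" for T
      using Fb xN[OF _ that] by (intro P.integrable_bounded[where C=M] m[OF that]) auto
    then have "(\<integral>\<omega>. \<bar>F (xi (S n) \<omega>) - F (xi (space L) \<omega>)\<bar> \<partial>P)
        \<le> (\<integral>\<omega>. e / 2 + (\<Sum>j\<le>k. M * indicator (discrepancy n (A j)) \<omega>) \<partial>P)"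
      by (intro integral_mono bound Bochner_Integration.integrable_add Bochner_Integration.integrable_sum i) auto
    also have "\<dots> = (\<integral>\<omega>. e / 2 \<partial>P) + (\<integral>\<omega>. (\<Sum>j\<le>k. M * indicator (discrepancy n (A j)) \<omega>) \<partial>P)"
      by (intro Bochner_Integration.integral_add Bochner_Integration.integrable_sum i) simp
    also have "(\<integral>\<omega>. e / 2 \<partial>P) = e / 2" by (simp add: P.prob_space)
    also have "(\<integral>\<omega>. (\<Sum>j\<le>k. M * indicator (discrepancy n (A j)) \<omega>) \<partial>P) = (\<Sum>j\<le>k. \<integral>\<omega>. M * indicator (discrepancy n (A j)) \<omega> \<partial>P)"
      by (rule Bochner_Integration.integral_sum) (rule i)
    also have "e / 2 + \<dots> = e / 2 + (\<Sum>j\<le>k. M * measure P (discrepancy n (A j)))"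
      using sets.sets_into_space[OF discrepancy_sets[OF A]] by (simp add: Int_absorb2)
    finally show ?thesis .
  qed
  have "(\<lambda>n. \<Sum>j\<le>k. M * measure P (discrepancy n (A j))) \<longlonglongrightarrow> (\<Sum>j\<le>k. M * 0)"
    by (intro tendsto_sum tendsto_mult tendsto_const discrepancy_tendsto A)
  then have "\<forall>\<^sub>F n in sequentially. (\<Sum>j\<le>k. M * measure P (discrepancy n (A j))) < e / 2"
    using order_tendstoD(2)[of _ 0 sequentially "e / 2"] e by simp
  then obtain n0 where n0: "\<And>n. n \<ge> n0 \<Longrightarrow> (\<Sum>j\<le>k. M * measure P (discrepancy n (A j))) < e / 2"
    by (meson eventually_sequentially)
  have "norm ((\<integral>\<omega>. \<bar>F (xi (S n) \<omega>) - F (xi (space L) \<omega>)\<bar> \<partial>P) - 0) < e" if "n \<ge> n0" for n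
    using int[of n] n0[OF that] by simp
  then show "\<exists>no. \<forall>n\<ge>no. norm ((\<integral>\<omega>. \<bar>F (xi (S n) \<omega>) - F (xi (space L) \<omega>)\<bar> \<partial>P) - 0) < e" by blast
qed

lemma correlation_tendsto:
  fixes F :: "('a set \<Rightarrow> ennreal) \<Rightarrow> real"
  assumes F[measurable]: "F \<in> borel_measurable N"
    and Fb: "\<And>\<mu>. \<mu> \<in> Nset L \<Longrightarrow> 0 \<le> F \<mu> \<and> F \<mu> \<le> M"
  shows "(\<lambda>n. \<integral>\<omega>. F (\<eta> \<omega>) * F (xi (S n) \<omega>) \<partial>P) \<longlonglongrightarrow> (\<integral>\<omega>. F (\<eta> \<omega>) * F (xi (space L) \<omega>) \<partial>P)"
proof -
  from refresh_L1_tendsto[OF F Fb]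
  have z: "(\<lambda>n. M * (\<integral>\<omega>. \<bar>F (xi (S n) \<omega>) - F (xi (space L) \<omega>)\<bar> \<partial>P)) \<longlonglongrightarrow> 0"
    by (rule tendsto_mult_right_zero)
  have xN: "xi T \<omega> \<in> Nset L" "\<eta> \<omega> \<in> Nset L" if "\<omega> \<in> space P" "T \<in> sets L" for \<omega> T
    using measurable_space[OF xi_meas[OF that(2)] that(1)] measurable_space[OF eta_meas that(1)] by simp_all
  have M0: "0 \<le> M" using Fb[of "pts L (\<lambda>_. False) (\<lambda>_. undefined)"] by force
  have m: "(\<lambda>\<omega>. F (xi T \<omega>)) \<in> borel_measurable P" if "T \<in> sets L" for T
    using xi_meas[OF that] F by (rule measurable_compose)
  have i1: "integrable P (\<lambda>\<omega>. F (\<eta> \<omega>) * F (xi T \<omega>))" if T: "T \<in> sets L" for T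
  proof (rule P.integrable_bounded[where C="M * M"])
    show "\<bar>F (\<eta> \<omega>) * F (xi T \<omega>)\<bar> \<le> M * M" if "\<omega> \<in> space P" for \<omega>
      using Fb[OF xN(1)[OF that T]] Fb[OF xN(2)[OF that T]] M0 by (auto simp: abs_mult intro!: mult_mono)
  qed (use m[OF T] in measurable)
  have i2: "integrable P (\<lambda>\<omega>. F (xi T \<omega>))" if T: "T \<in> sets L" for T
    using Fb[OF xN(1)[OF _ T]] by (intro P.integrable_bounded[where C=M] m[OF T]) auto
  have "norm ((\<integral>\<omega>. F (\<eta> \<omega>) * F (xi (S n) \<omega>) \<partial>P) - (\<integral>\<omega>. F (\<eta> \<omega>) * F (xi (space L) \<omega>) \<partial>P))
      \<le> M * (\<integral>\<omega>. \<bar>F (xi (S n) \<omega>) - F (xi (space L) \<omega>)\<bar> \<partial>P)" for n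
  proof -
    have "(\<integral>\<omega>. F (\<eta> \<omega>) * F (xi (S n) \<omega>) \<partial>P) - (\<integral>\<omega>. F (\<eta> \<omega>) * F (xi (space L) \<omega>) \<partial>P)
        = (\<integral>\<omega>. F (\<eta> \<omega>) * F (xi (S n) \<omega>) - F (\<eta> \<omega>) * F (xi (space L) \<omega>) \<partial>P)"
      using i1 by (subst Bochner_Integration.integral_diff) auto
    also have "norm \<dots> \<le> (\<integral>\<omega>. norm (F (\<eta> \<omega>) * F (xi (S n) \<omega>) - F (\<eta> \<omega>) * F (xi (space L) \<omega>)) \<partial>P)"
      by (rule integral_norm_bound)
    also have "\<dots> \<le> (\<integral>\<omega>. M * \<bar>F (xi (S n) \<omega>) - F (xi (space L) \<omega>)\<bar> \<partial>P)"
    proof (rule integral_mono)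
      fix \<omega> assume "\<omega> \<in> space P"
      then have "\<bar>F (\<eta> \<omega>)\<bar> \<le> M" using Fb[OF xN(2)[OF _ sets.top]] by auto
      then show "norm (F (\<eta> \<omega>) * F (xi (S n) \<omega>) - F (\<eta> \<omega>) * F (xi (space L) \<omega>))
          \<le> M * \<bar>F (xi (S n) \<omega>) - F (xi (space L) \<omega>)\<bar>"
        by (simp add: right_diff_distrib[symmetric] abs_mult mult_right_mono)
    qed (use i1 i2 in auto)
    finally show ?thesis by simp
  qed
  then have "(\<lambda>n. (\<integral>\<omega>. F (\<eta> \<omega>) * F (xi (S n) \<omega>) \<partial>P) - (\<integral>\<omega>. F (\<eta> \<omega>) * F (xi (space L) \<omega>) \<partial>P)) \<longlonglongrightarrow> 0"
    by (intro Lim_null_comparison[OF _ z]) auto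
  then show ?thesis by (rule LIM_zero_cancel)
qed

end

section \<open>The lower bound\<close>

lemma has_real_derivative_exp_scaled:
  fixes c t :: real
  assumes "c \<noteq> 0"
  shows "((\<lambda>t. - exp (- c * t) / c) has_real_derivative exp (- c * t)) (at t)"
  using assms by (auto intro!: derivative_eq_intros)

context exhaustion
begin

text \<open>The values of the correlation at \<open>s / 2\<close> and at \<open>s\<close> come from
  different families and are linked only by the joint law: \<open>correlation_square_le\<close>
  accepts any pair with retention e^(-s). The bound 1 - e^(-s) \<le> s brings the increment into the
  form required by \<open>log_convex_decay\<close>.\<close>

lemma correlation_decay_finite:
  fixes F :: "('a set \<Rightarrow> ennreal) \<Rightarrow> real"
  assumes fam: "\<And>t. 0 < t \<Longrightarrow> thinning L S P \<eta> (exp (- t)) (\<kappa> t) (X t) (U t) (\<zeta> t)"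
    and T: "T \<in> sets L" "0 < emeasure L T" "emeasure L T < \<infinity>"
    and F: "F \<in> borel_measurable N"
    and Fb: "\<And>\<mu>. \<mu> \<in> Nset L \<Longrightarrow> 0 \<le> F \<mu> \<and> F \<mu> \<le> M"
    and D: "0 \<le> D" "energy P L \<eta> F \<le> ennreal D"
    and t: "0 < t"
  shows "exp (- a * t) * ((1 + a * t) * (\<integral>\<omega>. (F (\<eta> \<omega>))\<^sup>2 \<partial>P) - t * D)
    \<le> (\<integral>\<omega>. F (\<eta> \<omega>) * F (thinning.refresh L T (\<kappa> t \<omega>, X t \<omega>) (U t \<omega>, \<zeta> t \<omega>)) \<partial>P)"
proof -
  define f where "f t = (\<integral>\<omega>. F (\<eta> \<omega>) * F (thinning.refresh L T (\<kappa> t \<omega>, X t \<omega>) (U t \<omega>, \<zeta> t \<omega>)) \<partial>P)" for t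
  have "exp (- a * t) * ((1 + a * t) * (\<integral>\<omega>. (F (\<eta> \<omega>))\<^sup>2 \<partial>P) - t * D) \<le> f t"
  proof (rule log_convex_decay[where C="2 * M\<^sup>2 * (measure L T)\<^sup>2"])
    show "0 \<le> (\<integral>\<omega>. (F (\<eta> \<omega>))\<^sup>2 \<partial>P)" by simp
    fix s :: real assume s: "0 < s"
    interpret A: thinning L S P \<eta> "exp (- s)" "\<kappa> s" "X s" "U s" "\<zeta> s" by (rule fam[OF s])
    interpret B: thinning L S P \<eta> "exp (- (s / 2))" "\<kappa> (s / 2)" "X (s / 2)" "U (s / 2)" "\<zeta> (s / 2)"
      by (rule fam) (use s in simp)
    show "0 \<le> f s"
      unfolding f_def using measurable_space[OF A.xi_meas[OF T(1)]] measurable_space[OF A.eta_meas] Fb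
      by (intro Bochner_Integration.integral_nonneg_AE AE_I2) auto
    have "(exp (- (s / 2)))\<^sup>2 = exp (- s)" by (simp add: power2_eq_square exp_add[symmetric])
    then have "pair_law ((exp (- (s / 2)))\<^sup>2) T P \<eta> (\<lambda>\<omega>. thinning.refresh L T (\<kappa> s \<omega>, X s \<omega>) (U s \<omega>, \<zeta> s \<omega>))"
      using A.pair_law_eta[OF T(1)] by simp
    from B.correlation_square_le[OF T(1) F Fb this]
    show "(f (s / 2))\<^sup>2 \<le> (\<integral>\<omega>. (F (\<eta> \<omega>))\<^sup>2 \<partial>P) * f s"
      by (simp add: f_def)
    interpret C: thinning_cluster L S P \<eta> "exp (- s)" "\<kappa> s" "X s" "U s" "\<zeta> s" T
      by unfold_locales (use T s in auto)
    have e: "0 \<le> 1 - exp (- s)" "1 - exp (- s) \<le> s"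
      using s exp_ge_add_one_self[of "- s"] by auto
    have "(\<integral>\<omega>. (F (\<eta> \<omega>))\<^sup>2 \<partial>P) - f s \<le> (1 - exp (- s)) * D + 2 * M\<^sup>2 * ((1 - exp (- s)) * measure L T)\<^sup>2"
      unfolding f_def by (rule C.correlation_increment[OF F Fb D])
    also have "\<dots> \<le> s * D + 2 * M\<^sup>2 * (s * measure L T)\<^sup>2"
      using e D(1) by (intro add_mono mult_right_mono mult_left_mono power_mono) auto
    finally show "(\<integral>\<omega>. (F (\<eta> \<omega>))\<^sup>2 \<partial>P) - f s \<le> s * D + 2 * M\<^sup>2 * (measure L T)\<^sup>2 * s\<^sup>2"
      by (simp add: power_mult_distrib mult_ac)
  qed (use D t in auto)
  then show ?thesis by (simp add: f_def)
qed

text \<open>The quadratic error depends on the mass of \<open>T\<close>, but it has disappeared from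
  the bound for finite \<open>T\<close>, so the exhaustion can be sent to the whole space.\<close>

lemma correlation_decay_bounded:
  fixes F :: "('a set \<Rightarrow> ennreal) \<Rightarrow> real"
  assumes fam: "\<And>t. 0 < t \<Longrightarrow> thinning L S P \<eta> (exp (- t)) (\<kappa> t) (X t) (U t) (\<zeta> t)"
    and pos: "0 < emeasure L (space L)"
    and F: "F \<in> borel_measurable N"
    and Fb: "\<And>\<mu>. \<mu> \<in> Nset L \<Longrightarrow> 0 \<le> F \<mu> \<and> F \<mu> \<le> M"
    and D: "0 \<le> D" "energy P L \<eta> F \<le> ennreal D"
    and t: "0 < t"
  shows "exp (- a * t) * ((1 + a * t) * (\<integral>\<omega>. (F (\<eta> \<omega>))\<^sup>2 \<partial>P) - t * D)
    \<le> (\<integral>\<omega>. F (\<eta> \<omega>) * F (thinning.refresh L (space L) (\<kappa> t \<omega>, X t \<omega>) (U t \<omega>, \<zeta> t \<omega>)) \<partial>P)"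
proof -
  interpret A: thinning L S P \<eta> "exp (- t)" "\<kappa> t" "X t" "U t" "\<zeta> t" by (rule fam[OF t])
  have "(\<lambda>n. emeasure L (S n)) \<longlonglongrightarrow> emeasure L (\<Union>n. S n)"
    using S_mono by (intro Lim_emeasure_incseq) auto
  then have "\<forall>\<^sub>F n in sequentially. 0 < emeasure L (S n)"
    using pos unfolding S_UN by (rule order_tendstoD)
  then have ev: "\<forall>\<^sub>F n in sequentially. exp (- a * t) * ((1 + a * t) * (\<integral>\<omega>. (F (\<eta> \<omega>))\<^sup>2 \<partial>P) - t * D)
      \<le> (\<integral>\<omega>. F (\<eta> \<omega>) * F (thinning.refresh L (S n) (\<kappa> t \<omega>, X t \<omega>) (U t \<omega>, \<zeta> t \<omega>)) \<partial>P)"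
    by eventually_elim (rule correlation_decay_finite[OF fam S_sets _ S_fin F Fb D t])
  have "(\<lambda>n. \<integral>\<omega>. F (\<eta> \<omega>) * F (A.xi (S n) \<omega>) \<partial>P) \<longlonglongrightarrow> (\<integral>\<omega>. F (\<eta> \<omega>) * F (A.xi (space L) \<omega>) \<partial>P)"
    by (rule A.correlation_tendsto[OF F Fb])
  from tendsto_lowerbound[OF this ev] show ?thesis by simp
qed

text \<open>Truncation at m is a contraction, so it does not increase the energy, and monotone
  convergence removes it. The energy term stands on the right to avoid subtraction in
  \<open>ennreal\<close>.\<close>

lemma correlation_decay:
  fixes F :: "('a set \<Rightarrow> ennreal) \<Rightarrow> real"
  assumes fam: "\<And>t. 0 < t \<Longrightarrow> thinning L S P \<eta> (exp (- t)) (\<kappa> t) (X t) (U t) (\<zeta> t)"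
    and pos: "0 < emeasure L (space L)"
    and F[measurable]: "F \<in> borel_measurable N"
    and F0: "\<And>\<mu>. \<mu> \<in> Nset L \<Longrightarrow> 0 \<le> F \<mu>"
    and t: "0 < t" and a: "0 < a"
  shows "ennreal (exp (- a * t) * (1 + a * t)) * (\<integral>\<^sup>+\<omega>. ennreal ((F (\<eta> \<omega>))\<^sup>2) \<partial>P)
    \<le> (\<integral>\<^sup>+\<omega>. ennreal (F (\<eta> \<omega>) * F (thinning.refresh L (space L) (\<kappa> t \<omega>, X t \<omega>) (U t \<omega>, \<zeta> t \<omega>))) \<partial>P)
      + ennreal (exp (- a * t) * t) * energy P L \<eta> F"
    (is "?c * ?A \<le> ?I + ?d * ?D")
proof (cases "?D = top")
  case True
  then show ?thesis using t by (simp add: ennreal_mult_top)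
next
  case False
  interpret A: thinning L S P \<eta> "exp (- t)" "\<kappa> t" "X t" "U t" "\<zeta> t" by (rule fam[OF t])
  define D where "D = enn2real ?D"
  have D: "0 \<le> D" "?D = ennreal D" using False by (auto simp: D_def less_top)
  define G where "G m \<mu> = min (F \<mu>) (real m)" for m :: nat and \<mu>
  have Gm[measurable]: "G m \<in> borel_measurable N" for m unfolding G_def by measurable
  have Gb: "0 \<le> G m \<mu> \<and> G m \<mu> \<le> real m" "G m \<mu> \<le> F \<mu>" if "\<mu> \<in> Nset L" for m \<mu>
    using F0[OF that] by (auto simp: G_def)
  have etaN: "\<eta> \<omega> \<in> Nset L" and xiN: "A.xi (space L) \<omega> \<in> Nset L" if "\<omega> \<in> space P" for \<omega>
    using measurable_space[OF A.eta_meas that] measurable_space[OF A.xi_meas[OF sets.top] that] by simp_all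
  have xm[measurable]: "A.xi (space L) \<in> measurable P N" by (rule A.xi_meas) simp
  have step: "?c * (\<integral>\<^sup>+\<omega>. ennreal ((G m (\<eta> \<omega>))\<^sup>2) \<partial>P) \<le> ?I + ?d * ?D" for m
  proof -
    have "energy P L \<eta> (G m) \<le> ?D"
      unfolding energy_def
    proof (intro nn_integral_mono ennreal_leI)
      fix \<omega> y
      have "\<bar>G m (cm_add (\<eta> \<omega>) (cm_dirac L y)) - G m (\<eta> \<omega>)\<bar> \<le> \<bar>F (cm_add (\<eta> \<omega>) (cm_dirac L y)) - F (\<eta> \<omega>)\<bar>"
        by (auto simp: G_def min_def)
      then show "(G m (cm_add (\<eta> \<omega>) (cm_dirac L y)) - G m (\<eta> \<omega>))\<^sup>2 \<le> (F (cm_add (\<eta> \<omega>) (cm_dirac L y)) - F (\<eta> \<omega>))\<^sup>2"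
        by (simp add: abs_le_square_iff)
    qed
    then have GD: "energy P L \<eta> (G m) \<le> ennreal D"
      by (simp add: D(2))
    define B where "B = (\<integral>\<omega>. (G m (\<eta> \<omega>))\<^sup>2 \<partial>P)"
    define \<phi> where "\<phi> = (\<integral>\<omega>. G m (\<eta> \<omega>) * G m (A.xi (space L) \<omega>) \<partial>P)"
    have "exp (- a * t) * ((1 + a * t) * B - t * D) \<le> \<phi>"
      unfolding B_def \<phi>_def by (rule correlation_decay_bounded[OF fam pos Gm Gb(1) D(1) GD t])
    then have le: "exp (- a * t) * (1 + a * t) * B \<le> \<phi> + exp (- a * t) * t * D"
      by (simp add: algebra_simps)
    have iB: "integrable P (\<lambda>\<omega>. (G m (\<eta> \<omega>))\<^sup>2)"
      using Gb(1)[OF etaN, of _ m] by (intro A.P.integrable_bounded[where C="(real m)\<^sup>2"]) (auto intro!: power_mono)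
    have i\<phi>: "integrable P (\<lambda>\<omega>. G m (\<eta> \<omega>) * G m (A.xi (space L) \<omega>))"
    proof (rule A.P.integrable_bounded[where C="real m * real m"])
      show "\<bar>G m (\<eta> \<omega>) * G m (A.xi (space L) \<omega>)\<bar> \<le> real m * real m" if "\<omega> \<in> space P" for \<omega>
        using Gb(1)[OF etaN[OF that], of m] Gb(1)[OF xiN[OF that], of m] by (auto simp: abs_mult intro!: mult_mono)
    qed measurable
    have nn: "0 \<le> B" "0 \<le> \<phi>"
      unfolding B_def \<phi>_def using Gb(1)[OF etaN, of _ m] Gb(1)[OF xiN, of _ m]
      by (auto intro!: Bochner_Integration.integral_nonneg_AE AE_I2)
    have "?c * (\<integral>\<^sup>+\<omega>. ennreal ((G m (\<eta> \<omega>))\<^sup>2) \<partial>P) = ennreal (exp (- a * t) * (1 + a * t) * B)"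
      using nn a t by (simp add: nn_integral_eq_integral[OF iB] B_def ennreal_mult)
    also have "\<dots> \<le> ennreal (\<phi> + exp (- a * t) * t * D)" by (intro ennreal_leI le)
    also have "\<dots> = ennreal \<phi> + ?d * ?D"
      using nn D t by (simp add: ennreal_mult)
    also have "ennreal \<phi> = (\<integral>\<^sup>+\<omega>. ennreal (G m (\<eta> \<omega>) * G m (A.xi (space L) \<omega>)) \<partial>P)"
      unfolding \<phi>_def using Gb(1)[OF etaN, of _ m] Gb(1)[OF xiN, of _ m]
      by (intro nn_integral_eq_integral[OF i\<phi>, symmetric] AE_I2) auto
    also have "\<dots> \<le> ?I"
      using Gb[OF etaN, of _ m] Gb[OF xiN, of _ m] by (intro nn_integral_mono ennreal_leI mult_mono) (auto intro: order_trans)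
    finally show ?thesis by (simp add: add_right_mono)
  qed
  have "?A = (\<integral>\<^sup>+\<omega>. (SUP m. ennreal ((G m (\<eta> \<omega>))\<^sup>2)) \<partial>P)"
  proof (rule nn_integral_cong)
    fix \<omega> assume \<omega>: "\<omega> \<in> space P"
    obtain m where "F (\<eta> \<omega>) \<le> real m" using real_arch_simple by blast
    then have "G m (\<eta> \<omega>) = F (\<eta> \<omega>)" by (simp add: G_def)
    then have "ennreal ((F (\<eta> \<omega>))\<^sup>2) \<le> (SUP m. ennreal ((G m (\<eta> \<omega>))\<^sup>2))"
      by (intro SUP_upper2[of m]) auto
    moreover have "(SUP m. ennreal ((G m (\<eta> \<omega>))\<^sup>2)) \<le> ennreal ((F (\<eta> \<omega>))\<^sup>2)"
      using Gb[OF etaN[OF \<omega>]] by (intro SUP_least ennreal_leI power_mono) auto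
    ultimately show "ennreal ((F (\<eta> \<omega>))\<^sup>2) = (SUP m. ennreal ((G m (\<eta> \<omega>))\<^sup>2))" by (rule antisym)
  qed
  \<comment> \<open>Squares of truncations increase with m only for nonnegative values, which are
    known on \<open>space P\<close>; the indicator makes the sequence monotone everywhere.\<close>
  also have "\<dots> = (SUP m. \<integral>\<^sup>+\<omega>. ennreal ((G m (\<eta> \<omega>))\<^sup>2) * indicator (space P) \<omega> \<partial>P)"
  proof (subst nn_integral_monotone_convergence_SUP[symmetric])
    show "incseq (\<lambda>m \<omega>. ennreal ((G m (\<eta> \<omega>))\<^sup>2) * indicator (space P) \<omega>)"
      using Gb(1)[OF etaN]
      by (auto simp: incseq_def le_fun_def G_def min_def F0 etaN split: split_indicator intro!: ennreal_leI power_mono)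
  qed (auto intro!: nn_integral_cong)
  also have "\<dots> = (SUP m. \<integral>\<^sup>+\<omega>. ennreal ((G m (\<eta> \<omega>))\<^sup>2) \<partial>P)"
    by (intro SUP_cong nn_integral_cong) auto
  finally show ?thesis
    using step by (auto simp: SUP_mult_left_ennreal intro!: SUP_least)
qed

end

text \<open>All points lie in \<open>space L\<close>, so for \<open>T = space L\<close> the clause
  sparing points outside \<open>T\<close> is void and restricting the noise changes nothing.\<close>

lemma thinned_superposition_thinning:
  assumes ex: "exhaustion L S" and pp: "poisson_process P L \<eta>" and p: "0 < p" "p \<le> 1"
    and th: "thinned_superposition P L \<eta> p \<xi>"
  obtains \<kappa> X U \<zeta> where "thinning L S P \<eta> p \<kappa> X U \<zeta>"
    "\<And>\<omega>. \<omega> \<in> space P \<Longrightarrow> \<xi> \<omega> = thinning.refresh L (space L) (\<kappa> \<omega>, X \<omega>) (U \<omega>, \<zeta> \<omega>)"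
proof -
  have NN: "N_meas (scale_measure (ennreal (1 - p)) L) = N_meas L"
    by (rule N_meas_cong) (simp_all add: space_scale_measure)
  show ?thesis
    using th unfolding thinned_superposition_def NN
  proof (elim exE conjE)
    fix \<kappa> :: "'b \<Rightarrow> enat" and X :: "'b \<Rightarrow> nat \<Rightarrow> 'a" and U :: "'b \<Rightarrow> nat \<Rightarrow> bool" and \<zeta>
    assume *:
      "(\<lambda>\<omega>. (\<kappa> \<omega>, X \<omega>)) \<in> measurable P (count_space UNIV \<Otimes>\<^sub>M (\<Pi>\<^sub>M i\<in>UNIV. L))"
      "U \<in> measurable P (\<Pi>\<^sub>M i\<in>UNIV. count_space UNIV)"
      "distr P (\<Pi>\<^sub>M i\<in>UNIV. count_space UNIV) U = (\<Pi>\<^sub>M i\<in>UNIV. measure_pmf (bernoulli_pmf p))"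
      "poisson_process P (scale_measure (ennreal (1 - p)) L) \<zeta>"
      "prob_space.indep_set P
          (sets (vimage_algebra (space P) (\<lambda>\<omega>. (\<kappa> \<omega>, X \<omega>)) (count_space UNIV \<Otimes>\<^sub>M (\<Pi>\<^sub>M i\<in>UNIV. L))))
          (sets (vimage_algebra (space P) (\<lambda>\<omega>. (U \<omega>, \<zeta> \<omega>)) ((\<Pi>\<^sub>M i\<in>UNIV. count_space UNIV) \<Otimes>\<^sub>M N_meas L)))"
      "prob_space.indep_set P
          (sets (vimage_algebra (space P) U (\<Pi>\<^sub>M i\<in>UNIV. count_space UNIV)))
          (sets (vimage_algebra (space P) \<zeta> (N_meas L)))"
    and \<eta>: "\<forall>\<omega>\<in>space P. \<eta> \<omega> = (\<lambda>B. if B \<in> sets L then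
            (\<Sum>i. if enat i < \<kappa> \<omega> then indicator B (X \<omega> i) else 0) else 0)"
    and \<xi>: "\<forall>\<omega>\<in>space P. \<xi> \<omega> = (\<lambda>B. if B \<in> sets L then
            (\<Sum>i. if enat i < \<kappa> \<omega> \<and> U \<omega> i then indicator B (X \<omega> i) else 0) + \<zeta> \<omega> B
            else 0)"
  have th: "thinning L S P \<eta> p \<kappa> X U \<zeta>"
    by (intro thinning.intro thinning_axioms.intro ex pp p *) (use \<eta> in \<open>simp add: pts_def\<close>)
  interpret thinning L S P \<eta> p \<kappa> X U \<zeta> by (rule th)
  have "\<xi> \<omega> = thinning.refresh L (space L) (\<kappa> \<omega>, X \<omega>) (U \<omega>, \<zeta> \<omega>)" if \<omega>: "\<omega> \<in> space P" for \<omega>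
  proof
    fix B
    have \<zeta>N: "\<zeta> \<omega> \<in> Nset L" using measurable_space[OF zeta_meas \<omega>] by simp
    have XL: "X \<omega> i \<in> space L" for i
      using measurable_space[OF KX \<omega>] by (auto simp: space_pair_measure space_PiM)
    show "\<xi> \<omega> B = thinning.refresh L (space L) (\<kappa> \<omega>, X \<omega>) (U \<omega>, \<zeta> \<omega>) B"
      using \<xi> \<omega> XL sets.sets_into_space[of B L]
      by (auto simp: refresh_def cm_add_def thin_def pts_def restr_def Int_absorb2)
  qed
  with th show thesis by (rule that)
  qed
qed

theorem theorem2p8:
  fixes P :: "'w measure" and lam :: "'a measure"
    and \<eta> :: "'w \<Rightarrow> 'a set \<Rightarrow> ennreal"
    and \<xi> :: "real \<Rightarrow> 'w \<Rightarrow> 'a set \<Rightarrow> ennreal"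
    and g :: "'a \<Rightarrow> ('a set \<Rightarrow> ennreal) \<Rightarrow> real"
    and \<alpha> :: real
  assumes sf: "sigma_finite_measure lam"
    and pp: "poisson_process P lam \<eta>"
    and eta_t: "\<And>t. t \<ge> 0 \<Longrightarrow> thinned_superposition P lam \<eta> (exp (- t)) (\<xi> t)"
    and g_meas: "(\<lambda>(x, \<mu>). g x \<mu>) \<in> borel_measurable (lam \<Otimes>\<^sub>M N_meas lam)"
    and g_nonneg: "\<And>x \<mu>. x \<in> space lam \<Longrightarrow> \<mu> \<in> Nset lam \<Longrightarrow> g x \<mu> \<ge> 0"
    and g_sq: "AE x in lam. (\<integral>\<^sup>+ \<omega>. ennreal ((g x (\<eta> \<omega>))\<^sup>2) \<partial>P) < \<infinity>"
    and alpha_pos: "\<alpha> > 0"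
    and poincare: "(\<integral>\<^sup>+ \<omega>. (\<integral>\<^sup>+ xy. ennreal ((Dop lam g (snd xy) (fst xy) (\<eta> \<omega>))\<^sup>2)
                        \<partial>(lam \<Otimes>\<^sub>M lam)) \<partial>P)
              \<le> ennreal \<alpha> * (\<integral>\<^sup>+ \<omega>. (\<integral>\<^sup>+ x. ennreal ((g x (\<eta> \<omega>))\<^sup>2) \<partial>lam) \<partial>P)"
    and finite: "(\<integral>\<^sup>+ \<omega>. (\<integral>\<^sup>+ x. ennreal ((g x (\<eta> \<omega>))\<^sup>2) \<partial>lam) \<partial>P) < \<infinity>"
  shows "(\<integral>\<^sup>+ t\<in>{0..}. ennreal (exp (- t)) *
            (\<integral>\<^sup>+ x. (\<integral>\<^sup>+ \<omega>. ennreal (g x (\<eta> \<omega>) * g x (\<xi> t \<omega>)) \<partial>P) \<partial>lam) \<partial>lborel)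
         \<ge> ennreal (1 / (\<alpha> + 1)) * (\<integral>\<^sup>+ \<omega>. (\<integral>\<^sup>+ x. ennreal ((g x (\<eta> \<omega>))\<^sup>2) \<partial>lam) \<partial>P)"
proof -
  interpret lam: sigma_finite_measure lam by (rule sf)
  interpret P: prob_space P using pp by (simp add: poisson_process_def)
  interpret Pl: pair_sigma_finite P lam ..
  define A where "A = (\<integral>\<^sup>+ \<omega>. (\<integral>\<^sup>+ x. ennreal ((g x (\<eta> \<omega>))\<^sup>2) \<partial>lam) \<partial>P)"
  have [measurable]: "\<eta> \<in> measurable P (N_meas lam)" using pp by (simp add: poisson_process_def)
  have gm: "(\<lambda>z. g (u z) (v z)) \<in> borel_measurable M"
    if "u \<in> measurable M lam" "v \<in> measurable M (N_meas lam)" for u v and M :: "'c measure"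
    using measurable_compose[OF measurable_Pair[OF that] g_meas] by simp
  have A_swap: "A = (\<integral>\<^sup>+ x. (\<integral>\<^sup>+ \<omega>. ennreal ((g x (\<eta> \<omega>))\<^sup>2) \<partial>P) \<partial>lam)"
  proof -
    have [measurable]: "(\<lambda>z. g (snd z) (\<eta> (fst z))) \<in> borel_measurable (P \<Otimes>\<^sub>M lam)" by (rule gm) measurable
    have "(\<lambda>z. ennreal ((g (snd z) (\<eta> (fst z)))\<^sup>2)) \<in> borel_measurable (P \<Otimes>\<^sub>M lam)" by measurable
    then show ?thesis unfolding A_def by (intro Pl.Fubini'[symmetric]) (simp add: split_beta')
  qed
  show ?thesis
  proof (cases "emeasure lam (space lam) = 0")
    \<comment> \<open>Without mass there is no set of positive finite intensity on which clusters
      could be normalised, but then the second moment vanishes.\<close>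
    case True
    have "A = 0" unfolding A_swap
      using nn_integral_null_set[of "space lam" lam] True
      by (subst nn_integral_cong[where v="\<lambda>x. (\<integral>\<^sup>+ \<omega>. ennreal ((g x (\<eta> \<omega>))\<^sup>2) \<partial>P) * indicator (space lam) x"])
        (auto simp: null_sets_def intro!: nn_integral_null_set)
    then show ?thesis by (simp add: A_def[symmetric])
  next
    case False
    obtain S :: "nat \<Rightarrow> 'a set" where S: "range S \<subseteq> sets lam" "(\<Union>i. S i) = space lam"
      "\<And>i. emeasure lam (S i) \<noteq> \<infinity>" "incseq S"
      using lam.sigma_finite_incseq by blast
    interpret exhaustion lam S
      by unfold_locales (use S in \<open>auto simp: less_top\<close>)
    \<comment> \<open>Time 0 is left out: there the retention is 1 and the cluster rate would be 0,
      which \<open>finite_cluster\<close> excludes. It is a null set for the time integral.\<close>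
    have "\<exists>\<kappa> X U \<zeta>. thinning lam S P \<eta> (exp (- t)) \<kappa> X U \<zeta>
        \<and> (\<forall>\<omega>\<in>space P. \<xi> t \<omega> = thinning.refresh lam (space lam) (\<kappa> \<omega>, X \<omega>) (U \<omega>, \<zeta> \<omega>))"
      if t: "0 < t" for t
    proof -
      have "thinned_superposition P lam \<eta> (exp (- t)) (\<xi> t)" "exp (- t) \<le> 1" using t eta_t by auto
      from thinned_superposition_thinning[OF exhaustion_axioms pp exp_gt_zero this(2,1)]
      obtain \<kappa> X U \<zeta> where "thinning lam S P \<eta> (exp (- t)) \<kappa> X U \<zeta>"
        "\<And>\<omega>. \<omega> \<in> space P \<Longrightarrow> \<xi> t \<omega> = thinning.refresh lam (space lam) (\<kappa> \<omega>, X \<omega>) (U \<omega>, \<zeta> \<omega>)"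
        by blast
      then show ?thesis by (intro exI[of _ \<kappa>] exI[of _ X] exI[of _ U] exI[of _ \<zeta>]) simp
    qed
    then obtain \<kappa> X U \<zeta> where th: "\<And>t. 0 < t \<Longrightarrow> thinning lam S P \<eta> (exp (- t)) (\<kappa> t) (X t) (U t) (\<zeta> t)"
      and \<xi>: "\<And>t \<omega>. 0 < t \<Longrightarrow> \<omega> \<in> space P \<Longrightarrow>
        \<xi> t \<omega> = thinning.refresh lam (space lam) (\<kappa> t \<omega>, X t \<omega>) (U t \<omega>, \<zeta> t \<omega>)"
      by metis
    define D where "D x = energy P lam \<eta> (g x)" for x
    have dm: "(\<lambda>z. g (u z) (cm_add (\<eta> (w z)) (cm_dirac lam (v z))) - g (u z) (\<eta> (w z))) \<in> borel_measurable M"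
      if [measurable]: "u \<in> measurable M lam" "v \<in> measurable M lam" "w \<in> measurable M P" for u v w and M :: "'c measure"
    proof -
      have [measurable]: "(\<lambda>z. cm_dirac lam (v z)) \<in> measurable M (N_meas lam)"
        by (rule measurable_compose[OF that(2) measurable_cm_dirac])
      show ?thesis by (intro borel_measurable_diff gm) measurable
    qed
    \<comment> \<open>Tonelli moves the expectation outside, and the two inner integrals combine
      into the integral over the product that occurs in the hypothesis.\<close>
    have D_int: "(\<integral>\<^sup>+x. D x \<partial>lam) \<le> ennreal \<alpha> * A"
    proof -
      have "(\<integral>\<^sup>+x. D x \<partial>lam)
          = (\<integral>\<^sup>+\<omega>. (\<integral>\<^sup>+x. (\<integral>\<^sup>+y. ennreal ((g x (cm_add (\<eta> \<omega>) (cm_dirac lam y)) - g x (\<eta> \<omega>))\<^sup>2) \<partial>lam) \<partial>lam) \<partial>P)"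
        unfolding D_def energy_def
      proof (rule Pl.Fubini')
        have [measurable]: "(\<lambda>z. g (snd (fst z)) (cm_add (\<eta> (fst (fst z))) (cm_dirac lam (snd z))) - g (snd (fst z)) (\<eta> (fst (fst z))))
            \<in> borel_measurable ((P \<Otimes>\<^sub>M lam) \<Otimes>\<^sub>M lam)" by (rule dm) measurable
        have "(\<lambda>z. \<integral>\<^sup>+y. ennreal ((g (snd z) (cm_add (\<eta> (fst z)) (cm_dirac lam y)) - g (snd z) (\<eta> (fst z)))\<^sup>2) \<partial>lam)
            \<in> borel_measurable (P \<Otimes>\<^sub>M lam)"
          by (rule lam.borel_measurable_nn_integral) (simp add: split_beta')
        then show "(\<lambda>(\<omega>, x). \<integral>\<^sup>+y. ennreal ((g x (cm_add (\<eta> \<omega>) (cm_dirac lam y)) - g x (\<eta> \<omega>))\<^sup>2) \<partial>lam)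
            \<in> borel_measurable (P \<Otimes>\<^sub>M lam)" by (simp add: split_beta')
      qed
      also have "\<dots> = (\<integral>\<^sup>+ \<omega>. (\<integral>\<^sup>+ xy. ennreal ((Dop lam g (snd xy) (fst xy) (\<eta> \<omega>))\<^sup>2) \<partial>(lam \<Otimes>\<^sub>M lam)) \<partial>P)"
      proof (rule nn_integral_cong)
        fix \<omega> assume \<omega>: "\<omega> \<in> space P"
        have [measurable]: "(\<lambda>z. g (fst z) (cm_add (\<eta> \<omega>) (cm_dirac lam (snd z))) - g (fst z) (\<eta> \<omega>)) \<in> borel_measurable (lam \<Otimes>\<^sub>M lam)"
          by (rule dm[OF measurable_fst measurable_snd measurable_const[OF \<omega>]])
        show "(\<integral>\<^sup>+x. (\<integral>\<^sup>+y. ennreal ((g x (cm_add (\<eta> \<omega>) (cm_dirac lam y)) - g x (\<eta> \<omega>))\<^sup>2) \<partial>lam) \<partial>lam)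
            = (\<integral>\<^sup>+ xy. ennreal ((Dop lam g (snd xy) (fst xy) (\<eta> \<omega>))\<^sup>2) \<partial>(lam \<Otimes>\<^sub>M lam))"
          unfolding Dop_def by (subst lam.nn_integral_fst[symmetric]) auto
      qed
      finally show ?thesis using poincare by (simp add: A_def)
    qed
    have Dm: "D \<in> borel_measurable lam"
    proof -
      have [measurable]: "(\<lambda>z. g (fst (fst z)) (cm_add (\<eta> (snd (fst z))) (cm_dirac lam (snd z))) - g (fst (fst z)) (\<eta> (snd (fst z))))
          \<in> borel_measurable ((lam \<Otimes>\<^sub>M P) \<Otimes>\<^sub>M lam)" by (rule dm) measurable
      have "(\<lambda>z. \<integral>\<^sup>+y. ennreal ((g (fst z) (cm_add (\<eta> (snd z)) (cm_dirac lam y)) - g (fst z) (\<eta> (snd z)))\<^sup>2) \<partial>lam)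
          \<in> borel_measurable (lam \<Otimes>\<^sub>M P)"
        by (rule lam.borel_measurable_nn_integral) (simp add: split_beta')
      then show ?thesis
        unfolding D_def energy_def by (intro P.borel_measurable_nn_integral) (simp add: split_beta')
    qed
    define I where "I t = (\<integral>\<^sup>+ x. (\<integral>\<^sup>+ \<omega>. ennreal (g x (\<eta> \<omega>) * g x (\<xi> t \<omega>)) \<partial>P) \<partial>lam)" for t
    \<comment> \<open>With a = \<alpha> the gain \<alpha> t A from the tangent pays exactly for t
      times the integral of \<open>D\<close>, which is at most \<alpha> t A.\<close>
    have I_ge: "ennreal (exp (- \<alpha> * t)) * A \<le> I t" if t: "0 < t" for t
    proof -
      interpret K: thinning lam S P \<eta> "exp (- t)" "\<kappa> t" "X t" "U t" "\<zeta> t"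
        by (rule th[OF t])
      have \<xi>m[measurable]: "\<xi> t \<in> measurable P (N_meas lam)"
        using K.xi_meas[OF sets.top] \<xi>[OF t] by (subst measurable_cong) auto
      have [measurable]: "(\<lambda>z. g (fst z) (\<eta> (snd z))) \<in> borel_measurable (lam \<Otimes>\<^sub>M P)"
        "(\<lambda>z. g (fst z) (\<xi> t (snd z))) \<in> borel_measurable (lam \<Otimes>\<^sub>M P)"
        by (rule gm; measurable)+
      have Im: "(\<lambda>x. \<integral>\<^sup>+ \<omega>. ennreal (g x (\<eta> \<omega>) * g x (\<xi> t \<omega>)) \<partial>P) \<in> borel_measurable lam"
        by (rule P.borel_measurable_nn_integral) (simp add: split_beta')
      have Am: "(\<lambda>x. \<integral>\<^sup>+ \<omega>. ennreal ((g x (\<eta> \<omega>))\<^sup>2) \<partial>P) \<in> borel_measurable lam"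
        by (rule P.borel_measurable_nn_integral) (simp add: split_beta')
      let ?d = "ennreal (exp (- \<alpha> * t) * t)"
      have "ennreal (exp (- \<alpha> * t) * (1 + \<alpha> * t)) * A
          = (\<integral>\<^sup>+ x. ennreal (exp (- \<alpha> * t) * (1 + \<alpha> * t)) * (\<integral>\<^sup>+ \<omega>. ennreal ((g x (\<eta> \<omega>))\<^sup>2) \<partial>P) \<partial>lam)"
        unfolding A_swap by (rule nn_integral_cmult[OF Am, symmetric])
      also have "\<dots> \<le> (\<integral>\<^sup>+ x. (\<integral>\<^sup>+ \<omega>. ennreal (g x (\<eta> \<omega>) * g x (\<xi> t \<omega>)) \<partial>P) + ?d * D x \<partial>lam)"
      proof (rule nn_integral_mono)
        fix x assume x: "x \<in> space lam"
        have gx: "g x \<in> borel_measurable (N_meas lam)"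
          using gm[OF measurable_const[OF x] measurable_ident] by simp
        have "(\<integral>\<^sup>+ \<omega>. ennreal (g x (\<eta> \<omega>) * g x (\<xi> t \<omega>)) \<partial>P)
            = (\<integral>\<^sup>+ \<omega>. ennreal (g x (\<eta> \<omega>) * g x (K.xi (space lam) \<omega>)) \<partial>P)"
          by (intro nn_integral_cong) (simp add: \<xi>[OF t])
        then show "ennreal (exp (- \<alpha> * t) * (1 + \<alpha> * t)) * (\<integral>\<^sup>+ \<omega>. ennreal ((g x (\<eta> \<omega>))\<^sup>2) \<partial>P)
            \<le> (\<integral>\<^sup>+ \<omega>. ennreal (g x (\<eta> \<omega>) * g x (\<xi> t \<omega>)) \<partial>P) + ?d * D x"
          using correlation_decay[OF th _ gx g_nonneg[OF x] t alpha_pos] False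
          by (simp add: D_def zero_less_iff_neq_zero)
      qed
      also have "\<dots> = I t + ?d * (\<integral>\<^sup>+x. D x \<partial>lam)"
        using Im Dm by (simp add: nn_integral_add nn_integral_cmult I_def)
      also have "\<dots> \<le> I t + ?d * (ennreal \<alpha> * A)"
        by (intro add_left_mono mult_left_mono D_int) simp
      also have "?d * (ennreal \<alpha> * A) = ennreal (exp (- \<alpha> * t) * (\<alpha> * t)) * A"
        using t alpha_pos by (simp add: ennreal_mult mult_ac)
      finally have "ennreal (exp (- \<alpha> * t)) * A + ennreal (exp (- \<alpha> * t) * (\<alpha> * t)) * A
          \<le> I t + ennreal (exp (- \<alpha> * t) * (\<alpha> * t)) * A"
        using t alpha_pos by (simp add: distrib_left distrib_right)
      \<comment> \<open>Cancelling a common term in \<open>ennreal\<close> requires it to be finite;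
        finiteness of the second moment supplies this.\<close>
      moreover have "ennreal (exp (- \<alpha> * t) * (\<alpha> * t)) * A \<noteq> top"
        using finite by (simp add: A_def ennreal_mult_eq_top_iff)
      ultimately show ?thesis
        using ennreal_add_left_cancel_le[of "ennreal (exp (- \<alpha> * t) * (\<alpha> * t)) * A" "ennreal (exp (- \<alpha> * t)) * A" "I t"]
        by (simp only: add.commute infinity_ennreal_def) simp
    qed
    have "ennreal (1 / (\<alpha> + 1)) * A = (\<integral>\<^sup>+ t. ennreal (exp (- (\<alpha> + 1) * t)) * indicator {0..} t * A \<partial>lborel)"
    proof -
      have "(\<integral>\<^sup>+ t. ennreal (exp (- (\<alpha> + 1) * t)) * indicator {0..} t \<partial>lborel) = ennreal (1 / (\<alpha> + 1))"
      proof -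
        have "(\<integral>\<^sup>+ t. ennreal (exp (- (\<alpha> + 1) * t)) * indicator {0..} t \<partial>lborel)
            = ennreal (0 - (- exp (- (\<alpha> + 1) * 0) / (\<alpha> + 1)))"
        proof (rule nn_integral_FTC_atLeast)
          show "((\<lambda>t. - exp (- (\<alpha> + 1) * t) / (\<alpha> + 1)) has_real_derivative exp (- (\<alpha> + 1) * t)) (at t)" for t
            by (rule has_real_derivative_exp_scaled) (use alpha_pos in simp)
          have "((\<lambda>t. - exp (- (\<alpha> + 1) * t) / (\<alpha> + 1)) \<longlongrightarrow> - 0 / (\<alpha> + 1)) at_top"
            using alpha_pos
            by (intro tendsto_intros filterlim_compose[OF exp_at_bot] filterlim_tendsto_neg_mult_at_bot[OF tendsto_const _ filterlim_ident]) auto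
          then show "((\<lambda>t. - exp (- (\<alpha> + 1) * t) / (\<alpha> + 1)) \<longlongrightarrow> 0) at_top" by simp
        qed auto
        then show ?thesis by simp
      qed
      then show ?thesis by (subst nn_integral_multc) auto
    qed
    also have "\<dots> \<le> (\<integral>\<^sup>+ t\<in>{0..}. ennreal (exp (- t)) * I t \<partial>lborel)"
    proof (rule nn_integral_mono_AE)
      have "AE t in lborel. t \<noteq> (0::real)" by (rule AE_lborel_singleton)
      then show "AE t in lborel. ennreal (exp (- (\<alpha> + 1) * t)) * indicator {0..} t * A
          \<le> ennreal (exp (- t)) * I t * indicator {0..} t"
      proof eventually_elim
        fix t :: real assume "t \<noteq> 0"
        show "ennreal (exp (- (\<alpha> + 1) * t)) * indicator {0..} t * A \<le> ennreal (exp (- t)) * I t * indicator {0..} t"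
        proof (cases "0 < t")
          case True
          have "exp (- (\<alpha> + 1) * t) = exp (- t) * exp (- \<alpha> * t)"
            by (simp add: exp_add[symmetric] algebra_simps)
          then have "ennreal (exp (- (\<alpha> + 1) * t)) * A = ennreal (exp (- t)) * (ennreal (exp (- \<alpha> * t)) * A)"
            by (simp add: ennreal_mult mult.assoc)
          also have "\<dots> \<le> ennreal (exp (- t)) * I t"
            by (intro mult_left_mono I_ge True) simp
          finally show ?thesis using True by simp
        qed (use \<open>t \<noteq> 0\<close> in simp)
      qed
    qed
    finally show ?thesis unfolding A_def I_def .
  qed
qed

end
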